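(* Let $P$ be a cominuscule maximal parabolic and $H(\boldsymbol{d};\boldsymbol{t})$ the exponential sum defined in the context. Let $\boldsymbol{d}=(d_1,\dots,d_N)$ with $d_i=e_if_i$, $e_i,f_i\in\mathfrak{o}_S$ nonzero, such that $\gcd(e_1\cdots e_N,f_1\cdots f_N)=1$, and set $$E_k=e_k\prod_{\ell=k+1}^Ne_\ell^{\langle\gamma_k,\gamma_\ell^\vee\rangle},\qquad F_k=f_k\prod_{\ell=k+1}^Nf_\ell^{\langle\gamma_k,\gamma_\ell^\vee\rangle}.$$ Then for every $\boldsymbol{t}$, $$H(\boldsymbol{d};\boldsymbol{t})=\prod_{k=1}^N\left(\frac{E_k}{f_k}\right)^{q_k}\left(\frac{F_k}{e_k}\right)^{q_k}\,H(e_1,\dots,e_N;\boldsymbol{t})\,H(f_1,\dots,f_N;\boldsymbol{t}).$$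
   Context: Setting: $n\ge1$; $F$ a totally complex number field containing the $2n$-th roots of unity; $S$ a finite set of places containing the archimedean and ramified places with $\mathfrak{o}_S$ a PID; $F_S=\prod_{v\in S}F_v$ with $\mathfrak{o}_S$ embedded diagonally; $\left(\frac{c}{d}\right)$ is the $n$-th power residue symbol for coprime $c,d\in\mathfrak{o}_S$ ($=1$ if $d$ is a unit). $\psi$ is a character of $F_S$ trivial on $\mathfrak{o}_S$ but on no larger fractional ideal. $G$ is a split connected reductive group of rank $r$ with simple roots $\alpha_1,\dots,\alpha_r$, coroots $\gamma^\vee$, pairing $\langle\cdot,\cdot\rangle$, and integer Steinberg structure constants $\eta_{\alpha,\beta;i,j}$ in $e_\alpha(s)e_\beta(t)e_\alpha(s)^{-1}=e_\beta(t)\prod_{i\alpha+j\beta=\gamma\in\Phi,\,i,j>0}e_\gamma(\eta_{\alpha,\beta;i,j}s^it^j)$. $P=MU^P$ is a maximal standard parabolic which is cominuscule (its omitted simple root $\alpha_{i_0}$ has coefficient $1$ in the highest root). With $w_0=w_Mw^P$ and a reduced word $(i_1,\dots,i_{t+N})$ for $w_0$ whose first $t$ letters give the long element $w_M$ of $M$'s Weyl group, $\gamma_k=w_Ms_{i_{t+1}}\cdots s_{i_{t+k-1}}(\alpha_{i_{t+k}})$, $k=1,\dots,N$, are the roots of $U^P$. $q_k=Q(\gamma_k^\vee)\in\mathbb{Z}$ for a fixed $W$-invariant integral quadratic form $Q$ on the cocharacter lattice. For nonzero $d_1,\dots,d_N\in\mathfrak{o}_S$ put $D_k=d_k\prod_{\ell=k+1}^Nd_\ell^{\langle\gamma_k,\gamma_\ell^\vee\rangle}$.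 For $j\ne i_0$ let $\mathcal{S}_j$ be the set of pairs $(k,k')$ with $k>k'$ and $i\gamma_k-i'\gamma_{k'}=-\alpha_j$ for positive integers $i,i'$. For $\boldsymbol{t}=(t_1,\dots,t_r)$ of nonzero $S$-integers, $$H(\boldsymbol{d};\boldsymbol{t})=\sum_{c_1,\dots,c_N}\psi\Big(\sum_{j=1}^rt_jv_j\Big)\prod_{k=1}^N\left(\frac{c_k}{d_k}\right)^{q_k},$$ where $c_k$ runs over residues modulo $D_k$ with $\gcd(c_k,d_k)=1$; $b_k\in\mathfrak{o}_S$ is chosen with $a_kd_k-b_kc_k=1$ for some $a_k$; $v_{i_0}=c_N/d_N$; and for $j\neq i_0$, $v_j=\sum_{(k,k')\in\mathcal{S}_j}(-1)^{i+i'}\eta_{\gamma_k,-\gamma_{k'};i,i'}(b_kd_k^{-1})^i(c_{k'}d_{k'}^{-1})^{i'}\prod_{\ell\ge k}(d_\ell^{-1})^{\langle\alpha_j,\gamma_\ell^\vee\rangle}\prod_{k'<\ell<k}(d_\ell^{-1})^{i'\langle\gamma_{k'},\gamma_\ell^\vee\rangle}$.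
   Formalization: H(d;t) can depend on the chosen b_k, so the identity is stated when H(d;t) is independent of the choice of residues c_k and b_k; for general d it holds, given any choices in H(e;t) and H(f;t), for some admissible choice of the b_k in H(d;t). *)

theory Defs
  imports
    "HOL-Analysis.Analysis"
    "HOL-Algebra.QuotRing"
    "HOL-Algebra.Ring_Divisibility"
    "HOL-Algebra.Generated_Groups"
begin

section \<open>Number fields, places and completions\<close>

class number_field = field_char_0 +
  assumes finite_dim_over_rat:
    "\<exists>B. finite B \<and> (\<forall>x. \<exists>c. x = (\<Sum>b\<in>B. of_rat (c b) * b))"

definition totally_complex :: "'f::number_field itself \<Rightarrow> bool" where
  "totally_complex _ \<longleftrightarrow>
     \<not> (\<exists>\<sigma> :: 'f \<Rightarrow> real. \<sigma> 1 = 1 \<and> (\<forall>x y. \<sigma> (x + y) = \<sigma> x + \<sigma> y) \<and> (\<forall>x y. \<sigma> (x * y) = \<sigma> x * \<sigma> y))"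

definition roots_of_unity :: "nat \<Rightarrow> 'f::field set" where
  "roots_of_unity m = {x. x ^ m = 1}"

definition absolute_value :: "('f::field \<Rightarrow> real) \<Rightarrow> bool" where
  "absolute_value v \<longleftrightarrow>
     (\<forall>x. v x \<ge> 0) \<and> (\<forall>x. v x = 0 \<longleftrightarrow> x = 0) \<and>
     (\<forall>x y. v (x * y) = v x * v y) \<and> (\<forall>x y. v (x + y) \<le> v x + v y)"

definition nontrivial_absolute_value :: "('f::field \<Rightarrow> real) \<Rightarrow> bool" where
  "nontrivial_absolute_value v \<longleftrightarrow> absolute_value v \<and> (\<exists>x. x \<noteq> 0 \<and> v x \<noteq> 1)"

definition equivalent_absolute_values :: "('f::field \<Rightarrow> real) \<Rightarrow> ('f \<Rightarrow> real) \<Rightarrow> bool" where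
  "equivalent_absolute_values v w \<longleftrightarrow> (\<exists>s>0. \<forall>x. w x = v x powr s)"

type_synonym 'f place = "('f \<Rightarrow> real) set"

definition places :: "'f::field place set" where
  "places = {{w. absolute_value w \<and> equivalent_absolute_values v w} | v. nontrivial_absolute_value v}"

text \<open>A representative of the equivalence class. All notions below that use it depend only on the class.\<close>

definition place_abs :: "'f place \<Rightarrow> 'f \<Rightarrow> real" where
  "place_abs P = (SOME v. v \<in> P)"

definition archimedean_place :: "'f::field place \<Rightarrow> bool" where
  "archimedean_place P \<longleftrightarrow>
     P \<in> places \<and> \<not> (\<forall>x y. place_abs P (x + y) \<le> max (place_abs P x) (place_abs P y))"

text \<open>Ramified over the rationals: the value group of the field is strictly larger than that of the
  rational numbers, i.e. the ramification index exceeds 1.\<close>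

definition ramified_place :: "'f::number_field place \<Rightarrow> bool" where
  "ramified_place P \<longleftrightarrow>
     P \<in> places \<and> \<not> archimedean_place P \<and>
     (\<exists>x. x \<noteq> 0 \<and> (\<forall>q. place_abs P x \<noteq> place_abs P (of_rat q)))"

definition S_integers :: "'f::field place set \<Rightarrow> 'f ring" where
  "S_integers S =
     \<lparr>carrier = {x. \<forall>P\<in>places - S. place_abs P x \<le> 1},
      monoid.mult = (*), one = 1, zero = 0, add = (+)\<rparr>"

definition fractional_ideal :: "'f::field place set \<Rightarrow> 'f set \<Rightarrow> bool" where
  "fractional_ideal S I \<longleftrightarrow>
     0 \<in> I \<and> I \<noteq> {0} \<and> (\<forall>x\<in>I. \<forall>y\<in>I. x + y \<in> I) \<and>
     (\<forall>a\<in>carrier (S_integers S). \<forall>x\<in>I. a * x \<in> I) \<and>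
     (\<exists>a\<in>carrier (S_integers S). a \<noteq> 0 \<and> (\<forall>x\<in>I. a * x \<in> carrier (S_integers S)))"

text \<open>The completion at a place is the ring of Cauchy sequences modulo null sequences.\<close>

definition cauchy_ring :: "'f::field place \<Rightarrow> (nat \<Rightarrow> 'f) ring" where
  "cauchy_ring P =
     \<lparr>carrier = {s. \<forall>\<epsilon>>0. \<exists>M. \<forall>m\<ge>M. \<forall>n\<ge>M. place_abs P (s m - s n) < \<epsilon>},
      monoid.mult = (\<lambda>s s' n. s n * s' n), one = (\<lambda>_. 1), zero = (\<lambda>_. 0),
      add = (\<lambda>s s' n. s n + s' n)\<rparr>"

definition null_sequences :: "'f::field place \<Rightarrow> (nat \<Rightarrow> 'f) set" where
  "null_sequences P = {s. (\<lambda>n. place_abs P (s n)) \<longlonglongrightarrow> 0}"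

definition completion :: "'f::field place \<Rightarrow> (nat \<Rightarrow> 'f) set ring" where
  "completion P = cauchy_ring P Quot null_sequences P"

definition completion_embed :: "'f::field place \<Rightarrow> 'f \<Rightarrow> (nat \<Rightarrow> 'f) set" where
  "completion_embed P x = null_sequences P +>\<^bsub>cauchy_ring P\<^esub> (\<lambda>_. x)"

definition completion_dist :: "'f::field place \<Rightarrow> (nat \<Rightarrow> 'f) set \<Rightarrow> (nat \<Rightarrow> 'f) set \<Rightarrow> real" where
  "completion_dist P X Y = (THE l. \<exists>s\<in>X. \<exists>s'\<in>Y. (\<lambda>n. place_abs P (s n - s' n)) \<longlonglongrightarrow> l)"

definition completion_topology :: "'f::field place \<Rightarrow> (nat \<Rightarrow> 'f) set topology" where
  "completion_topology P = Metric_space.mtopology (carrier (completion P)) (completion_dist P)"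

type_synonym 'f S_adele = "'f place \<Rightarrow> (nat \<Rightarrow> 'f) set"

definition S_completion :: "'f::field place set \<Rightarrow> 'f S_adele ring" where
  "S_completion S =
     \<lparr>carrier = (\<Pi>\<^sub>E P\<in>S. carrier (completion P)),
      monoid.mult = (\<lambda>x y. \<lambda>P\<in>S. x P \<otimes>\<^bsub>completion P\<^esub> y P),
      one = (\<lambda>P\<in>S. \<one>\<^bsub>completion P\<^esub>),
      zero = (\<lambda>P\<in>S. \<zero>\<^bsub>completion P\<^esub>),
      add = (\<lambda>x y. \<lambda>P\<in>S. x P \<oplus>\<^bsub>completion P\<^esub> y P)\<rparr>"

definition diagonal :: "'f::field place set \<Rightarrow> 'f \<Rightarrow> 'f S_adele" where
  "diagonal S x = (\<lambda>P\<in>S. completion_embed P x)"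

definition additive_character :: "'f::field place set \<Rightarrow> ('f S_adele \<Rightarrow> complex) \<Rightarrow> bool" where
  "additive_character S \<psi> \<longleftrightarrow>
     (\<forall>x\<in>carrier (S_completion S). cmod (\<psi> x) = 1) \<and>
     (\<forall>x\<in>carrier (S_completion S). \<forall>y\<in>carrier (S_completion S).
        \<psi> (x \<oplus>\<^bsub>S_completion S\<^esub> y) = \<psi> x * \<psi> y) \<and>
     continuous_map (product_topology completion_topology S) euclidean \<psi>"

section \<open>The power residue symbol\<close>

definition prime_residue_symbol :: "'f::field place set \<Rightarrow> nat \<Rightarrow> 'f \<Rightarrow> 'f \<Rightarrow> 'f" where
  "prime_residue_symbol S n c p =
     (let q = card (carrier (S_integers S Quot (PIdl\<^bsub>S_integers S\<^esub> p)))
      in THE \<zeta>. \<zeta> \<in> roots_of_unity n \<and> c ^ ((q - 1) div n) - \<zeta> \<in> PIdl\<^bsub>S_integers S\<^esub> p)"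

definition residue_symbol :: "'f::field place set \<Rightarrow> nat \<Rightarrow> 'f \<Rightarrow> 'f \<Rightarrow> 'f" where
  "residue_symbol S n c d =
     prod_list (map (prime_residue_symbol S n c)
       (SOME fs. set fs \<subseteq> carrier (mult_of (S_integers S)) \<and> wfactors (mult_of (S_integers S)) fs d))"

text \<open>The last field identifies the n-th roots of unity of the field with complex numbers, so that
  residue symbols can be multiplied with values of the additive character.\<close>

record 'f arithmetic_data =
  sym_deg :: nat
  bad_places :: "'f place set"
  add_char :: "'f S_adele \<Rightarrow> complex"
  mu_embed :: "'f \<Rightarrow> complex"

abbreviation oS :: "('f::number_field, 'z) arithmetic_data_scheme \<Rightarrow> 'f ring" where
  "oS A \<equiv> S_integers (bad_places A)"

definition arithmetic_setting :: "('f::number_field) arithmetic_data \<Rightarrow> bool" where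
  "arithmetic_setting A \<longleftrightarrow>
     sym_deg A \<ge> 1 \<and>
     totally_complex TYPE('f) \<and>
     card (roots_of_unity (2 * sym_deg A) :: 'f set) = 2 * sym_deg A \<and>
     finite (bad_places A) \<and> bad_places A \<subseteq> places \<and>
     (\<forall>P\<in>places. archimedean_place P \<or> ramified_place P \<longrightarrow> P \<in> bad_places A) \<and>
     principal_domain (oS A) \<and>
     additive_character (bad_places A) (add_char A) \<and>
     (\<forall>x\<in>carrier (oS A). add_char A (diagonal (bad_places A) x) = 1) \<and>
     (\<forall>I. fractional_ideal (bad_places A) I \<and> carrier (oS A) \<subset> I \<longrightarrow>
        (\<exists>x\<in>I. add_char A (diagonal (bad_places A) x) \<noteq> 1)) \<and>
     inj_on (mu_embed A) (roots_of_unity (sym_deg A)) \<and>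
     (\<forall>x\<in>roots_of_unity (sym_deg A). \<forall>y\<in>roots_of_unity (sym_deg A).
        mu_embed A (x * y) = mu_embed A x * mu_embed A y)"

definition psi :: "('f::number_field) arithmetic_data \<Rightarrow> 'f \<Rightarrow> complex" where
  "psi A x = add_char A (diagonal (bad_places A) x)"

definition symb :: "('f::number_field) arithmetic_data \<Rightarrow> 'f \<Rightarrow> 'f \<Rightarrow> complex" where
  "symb A c d = mu_embed A (residue_symbol (bad_places A) (sym_deg A) c d)"

definition coprime_S :: "('f::number_field) arithmetic_data \<Rightarrow> 'f \<Rightarrow> 'f \<Rightarrow> bool" where
  "coprime_S A c d \<longleftrightarrow> \<one>\<^bsub>oS A\<^esub> gcdof\<^bsub>oS A\<^esub> c d"

section \<open>Root data and Weyl groups\<close>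

text \<open>The character and cocharacter lattices are both the standard lattice, in perfect duality under
  the standard pairing. The simple roots are indexed by 1, ..., r with r the semisimple rank, which
  may be smaller than the rank of the lattice.\<close>

definition pairing :: "int ^ 'm \<Rightarrow> int ^ 'm \<Rightarrow> int" where
  "pairing x y = (\<Sum>i\<in>UNIV. x $ i * y $ i)"

record ('m::finite) root_data =
  roots :: "(int ^ 'm) set"
  coroot :: "int ^ 'm \<Rightarrow> int ^ 'm"
  ss_rank :: nat
  simple :: "nat \<Rightarrow> int ^ 'm"

definition root_reflection :: "('m::finite) root_data \<Rightarrow> int ^ 'm \<Rightarrow> int ^ 'm \<Rightarrow> int ^ 'm" where
  "root_reflection R \<alpha> x = x - pairing x (coroot R \<alpha>) *s \<alpha>"

definition coroot_reflection :: "('m::finite) root_data \<Rightarrow> int ^ 'm \<Rightarrow> int ^ 'm \<Rightarrow> int ^ 'm" where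
  "coroot_reflection R \<alpha> y = y - pairing \<alpha> y *s coroot R \<alpha>"

definition simple_combination :: "('m::finite) root_data \<Rightarrow> (nat \<Rightarrow> int) \<Rightarrow> int ^ 'm" where
  "simple_combination R c = (\<Sum>j=1..ss_rank R. c j *s simple R j)"

definition based_root_datum :: "('m::finite) root_data \<Rightarrow> bool" where
  "based_root_datum R \<longleftrightarrow>
     finite (roots R) \<and> inj_on (coroot R) (roots R) \<and>
     (\<forall>\<alpha>\<in>roots R. pairing \<alpha> (coroot R \<alpha>) = 2) \<and>
     (\<forall>\<alpha>\<in>roots R. \<forall>\<beta>\<in>roots R. root_reflection R \<alpha> \<beta> \<in> roots R) \<and>
     (\<forall>\<alpha>\<in>roots R. \<forall>\<beta>\<in>roots R. coroot_reflection R \<alpha> (coroot R \<beta>) \<in> coroot R ` roots R) \<and>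
     (\<forall>\<alpha>\<in>roots R. 2 *s \<alpha> \<notin> roots R) \<and>
     (\<forall>j\<in>{1..ss_rank R}. simple R j \<in> roots R) \<and>
     (\<forall>c. simple_combination R c = 0 \<longrightarrow> (\<forall>j\<in>{1..ss_rank R}. c j = 0)) \<and>
     (\<forall>\<beta>\<in>roots R. \<exists>c. \<beta> = simple_combination R c \<and>
        ((\<forall>j\<in>{1..ss_rank R}. c j \<ge> 0) \<or> (\<forall>j\<in>{1..ss_rank R}. c j \<le> 0)))"

definition simple_coeff :: "('m::finite) root_data \<Rightarrow> int ^ 'm \<Rightarrow> nat \<Rightarrow> int" where
  "simple_coeff R \<beta> =
     (THE c. \<beta> = simple_combination R c \<and> (\<forall>j. j \<notin> {1..ss_rank R} \<longrightarrow> c j = 0))"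

text \<open>Irreducible components are the connectivity classes of roots under non-orthogonality; for a
  reducible root system the highest root is that of the component of the given simple root.\<close>

definition root_component :: "('m::finite) root_data \<Rightarrow> int ^ 'm \<Rightarrow> (int ^ 'm) set" where
  "root_component R \<alpha> =
     {\<beta>. (\<alpha>, \<beta>) \<in> {(\<beta>, \<gamma>). \<beta> \<in> roots R \<and> \<gamma> \<in> roots R \<and> pairing \<beta> (coroot R \<gamma>) \<noteq> 0}\<^sup>*}"

definition highest_root :: "('m::finite) root_data \<Rightarrow> nat \<Rightarrow> int ^ 'm \<Rightarrow> bool" where
  "highest_root R i \<theta> \<longleftrightarrow>
     \<theta> \<in> root_component R (simple R i) \<and>
     (\<forall>\<beta>\<in>root_component R (simple R i). \<exists>c. \<theta> - \<beta> = simple_combination R c \<and> (\<forall>j. c j \<ge> 0))"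

definition cominuscule :: "('m::finite) root_data \<Rightarrow> nat \<Rightarrow> bool" where
  "cominuscule R i \<longleftrightarrow>
     i \<in> {1..ss_rank R} \<and> (\<exists>\<theta>. highest_root R i \<theta> \<and> simple_coeff R \<theta> i = 1)"

text \<open>A word stands for the product of its simple reflections in the given order, acting on characters.\<close>

fun word_act :: "('m::finite) root_data \<Rightarrow> nat list \<Rightarrow> int ^ 'm \<Rightarrow> int ^ 'm" where
  "word_act R [] x = x"
| "word_act R (i # ws) x = root_reflection R (simple R i) (word_act R ws x)"

definition weyl_group :: "('m::finite) root_data \<Rightarrow> nat set \<Rightarrow> (int ^ 'm \<Rightarrow> int ^ 'm) set" where
  "weyl_group R J = {word_act R ws | ws. set ws \<subseteq> J}"

definition weyl_length :: "('m::finite) root_data \<Rightarrow> (int ^ 'm \<Rightarrow> int ^ 'm) \<Rightarrow> nat" where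
  "weyl_length R w = (LEAST l. \<exists>ws. set ws \<subseteq> {1..ss_rank R} \<and> word_act R ws = w \<and> length ws = l)"

definition reduced_word :: "('m::finite) root_data \<Rightarrow> nat list \<Rightarrow> bool" where
  "reduced_word R ws \<longleftrightarrow>
     set ws \<subseteq> {1..ss_rank R} \<and> length ws = weyl_length R (word_act R ws)"

definition long_element :: "('m::finite) root_data \<Rightarrow> nat set \<Rightarrow> (int ^ 'm \<Rightarrow> int ^ 'm) \<Rightarrow> bool" where
  "long_element R J w \<longleftrightarrow>
     w \<in> weyl_group R J \<and> (\<forall>w'\<in>weyl_group R J. weyl_length R w' \<le> weyl_length R w)"

definition invariant_quadratic_form :: "('m::finite) root_data \<Rightarrow> (int ^ 'm \<Rightarrow> int) \<Rightarrow> bool" where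
  "invariant_quadratic_form R Q \<longleftrightarrow>
     (\<forall>a y. Q (a *s y) = a\<^sup>2 * Q y) \<and>
     (\<forall>x y z. Q (x + y + z) - Q (x + y) - Q z = (Q (x + z) - Q x - Q z) + (Q (y + z) - Q y - Q z)) \<and>
     (\<forall>\<alpha>\<in>roots R. \<forall>y. Q (coroot_reflection R \<alpha> y) = Q y)"

section \<open>Split reductive groups\<close>

text \<open>A split connected reductive group over the field is given by its group of rational points
  together with a split maximal torus, whose points are the tuples of nonzero field elements, and
  one-parameter root subgroups, subject to Steinberg's relations. Over an infinite field these data
  determine the group of points up to isomorphism. The commutator relations involve a product over
  pairs (i, j) whose order is arbitrary but fixed; the structure constants may depend on it.\<close>

record ('f, 'g, 'm) pinned_group =
  points :: "'g monoid"
  torus_elt :: "'f ^ ('m::finite) \<Rightarrow> 'g"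
  root_elt :: "int ^ 'm \<Rightarrow> 'f \<Rightarrow> 'g"
  comm_order :: "int ^ 'm \<Rightarrow> int ^ 'm \<Rightarrow> (nat \<times> nat) list"
  struct_const :: "int ^ 'm \<Rightarrow> int ^ 'm \<Rightarrow> nat \<Rightarrow> nat \<Rightarrow> int"

definition torus_points :: "('f::field ^ 'm) set" where
  "torus_points = {h. \<forall>i. h $ i \<noteq> 0}"

definition char_value :: "int ^ 'm \<Rightarrow> 'f::field ^ 'm \<Rightarrow> 'f" where
  "char_value x h = (\<Prod>i\<in>UNIV. (h $ i) powi (x $ i))"

definition cochar_value :: "int ^ 'm \<Rightarrow> 'f::field \<Rightarrow> 'f ^ 'm" where
  "cochar_value y s = (\<chi> i. s powi (y $ i))"

definition weyl_elt :: "('f::field, 'g, 'm::finite) pinned_group \<Rightarrow> int ^ 'm \<Rightarrow> 'f \<Rightarrow> 'g" where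
  "weyl_elt G \<alpha> s =
     root_elt G \<alpha> s \<otimes>\<^bsub>points G\<^esub> root_elt G (- \<alpha>) (- inverse s) \<otimes>\<^bsub>points G\<^esub> root_elt G \<alpha> s"

definition steinberg_relation ::
    "('m::finite) root_data \<Rightarrow> ('f::field, 'g, 'm) pinned_group \<Rightarrow> int ^ 'm \<Rightarrow> int ^ 'm \<Rightarrow> bool" where
  "steinberg_relation R G \<alpha> \<beta> \<longleftrightarrow>
     distinct (comm_order G \<alpha> \<beta>) \<and>
     set (comm_order G \<alpha> \<beta>) = {(i, j). i > 0 \<and> j > 0 \<and> int i *s \<alpha> + int j *s \<beta> \<in> roots R} \<and>
     (\<forall>s u. root_elt G \<alpha> s \<otimes>\<^bsub>points G\<^esub> root_elt G \<beta> u \<otimes>\<^bsub>points G\<^esub> inv\<^bsub>points G\<^esub> root_elt G \<alpha> s =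
        root_elt G \<beta> u \<otimes>\<^bsub>points G\<^esub>
        foldr (\<lambda>(i, j) g. root_elt G (int i *s \<alpha> + int j *s \<beta>)
                 (of_int (struct_const G \<alpha> \<beta> i j) * s ^ i * u ^ j) \<otimes>\<^bsub>points G\<^esub> g)
          (comm_order G \<alpha> \<beta>) \<one>\<^bsub>points G\<^esub>)"

definition split_reductive_group ::
    "('m::finite) root_data \<Rightarrow> ('f::field, 'g, 'm) pinned_group \<Rightarrow> bool" where
  "split_reductive_group R G \<longleftrightarrow>
     based_root_datum R \<and> group (points G) \<and>
     (\<forall>h\<in>torus_points. torus_elt G h \<in> carrier (points G)) \<and>
     inj_on (torus_elt G) torus_points \<and>
     (\<forall>h\<in>torus_points. \<forall>h'\<in>torus_points.
        torus_elt G (\<chi> i. h $ i * h' $ i) = torus_elt G h \<otimes>\<^bsub>points G\<^esub> torus_elt G h') \<and>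
     (\<forall>\<alpha>\<in>roots R.
        range (root_elt G \<alpha>) \<subseteq> carrier (points G) \<and> inj (root_elt G \<alpha>) \<and>
        (\<forall>s u. root_elt G \<alpha> (s + u) = root_elt G \<alpha> s \<otimes>\<^bsub>points G\<^esub> root_elt G \<alpha> u) \<and>
        (\<forall>h\<in>torus_points. \<forall>s.
           torus_elt G h \<otimes>\<^bsub>points G\<^esub> root_elt G \<alpha> s \<otimes>\<^bsub>points G\<^esub> inv\<^bsub>points G\<^esub> torus_elt G h =
           root_elt G \<alpha> (char_value \<alpha> h * s)) \<and>
        (\<forall>s. s \<noteq> 0 \<longrightarrow>
           weyl_elt G \<alpha> s \<otimes>\<^bsub>points G\<^esub> weyl_elt G \<alpha> (- 1) = torus_elt G (cochar_value (coroot R \<alpha>) s)) \<and>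
        (\<forall>s u. s \<noteq> 0 \<longrightarrow>
           weyl_elt G \<alpha> s \<otimes>\<^bsub>points G\<^esub> root_elt G \<alpha> u \<otimes>\<^bsub>points G\<^esub> inv\<^bsub>points G\<^esub> weyl_elt G \<alpha> s =
           root_elt G (- \<alpha>) (- (u / s\<^sup>2)))) \<and>
     (\<forall>\<alpha>\<in>roots R. \<forall>\<beta>\<in>roots R. \<beta> \<noteq> \<alpha> \<and> \<beta> \<noteq> - \<alpha> \<longrightarrow> steinberg_relation R G \<alpha> \<beta>) \<and>
     carrier (points G) =
       generate (points G) (torus_elt G ` torus_points \<union> (\<Union>\<alpha>\<in>roots R. range (root_elt G \<alpha>)))"

section \<open>The exponential sum\<close>

text \<open>A maximal standard parabolic is given by its omitted simple root. The reduced word for the long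
  element of the Weyl group is split into a word for the long element of the Levi factor followed by
  the letters that enumerate the roots of the unipotent radical.\<close>

record parabolic_data =
  omitted :: nat
  levi_word :: "nat list"
  unip_word :: "nat list"

definition cominuscule_parabolic :: "('m::finite) root_data \<Rightarrow> parabolic_data \<Rightarrow> bool" where
  "cominuscule_parabolic R P \<longleftrightarrow>
     cominuscule R (omitted P) \<and>
     reduced_word R (levi_word P @ unip_word P) \<and>
     long_element R {1..ss_rank R} (word_act R (levi_word P @ unip_word P)) \<and>
     long_element R ({1..ss_rank R} - {omitted P}) (word_act R (levi_word P))"

definition unip_dim :: "parabolic_data \<Rightarrow> nat" where
  "unip_dim P = length (unip_word P)"

definition unip_root :: "('m::finite) root_data \<Rightarrow> parabolic_data \<Rightarrow> nat \<Rightarrow> int ^ 'm" where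
  "unip_root R P k =
     word_act R (levi_word P) (word_act R (take (k - 1) (unip_word P)) (simple R (unip_word P ! (k - 1))))"

definition unip_coroot :: "('m::finite) root_data \<Rightarrow> parabolic_data \<Rightarrow> nat \<Rightarrow> int ^ 'm" where
  "unip_coroot R P k = coroot R (unip_root R P k)"

definition modulus :: "('m::finite) root_data \<Rightarrow> parabolic_data \<Rightarrow> (nat \<Rightarrow> 'f::field) \<Rightarrow> nat \<Rightarrow> 'f" where
  "modulus R P d k =
     d k * (\<Prod>l=k+1..unip_dim P. d l powi pairing (unip_root R P k) (unip_coroot R P l))"

text \<open>The positive integers i, i' are determined by (k, k'), so summing over quadruples is the same as
  summing over the pairs (k, k').\<close>

definition root_pairs ::
    "('m::finite) root_data \<Rightarrow> parabolic_data \<Rightarrow> nat \<Rightarrow> (nat \<times> nat \<times> nat \<times> nat) set" where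
  "root_pairs R P j =
     {(k, k', i, i'). k \<in> {1..unip_dim P} \<and> k' \<in> {1..unip_dim P} \<and> k > k' \<and> i > 0 \<and> i' > 0 \<and>
        int i *s unip_root R P k - int i' *s unip_root R P k' = - simple R j}"

definition v_coord ::
    "('m::finite) root_data \<Rightarrow> ('f::field, 'g, 'm) pinned_group \<Rightarrow> parabolic_data \<Rightarrow>
     (nat \<Rightarrow> 'f) \<Rightarrow> (nat \<Rightarrow> 'f) \<Rightarrow> (nat \<Rightarrow> 'f) \<Rightarrow> nat \<Rightarrow> 'f" where
  "v_coord R G P d c b j =
     (if j = omitted P then c (unip_dim P) / d (unip_dim P)
      else \<Sum>(k, k', i, i')\<in>root_pairs R P j.
        (- 1) ^ (i + i') *
        of_int (struct_const G (unip_root R P k) (- unip_root R P k') i i') *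
        (b k * inverse (d k)) ^ i * (c k' * inverse (d k')) ^ i' *
        (\<Prod>l=k..unip_dim P. inverse (d l) powi pairing (simple R j) (unip_coroot R P l)) *
        (\<Prod>l=k'+1..<k. inverse (d l) powi (int i' * pairing (unip_root R P k') (unip_coroot R P l))))"

text \<open>The choices entering the sum: representatives of the residues modulo the k-th modulus that are
  coprime to the k-th entry, and for each representative a solution b of a * d - b * c = 1.\<close>

definition admissible_choice ::
    "('f::number_field) arithmetic_data \<Rightarrow> ('m::finite) root_data \<Rightarrow> parabolic_data \<Rightarrow>
     (nat \<Rightarrow> 'f) \<Rightarrow> (nat \<Rightarrow> 'f set) \<Rightarrow> (nat \<Rightarrow> 'f \<Rightarrow> 'f) \<Rightarrow> bool" where
  "admissible_choice A R P d C b \<longleftrightarrow>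
     (\<forall>k\<in>{1..unip_dim P}.
        C k \<subseteq> {c \<in> carrier (oS A). coprime_S A c (d k)} \<and>
        (\<forall>x\<in>carrier (oS A). coprime_S A x (d k) \<longrightarrow>
           (\<exists>!c. c \<in> C k \<and> x - c \<in> PIdl\<^bsub>oS A\<^esub> (modulus R P d k))) \<and>
        (\<forall>c\<in>C k. b k c \<in> carrier (oS A) \<and> (\<exists>a\<in>carrier (oS A). a * d k - b k c * c = 1)))"

definition exp_sum ::
    "('f::number_field) arithmetic_data \<Rightarrow> ('m::finite) root_data \<Rightarrow> ('f, 'g, 'm) pinned_group \<Rightarrow>
     (int ^ 'm \<Rightarrow> int) \<Rightarrow> parabolic_data \<Rightarrow>
     (nat \<Rightarrow> 'f set) \<Rightarrow> (nat \<Rightarrow> 'f \<Rightarrow> 'f) \<Rightarrow> (nat \<Rightarrow> 'f) \<Rightarrow> (nat \<Rightarrow> 'f) \<Rightarrow> complex" where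
  "exp_sum A R G Q P C b d t =
     (\<Sum>c \<in> (\<Pi>\<^sub>E k\<in>{1..unip_dim P}. C k).
        psi A (\<Sum>j=1..ss_rank R. t j * v_coord R G P d c (\<lambda>k. b k (c k)) j) *
        (\<Prod>k=1..unip_dim P. symb A (c k) (d k) powi Q (unip_coroot R P k)))"

definition H_sum ::
    "('f::number_field) arithmetic_data \<Rightarrow> ('m::finite) root_data \<Rightarrow> ('f, 'g, 'm) pinned_group \<Rightarrow>
     (int ^ 'm \<Rightarrow> int) \<Rightarrow> parabolic_data \<Rightarrow> (nat \<Rightarrow> 'f) \<Rightarrow> (nat \<Rightarrow> 'f) \<Rightarrow> complex" where
  "H_sum A R G Q P d t =
     (SOME z. \<exists>C b. admissible_choice A R P d C b \<and> z = exp_sum A R G Q P C b d t)"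

text \<open>The value above is meaningful when it does not depend on the choices. For some d and t it does
  depend on the b's: in type A2 with n = 1, d = (p, 1), p prime and t = (1, 1), the second b is
  arbitrary, and its values 0 and 1 give different sums.\<close>

definition H_well_defined ::
    "('f::number_field) arithmetic_data \<Rightarrow> ('m::finite) root_data \<Rightarrow> ('f, 'g, 'm) pinned_group \<Rightarrow>
     (int ^ 'm \<Rightarrow> int) \<Rightarrow> parabolic_data \<Rightarrow> (nat \<Rightarrow> 'f) \<Rightarrow> (nat \<Rightarrow> 'f) \<Rightarrow> bool" where
  "H_well_defined A R G Q P d t \<longleftrightarrow>
     (\<forall>C b C' b'. admissible_choice A R P d C b \<and> admissible_choice A R P d C' b' \<longrightarrow>
        exp_sum A R G Q P C b d t = exp_sum A R G Q P C' b' d t)"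

end

theory Submission
  imports Defs "HOL-Algebra.Multiplicative_Group"
begin

text \<open>
  In the cominuscule case every root \<open>\<gamma>\<^sub>k\<close> of the unipotent radical has coefficient 1 at the omitted
  simple root. Reflecting one such root in another therefore shows that all pairings of \<open>\<gamma>\<^sub>k\<close> with
  the coroot of \<open>\<gamma>\<^sub>l\<close> are nonnegative, so the moduli \<open>D\<^sub>k = E\<^sub>k F\<^sub>k\<close> are integral, and comparing
  coefficients shows that only \<open>i = i' = 1\<close> occurs in the coordinates \<open>v\<^sub>j\<close>, whose summands collapse to
  \<open>\<eta> b\<^sub>k D\<^sub>k c\<^sub>k' / D\<^sub>k'\<close>.

  By the Chinese remainder theorem \<open>c\<^sub>k = F\<^sub>k x\<^sub>k + E\<^sub>k y\<^sub>k\<close> modulo \<open>D\<^sub>k\<close>, and \<open>b\<^sub>k\<close> is chosen such that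
  \<open>b\<^sub>k F\<^sub>k\<close> and \<open>b\<^sub>k E\<^sub>k\<close> agree with the given choices for \<open>e\<close> and \<open>f\<close> modulo all \<open>E\<^sub>l\<close> and all \<open>F\<^sub>l\<close>.
  Then each \<open>v\<^sub>j\<close> splits additively modulo S-integers, while the residue symbol of \<open>c\<^sub>k\<close> modulo
  \<open>d\<^sub>k\<close> produces the twisting factors from \<open>F\<^sub>k x\<^sub>k\<close> modulo \<open>e\<^sub>k\<close> and \<open>E\<^sub>k y\<^sub>k\<close> modulo \<open>f\<^sub>k\<close>.
  Multiplicativity of the symbol rests on the roots of unity being distinct modulo every prime outside
  S, which holds because these primes are unramified.
\<close>

section \<open>Root data\<close>

text \<open>The obstacle is the freedom in the \<open>b\<close>'s. Each is determined only modulo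
  \<open>d k\<close>, while the summand b_k D_k c_k' / D_k' modulo S-integers can depend on more,
  since D_k' need not divide d_k D_k. Sums for unrelated choices therefore cannot be compared: all
  choices for \<open>e\<close> and \<open>f\<close> stay arbitrary, and a matching \<open>b\<close>
  for \<open>d\<close> is built. As k' varies, the congruences on b_k must hold modulo all E_l and
  F_l, not only those with l = k. The twist acts oppositely on the two kinds of variables. Taking
  c_k = F_k x_k + E_k y_k makes c_k / D_k split as x_k / E_k + y_k / F_k. Then b_k F_k, rather than
  b_k, has to match the choice for \<open>e\<close>: this preserves b c = -1 modulo e_k, and the
  summand contains b_k D_k = (b_k F_k) E_k. On the root side, the axioms say only that coroot
  reflections permute the set of coroots. That the coroot of a reflected root is the reflected
  coroot has to be derived, and the exchange condition behind the positivity of the \<gamma>_k rests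
  on it.\<close>

lemma pairing_add_left: "pairing (x + y) z = pairing x z + pairing y z"
  by (simp add: pairing_def algebra_simps sum.distrib)

lemma pairing_diff_left: "pairing (x - y) z = pairing x z - pairing y z"
  by (simp add: pairing_def algebra_simps sum_subtractf)

lemma pairing_smult_left: "pairing (a *s x) z = a * pairing x z"
  by (simp add: pairing_def algebra_simps sum_distrib_left)

lemma pairing_add_right: "pairing x (y + z) = pairing x y + pairing x z"
  by (simp add: pairing_def algebra_simps sum.distrib)

lemma pairing_diff_right: "pairing x (y - z) = pairing x y - pairing x z"
  by (simp add: pairing_def algebra_simps sum_subtractf)

lemma pairing_smult_right: "pairing x (a *s z) = a * pairing x z"
  by (simp add: pairing_def algebra_simps sum_distrib_left)

lemma pairing_minus_left: "pairing (- x) z = - pairing x z"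
  by (simp add: pairing_def sum_negf)

lemma pairing_sum_right: "pairing x (\<Sum>i\<in>I. g i) = (\<Sum>i\<in>I. pairing x (g i))"
  by (simp add: pairing_def sum_distrib_left) (rule sum.swap)

lemma pairing_zero_left [simp]: "pairing 0 z = 0"
  by (simp add: pairing_def)

lemma pairing_zero_right [simp]: "pairing x 0 = 0"
  by (simp add: pairing_def)

lemma pairing_reflection:
  "pairing (root_reflection R \<alpha> x) y = pairing x (coroot_reflection R \<alpha> y)"
  by (simp add: root_reflection_def coroot_reflection_def pairing_diff_left pairing_diff_right
      pairing_smult_left pairing_smult_right)

lemma root_reflection_add:
  "root_reflection R \<alpha> (x + y) = root_reflection R \<alpha> x + root_reflection R \<alpha> y"
  by (simp add: root_reflection_def pairing_add_left vec_eq_iff algebra_simps)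

lemma root_reflection_smult:
  "root_reflection R \<alpha> (a *s x) = a *s root_reflection R \<alpha> x"
  by (simp add: root_reflection_def pairing_smult_left vec_eq_iff algebra_simps)

lemma root_reflection_0 [simp]: "root_reflection R \<alpha> 0 = 0"
  by (simp add: root_reflection_def)

lemma word_act_add: "word_act R ws (x + y) = word_act R ws x + word_act R ws y"
  by (induction ws) (simp_all add: root_reflection_add)

lemma word_act_smult: "word_act R ws (a *s x) = a *s word_act R ws x"
  by (induction ws) (simp_all add: root_reflection_smult)

lemma word_act_0 [simp]: "word_act R ws 0 = 0"
  by (induction ws) simp_all

lemma word_act_minus:
  fixes x :: "int ^ 'm::finite"
  shows "word_act R ws (- x) = - word_act R ws x"
proof -
  have "(- 1) *s y = - y" for y :: "int ^ 'm" by (simp add: vec_eq_iff)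
  then show ?thesis using word_act_smult[of R ws "-1" x] by metis
qed

lemma word_act_sum: "word_act R ws (\<Sum>i\<in>I. g i) = (\<Sum>i\<in>I. word_act R ws (g i))"
  by (induction I rule: infinite_finite_induct) (simp_all add: word_act_add)

lemma word_act_append: "word_act R (us @ vs) x = word_act R us (word_act R vs x)"
  by (induction us) simp_all

lemma simple_combination_add:
  "simple_combination R (\<lambda>j. c j + c' j) = simple_combination R c + simple_combination R c'"
  by (simp add: simple_combination_def vec_eq_iff sum.distrib algebra_simps)

lemma simple_combination_smult:
  "simple_combination R (\<lambda>j. a * c j) = a *s simple_combination R c"
  by (simp add: simple_combination_def vec_eq_iff sum_distrib_left algebra_simps)

lemma simple_combination_diff:
  "simple_combination R (\<lambda>j. c j - c' j) = simple_combination R c - simple_combination R c'"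
  by (simp add: simple_combination_def vec_eq_iff sum_subtractf algebra_simps)

lemma simple_combination_single:
  assumes "i \<in> {1..ss_rank R}"
  shows "simple_combination R (\<lambda>j. if j = i then 1 else 0) = simple R i"
proof -
  have "(if j = i then 1 else 0) *s simple R j = (if j = i then simple R j else 0)" for j
    by (simp add: vec_eq_iff)
  then show ?thesis
    using assms by (simp add: simple_combination_def)
qed

locale based_datum =
  fixes R :: "('m::finite) root_data"
  assumes based: "based_root_datum R"
begin

abbreviation refl where "refl \<equiv> root_reflection R"
abbreviation corefl where "corefl \<equiv> coroot_reflection R"
abbreviation coeff where "coeff \<equiv> simple_coeff R"
abbreviation act where "act \<equiv> word_act R"
abbreviation idx where "idx \<equiv> {1..ss_rank R}"

lemma finite_roots: "finite (roots R)"
  and pairing_coroot: "\<alpha> \<in> roots R \<Longrightarrow> pairing \<alpha> (coroot R \<alpha>) = 2"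
  and refl_root: "\<alpha> \<in> roots R \<Longrightarrow> \<beta> \<in> roots R \<Longrightarrow> refl \<alpha> \<beta> \<in> roots R"
  and corefl_coroot: "\<alpha> \<in> roots R \<Longrightarrow> \<gamma> \<in> coroot R ` roots R \<Longrightarrow> corefl \<alpha> \<gamma> \<in> coroot R ` roots R"
  and double_not_root: "\<alpha> \<in> roots R \<Longrightarrow> 2 *s \<alpha> \<notin> roots R"
  and simple_root: "j \<in> idx \<Longrightarrow> simple R j \<in> roots R"
  and simple_independent: "simple_combination R c = 0 \<Longrightarrow> j \<in> idx \<Longrightarrow> c j = 0"
  and root_combination: "\<beta> \<in> roots R \<Longrightarrow> \<exists>c. \<beta> = simple_combination R c \<and>
        ((\<forall>j\<in>idx. c j \<ge> 0) \<or> (\<forall>j\<in>idx. c j \<le> 0))"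
proof -
  note D = based[unfolded based_root_datum_def]
  show "finite (roots R)" using D by (elim conjE)
  show "\<alpha> \<in> roots R \<Longrightarrow> pairing \<alpha> (coroot R \<alpha>) = 2" using D by (elim conjE bspec)
  show "\<alpha> \<in> roots R \<Longrightarrow> \<beta> \<in> roots R \<Longrightarrow> refl \<alpha> \<beta> \<in> roots R" using D by (elim conjE) simp
  show "\<alpha> \<in> roots R \<Longrightarrow> \<gamma> \<in> coroot R ` roots R \<Longrightarrow> corefl \<alpha> \<gamma> \<in> coroot R ` roots R"
    using D by (elim conjE imageE) simp
  show "\<alpha> \<in> roots R \<Longrightarrow> 2 *s \<alpha> \<notin> roots R" using D by (elim conjE bspec)
  show "j \<in> idx \<Longrightarrow> simple R j \<in> roots R" using D by (elim conjE bspec)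
  show "simple_combination R c = 0 \<Longrightarrow> j \<in> idx \<Longrightarrow> c j = 0" using D by (elim conjE) blast
  show "\<beta> \<in> roots R \<Longrightarrow> \<exists>c. \<beta> = simple_combination R c \<and>
        ((\<forall>j\<in>idx. c j \<ge> 0) \<or> (\<forall>j\<in>idx. c j \<le> 0))" using D by (elim conjE bspec)
qed

lemma refl_refl: "\<alpha> \<in> roots R \<Longrightarrow> refl \<alpha> (refl \<alpha> x) = x"
  using pairing_coroot[of \<alpha>]
  by (simp add: root_reflection_def pairing_diff_left pairing_smult_left vec_eq_iff algebra_simps)

lemma corefl_corefl: "\<alpha> \<in> roots R \<Longrightarrow> corefl \<alpha> (corefl \<alpha> x) = x"
  using pairing_coroot[of \<alpha>]
  by (simp add: coroot_reflection_def pairing_diff_right pairing_smult_right vec_eq_iff algebra_simps)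

lemma refl_self: "\<alpha> \<in> roots R \<Longrightarrow> refl \<alpha> \<alpha> = - \<alpha>"
  using pairing_coroot[of \<alpha>]
  by (simp add: root_reflection_def vec_eq_iff algebra_simps)

lemma root_nonzero: "\<alpha> \<in> roots R \<Longrightarrow> \<alpha> \<noteq> 0"
  using pairing_coroot by force

section \<open>Equivariance of the coroot map\<close>

lemma bij_betw_corefl:
  assumes "\<alpha> \<in> roots R"
  shows "bij_betw (corefl \<alpha>) (coroot R ` roots R) (coroot R ` roots R)"
  using assms corefl_coroot corefl_corefl
  by (intro bij_betwI[where g = "corefl \<alpha>"]) auto

text \<open>The canonical Weyl-invariant map from characters to cocharacters; it sends each root to a
  positive multiple of its coroot, which makes the coroot map equivariant.\<close>

definition canon :: "int ^ 'm \<Rightarrow> int ^ 'm" where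
  "canon x = (\<Sum>\<gamma>\<in>coroot R ` roots R. pairing x \<gamma> *s \<gamma>)"

text \<open>The bilinear form x, y -> <x, \<open>canon y\<close>> is a sum of products of linear
  forms, hence symmetric and positive semidefinite. It serves as the invariant inner
  product.\<close>

lemma pairing_canon: "pairing x (canon y) = (\<Sum>\<gamma>\<in>coroot R ` roots R. pairing x \<gamma> * pairing y \<gamma>)"
  by (simp add: canon_def pairing_sum_right pairing_smult_right mult.commute)

lemma pairing_canon_commute: "pairing x (canon y) = pairing y (canon x)"
  by (simp add: pairing_canon mult.commute)

lemma canon_minus: "canon (- x) = - canon x"
  by (simp add: canon_def pairing_minus_left vec_eq_iff sum_negf)

lemma corefl_sum: "corefl \<alpha> (\<Sum>i\<in>I. g i) = (\<Sum>i\<in>I. corefl \<alpha> (g i))"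
  by (induction I rule: infinite_finite_induct)
     (simp_all add: coroot_reflection_def pairing_add_right vec_eq_iff algebra_simps)

lemma corefl_smult: "corefl \<alpha> (a *s x) = a *s corefl \<alpha> x"
  by (simp add: coroot_reflection_def pairing_smult_right vec_eq_iff algebra_simps)

text \<open>\<open>canon\<close> depends on the coroots only as a set, and
  \<open>corefl \<alpha>\<close> permutes that set by axiom. Reindexing along it does not require
  knowing which root a reflected coroot belongs to.\<close>

lemma canon_refl:
  assumes "\<alpha> \<in> roots R"
  shows "canon (refl \<alpha> x) = corefl \<alpha> (canon x)"
proof -
  have "corefl \<alpha> (canon x) = (\<Sum>\<gamma>\<in>coroot R ` roots R. pairing x \<gamma> *s corefl \<alpha> \<gamma>)"
    by (simp add: canon_def corefl_sum corefl_smult)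
  also have "\<dots> = (\<Sum>\<gamma>\<in>coroot R ` roots R. pairing x (corefl \<alpha> \<gamma>) *s corefl \<alpha> (corefl \<alpha> \<gamma>))"
    by (rule sum.reindex_bij_betw[OF bij_betw_corefl[OF assms], symmetric])
  also have "\<dots> = canon (refl \<alpha> x)"
    using assms by (simp add: canon_def corefl_corefl pairing_reflection)
  finally show ?thesis ..
qed

text \<open>Apply \<open>canon_refl\<close> to \<beta> and its own reflection:
  -\<open>canon \<beta>\<close> is \<open>canon \<beta>\<close> minus a multiple of the
  coroot.\<close>

lemma canon_root:
  assumes "\<beta> \<in> roots R"
  shows "2 *s canon \<beta> = pairing \<beta> (canon \<beta>) *s coroot R \<beta>"
  using canon_refl[OF assms, of \<beta>] refl_self[OF assms]
  by (simp add: canon_minus coroot_reflection_def vec_eq_iff algebra_simps)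

lemma pairing_canon_root_pos:
  assumes "\<beta> \<in> roots R"
  shows "pairing \<beta> (canon \<beta>) > 0"
proof -
  have "0 < pairing \<beta> (coroot R \<beta>) * pairing \<beta> (coroot R \<beta>)"
    using pairing_coroot[OF assms] by simp
  also have "\<dots> \<le> (\<Sum>\<gamma>\<in>coroot R ` roots R. pairing \<beta> \<gamma> * pairing \<beta> \<gamma>)"
    using assms finite_roots
    by (intro member_le_sum[where f = "\<lambda>\<gamma>. pairing \<beta> \<gamma> * pairing \<beta> \<gamma>"]) auto
  finally show ?thesis by (simp add: pairing_canon)
qed

lemma pairing_canon_refl:
  assumes "\<alpha> \<in> roots R"
  shows "pairing (refl \<alpha> x) (canon (refl \<alpha> x)) = pairing x (canon x)"
  using assms by (simp add: canon_refl pairing_reflection corefl_corefl)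

lemma smult_cancel_int:
  fixes x y :: "int ^ 'm"
  assumes "a *s x = a *s y" "a \<noteq> 0"
  shows "x = y"
  using assms by (simp add: vec_eq_iff)

text \<open>By \<open>canon_root\<close> both sides, scaled by the invariant norm of \<beta>, are
  twice the same \<open>canon\<close> value; the norm is positive and cancels.\<close>

lemma coroot_refl:
  assumes "\<alpha> \<in> roots R" "\<beta> \<in> roots R"
  shows "coroot R (refl \<alpha> \<beta>) = corefl \<alpha> (coroot R \<beta>)"
proof -
  let ?n = "pairing \<beta> (canon \<beta>)"
  have "?n *s coroot R (refl \<alpha> \<beta>) = 2 *s canon (refl \<alpha> \<beta>)"
    using canon_root[OF refl_root[OF assms]] pairing_canon_refl[OF assms(1)] by simp
  also have "\<dots> = corefl \<alpha> (2 *s canon \<beta>)"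
    using assms by (simp add: canon_refl corefl_smult)
  also have "\<dots> = ?n *s corefl \<alpha> (coroot R \<beta>)"
    using assms by (simp add: canon_root corefl_smult)
  finally show ?thesis
    using smult_cancel_int pairing_canon_root_pos[OF assms(2)] by fastforce
qed

lemma refl_conj:
  assumes "\<alpha> \<in> roots R" "\<beta> \<in> roots R"
  shows "refl (refl \<alpha> \<beta>) (refl \<alpha> x) = refl \<alpha> (refl \<beta> x)"
proof -
  have "pairing (refl \<alpha> x) (corefl \<alpha> (coroot R \<beta>)) = pairing x (coroot R \<beta>)"
    using assms by (simp add: pairing_reflection corefl_corefl)
  then have "refl (refl \<alpha> \<beta>) (refl \<alpha> x) = refl \<alpha> x - pairing x (coroot R \<beta>) *s refl \<alpha> \<beta>"
    using assms by (simp add: root_reflection_def[of R "refl \<alpha> \<beta>"] coroot_refl)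
  also have "\<dots> = refl \<alpha> (x + (- pairing x (coroot R \<beta>)) *s \<beta>)"
    by (simp only: root_reflection_add root_reflection_smult) (simp add: vec_eq_iff)
  also have "x + (- pairing x (coroot R \<beta>)) *s \<beta> = refl \<beta> x"
    by (simp add: root_reflection_def vec_eq_iff)
  finally show ?thesis .
qed

lemma act_root: "set ws \<subseteq> idx \<Longrightarrow> \<beta> \<in> roots R \<Longrightarrow> act ws \<beta> \<in> roots R"
  by (induction ws) (auto intro!: refl_root simple_root)

text \<open>The conjugation rule for reflections, written as an intertwining identity so that no
  inverse of \<open>act ws\<close> appears.\<close>

lemma act_refl_conj:
  assumes "set ws \<subseteq> idx" "\<beta> \<in> roots R"
  shows "refl (act ws \<beta>) (act ws x) = act ws (refl \<beta> x)"
  using assms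
proof (induction ws)
  case (Cons i ws)
  then show ?case
    using refl_conj[OF simple_root act_root, of i ws \<beta> "act ws x"] by simp
qed simp

text \<open>Each pairing differs by a positive factor from the symmetric form <\<alpha>,
  \<open>canon \<beta>\<close>>, so both vanish together.\<close>

lemma pairing_coroot_symmetric:
  assumes "\<alpha> \<in> roots R" "\<beta> \<in> roots R" "pairing \<alpha> (coroot R \<beta>) \<noteq> 0"
  shows "pairing \<beta> (coroot R \<alpha>) \<noteq> 0"
proof -
  have eq: "2 * pairing x (canon y) = pairing y (canon y) * pairing x (coroot R y)"
    if "y \<in> roots R" for x y
    using arg_cong[OF canon_root[OF that], of "pairing x"] by (simp add: pairing_smult_right)
  have "pairing \<alpha> (canon \<beta>) \<noteq> 0"
    using eq[OF assms(2), of \<alpha>] assms(3) pairing_canon_root_pos[OF assms(2)] by auto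
  then have "pairing \<beta> (canon \<alpha>) \<noteq> 0"
    by (simp add: pairing_canon_commute)
  then show ?thesis
    using eq[OF assms(1), of \<beta>] by auto
qed

subsection \<open>Coefficients and positivity\<close>

lemma coeff_unique:
  assumes "x = simple_combination R c" "j \<in> idx"
  shows "coeff x j = c j"
proof -
  \<comment> \<open>The description defining \<open>simple_coeff\<close> demands the value 0 outside
    the index range, so \<open>c\<close> is cut off there first.\<close>
  define c' where "c' = (\<lambda>j. if j \<in> idx then c j else 0)"
  have c': "x = simple_combination R c'"
    using assms(1) by (simp add: c'_def simple_combination_def)
  have "coeff x = c'"
    unfolding simple_coeff_def
  proof (rule the_equality)
    show "x = simple_combination R c' \<and> (\<forall>j. j \<notin> idx \<longrightarrow> c' j = 0)"
      using c' by (auto simp: c'_def)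
  next
    fix e assume e: "x = simple_combination R e \<and> (\<forall>j. j \<notin> idx \<longrightarrow> e j = 0)"
    have "simple_combination R (\<lambda>j. e j - c' j) = 0"
      using e c' by (simp add: simple_combination_diff)
    from simple_independent[OF this] show "e = c'"
      using e by (auto simp: c'_def fun_eq_iff) 
  qed
  then show ?thesis using assms(2) by (simp add: c'_def)
qed

text \<open>The root lattice, on which \<open>simple_coeff\<close> is meaningful. The additivity
  rules for coefficients carry membership in it as a premise.\<close>

definition root_span :: "(int ^ 'm) set" where
  "root_span = range (simple_combination R)"

lemma root_in_span: "\<beta> \<in> roots R \<Longrightarrow> \<beta> \<in> root_span"
  using root_combination unfolding root_span_def by blast

lemma span_coeff:
  assumes "x \<in> root_span"
  shows "x = simple_combination R (coeff x)"
proof -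
  obtain c where c: "x = simple_combination R c"
    using assms unfolding root_span_def by blast
  then show ?thesis
    using coeff_unique[OF c] by (metis (no_types, lifting) simple_combination_def sum.cong)
qed

lemma coeff_add:
  assumes "x \<in> root_span" "y \<in> root_span" "j \<in> idx"
  shows "coeff (x + y) j = coeff x j + coeff y j"
  using coeff_unique[of "x + y" "\<lambda>j. coeff x j + coeff y j"] span_coeff assms
  by (simp add: simple_combination_add)

lemma coeff_diff:
  assumes "x \<in> root_span" "y \<in> root_span" "j \<in> idx"
  shows "coeff (x - y) j = coeff x j - coeff y j"
  using coeff_unique[of "x - y" "\<lambda>j. coeff x j - coeff y j"] span_coeff assms
  by (simp add: simple_combination_diff)

lemma coeff_smult:
  assumes "x \<in> root_span" "j \<in> idx"
  shows "coeff (a *s x) j = a * coeff x j"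
  using coeff_unique[of "a *s x" "\<lambda>j. a * coeff x j"] span_coeff assms
  by (simp add: simple_combination_smult)

lemma coeff_minus:
  assumes "x \<in> root_span" "j \<in> idx"
  shows "coeff (- x) j = - coeff x j"
proof -
  have "(- 1) *s x = - x" by (simp add: vec_eq_iff)
  then show ?thesis using coeff_smult[OF assms, of "-1"] by simp
qed

lemma coeff_simple:
  assumes "i \<in> idx" "j \<in> idx"
  shows "coeff (simple R i) j = (if j = i then 1 else 0)"
  using coeff_unique[OF simple_combination_single[symmetric]] assms by simp

lemma span_smult: "x \<in> root_span \<Longrightarrow> a *s x \<in> root_span"
  unfolding root_span_def by (auto simp: simple_combination_smult[symmetric])

lemma span_diff: "x \<in> root_span \<Longrightarrow> y \<in> root_span \<Longrightarrow> x - y \<in> root_span"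
  unfolding root_span_def by (auto simp: simple_combination_diff[symmetric])

text \<open>The zero vector also satisfies this; a strict dichotomy with negation holds only for
  roots.\<close>

definition pos :: "int ^ 'm \<Rightarrow> bool" where
  "pos x \<longleftrightarrow> (\<forall>j\<in>idx. coeff x j \<ge> 0)"

lemma root_pos_or_neg:
  assumes "\<beta> \<in> roots R"
  shows "pos \<beta> \<or> pos (- \<beta>)"
  using root_combination[OF assms] coeff_unique coeff_minus[OF root_in_span[OF assms]]
  unfolding pos_def by (metis neg_0_le_iff_le)

lemma root_coeff_nonzero:
  assumes "\<beta> \<in> roots R"
  shows "\<exists>j\<in>idx. coeff \<beta> j \<noteq> 0"
proof (rule ccontr)
  assume "\<not> ?thesis"
  then have "simple_combination R (coeff \<beta>) = 0"
    by (simp add: simple_combination_def)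
  then show False
    using span_coeff[OF root_in_span[OF assms]] root_nonzero[OF assms] by simp
qed

lemma not_pos_and_neg:
  assumes "\<beta> \<in> roots R" "pos \<beta>"
  shows "\<not> pos (- \<beta>)"
  using root_coeff_nonzero[OF assms(1)] assms coeff_minus[OF root_in_span[OF assms(1)]]
  unfolding pos_def by fastforce

lemma pos_simple: "i \<in> idx \<Longrightarrow> pos (simple R i)"
  by (simp add: pos_def coeff_simple)

lemma coeff_refl_simple:
  assumes "x \<in> root_span" "i \<in> idx" "j \<in> idx" "j \<noteq> i"
  shows "coeff (refl (simple R i) x) j = coeff x j"
  using assms
  by (simp add: root_reflection_def coeff_diff coeff_smult coeff_simple span_smult root_in_span simple_root)

text \<open>Here \<beta> is a times a simple root, and pairing with the coroot of \<beta> gives 2,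
  so a divides 2. The value 2 is excluded because the root system is reduced.\<close>

lemma pos_multiple_of_simple:
  assumes "\<beta> \<in> roots R" "pos \<beta>" "i \<in> idx" "\<forall>j\<in>idx. j \<noteq> i \<longrightarrow> coeff \<beta> j = 0"
  shows "\<beta> = simple R i"
proof -
  let ?a = "coeff \<beta> i"
  have "\<beta> = simple_combination R (coeff \<beta>)"
    by (rule span_coeff[OF root_in_span[OF assms(1)]])
  also have "\<dots> = (\<Sum>j=1..ss_rank R. if j = i then ?a *s simple R i else 0)"
    unfolding simple_combination_def using assms(4) by (intro sum.cong) auto
  also have "\<dots> = ?a *s simple R i"
    using assms(3) by simp
  finally have \<beta>: "\<beta> = ?a *s simple R i" .
  then have "2 = ?a * pairing (simple R i) (coroot R \<beta>)"
    using pairing_coroot[OF assms(1)] pairing_smult_left[of ?a "simple R i" "coroot R \<beta>"] \<beta> by simp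
  then have "?a dvd 2" by (metis dvd_triv_left)
  moreover have "?a \<ge> 0" using assms(2,3) by (auto simp: pos_def)
  ultimately have "?a \<in> {1, 2}"
    using zdvd_imp_le[of ?a 2] by (cases "?a = 0") auto
  moreover have "?a \<noteq> 2"
    using \<beta> double_not_root[OF simple_root[OF assms(3)]] assms(1) by auto
  ultimately show ?thesis
    using \<beta> by (auto simp: vec_eq_iff)
qed

text \<open>A simple reflection alters a single coefficient. A positive root other than that simple
  root has another positive coefficient, which survives and decides the sign.\<close>

lemma refl_simple_pos:
  assumes "\<beta> \<in> roots R" "pos \<beta>" "i \<in> idx" "\<beta> \<noteq> simple R i"
  shows "pos (refl (simple R i) \<beta>)"
proof -
  obtain j where j: "j \<in> idx" "j \<noteq> i" "coeff \<beta> j \<noteq> 0"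
    using pos_multiple_of_simple assms by blast
  let ?\<beta> = "refl (simple R i) \<beta>"
  have r: "?\<beta> \<in> roots R" using assms by (simp add: refl_root simple_root)
  have "coeff ?\<beta> j > 0"
    using j assms coeff_refl_simple[OF root_in_span[OF assms(1)], of i j]
    by (force simp: pos_def)
  then have "\<not> pos (- ?\<beta>)"
    using coeff_minus[OF root_in_span[OF r] j(1)] j(1) by (force simp: pos_def)
  then show ?thesis using root_pos_or_neg[OF r] by blast
qed

subsection \<open>Words and the length function\<close>

text \<open>The exchange condition. Read from the right, the word turns the simple root negative at
  some letter j; just before, the root must have been \<alpha>_j. By conjugation the reflection s_i
  at the end then cancels this letter, so j can be deleted.\<close>

lemma exchange:
  assumes "set ws \<subseteq> idx" "i \<in> idx" "pos (- act ws (simple R i))"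
  shows "\<exists>vs. set vs \<subseteq> idx \<and> length vs + 1 = length ws \<and> act vs = act (ws @ [i])"
  using assms(1,3)
proof (induction ws)
  case Nil
  then show ?case
    using not_pos_and_neg[OF simple_root[OF assms(2)] pos_simple[OF assms(2)]] by simp
next
  case (Cons j ws)
  let ?\<beta> = "act ws (simple R i)"
  have ws: "set ws \<subseteq> idx" and j: "j \<in> idx" using Cons.prems by auto
  have r: "?\<beta> \<in> roots R" using ws assms(2) by (simp add: act_root simple_root)
  show ?case
  proof (cases "pos (- ?\<beta>)")
    case True
    then obtain vs where vs: "set vs \<subseteq> idx" "length vs + 1 = length ws" "act vs = act (ws @ [i])"
      using Cons.IH ws by blast
    then have "act (j # vs) = act ((j # ws) @ [i])" by (simp add: fun_eq_iff)
    then show ?thesis using vs j by (intro exI[of _ "j # vs"]) auto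
  next
    case False
    then have "pos ?\<beta>" using root_pos_or_neg[OF r] by blast
    moreover have "\<not> pos (refl (simple R j) ?\<beta>)"
      using Cons.prems(2) not_pos_and_neg[OF refl_root[OF simple_root[OF j] r]] by auto
    ultimately have "?\<beta> = simple R j"
      using refl_simple_pos[OF r _ j] by blast
    then have "act ws x = act ((j # ws) @ [i]) x" for x
      using act_refl_conj[OF ws simple_root[OF assms(2)], of x] refl_refl[OF simple_root[OF j]]
      by (simp add: word_act_append) metis
    then show ?thesis using ws by (intro exI[of _ ws]) auto
  qed
qed

lemma weyl_length_le:
  assumes "set ws \<subseteq> idx"
  shows "weyl_length R (act ws) \<le> length ws"
  unfolding weyl_length_def using assms by (intro Least_le) auto

lemma weyl_length_attained:
  assumes "set ws \<subseteq> idx"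
  obtains vs where "set vs \<subseteq> idx" "act vs = act ws" "length vs = weyl_length R (act ws)"
proof -
  have "\<exists>vs. set vs \<subseteq> idx \<and> act vs = act ws \<and> length vs = weyl_length R (act ws)"
    unfolding weyl_length_def by (rule LeastI_ex) (use assms in blast)
  then show ?thesis using that by blast
qed

text \<open>Otherwise \<open>exchange\<close> would shorten an inner factor, and with it the whole
  word. The prefix \<open>us\<close> is kept free because the Levi word is needed both in front of
  the factor and as part of it.\<close>

lemma reduced_factor_pos:
  assumes "reduced_word R (us @ ws @ [i] @ vs)"
  shows "pos (act ws (simple R i))"
proof (rule ccontr)
  assume neg: "\<not> ?thesis"
  have idx: "set us \<subseteq> idx" "set ws \<subseteq> idx" "i \<in> idx" "set vs \<subseteq> idx"
    using assms by (auto simp: reduced_word_def)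
  then obtain zs where zs: "set zs \<subseteq> idx" "length zs + 1 = length ws" "act zs = act (ws @ [i])"
    using exchange[of ws i] root_pos_or_neg[OF act_root[OF idx(2) simple_root[OF idx(3)]]] neg by blast
  then have "act (us @ zs @ vs) = act (us @ ws @ [i] @ vs)"
    by (simp add: fun_eq_iff word_act_append)
  then have "weyl_length R (act (us @ ws @ [i] @ vs)) \<le> length (us @ zs @ vs)"
    using weyl_length_le[of "us @ zs @ vs"] idx zs by simp
  then show False
    using assms zs by (simp add: reduced_word_def)
qed

text \<open>If w keeps \<alpha>_j positive, then w s_j makes it negative. Exchange applied to a
  shortest word of w s_j yields a shorter word for w, so w s_j is longer than w, against
  maximality.\<close>

lemma long_element_simple_neg:
  assumes "long_element R J (act ws)" "J \<subseteq> idx" "set ws \<subseteq> idx" "j \<in> J"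
  shows "pos (- act ws (simple R j))"
proof (rule ccontr)
  assume neg: "\<not> ?thesis"
  have j: "j \<in> idx" using assms by auto
  have p: "pos (act ws (simple R j))"
    using neg root_pos_or_neg[OF act_root[OF assms(3) simple_root[OF j]]] by blast
  have wsj: "set (ws @ [j]) \<subseteq> idx" using assms(3) j by auto
  obtain vs where vs: "set vs \<subseteq> idx" "act vs = act (ws @ [j])"
      "length vs = weyl_length R (act (ws @ [j]))"
    using weyl_length_attained[OF wsj] .
  have "act vs (simple R j) = - act ws (simple R j)"
    using vs(2) refl_self[OF simple_root[OF j]] by (simp add: word_act_append word_act_minus)
  then obtain zs where zs: "set zs \<subseteq> idx" "length zs + 1 = length vs" "act zs = act (vs @ [j])"
    using exchange[OF vs(1) j] p by auto
  have "act zs = act ws"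
    using zs(3) vs(2) refl_refl[OF simple_root[OF j]] by (simp add: fun_eq_iff word_act_append)
  then have "weyl_length R (act ws) < weyl_length R (act (ws @ [j]))"
    using weyl_length_le[OF zs(1)] zs(2) vs(3) by simp
  \<comment> \<open>The letters of \<open>ws\<close> are not known to lie in \<open>J\<close>; only
    the element has a word that does, so membership of w s_j is shown with
    \<open>us\<close>.\<close>
  moreover obtain us where us: "set us \<subseteq> J" "act ws = act us"
    using assms(1) by (auto simp: long_element_def weyl_group_def)
  have "act (ws @ [j]) = act (us @ [j])"
    using us(2) by (simp add: fun_eq_iff word_act_append)
  then have "act (ws @ [j]) \<in> weyl_group R J"
    using us(1) assms(4) unfolding weyl_group_def by (intro CollectI exI[of _ "us @ [j]"]) auto
  ultimately show False
    using assms(1) by (auto simp: long_element_def)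
qed

lemma act_span: "set ws \<subseteq> idx \<Longrightarrow> x \<in> root_span \<Longrightarrow> act ws x \<in> root_span"
  by (induction ws) (simp_all add: root_reflection_def span_diff span_smult root_in_span simple_root)

lemma coeff_act:
  assumes "set ws \<subseteq> idx - {i}" "i \<in> idx" "x \<in> root_span"
  shows "coeff (act ws x) i = coeff x i"
  using assms
proof (induction ws)
  case (Cons j ws)
  then show ?case using coeff_refl_simple[OF act_span, of ws x j i] by auto
qed simp

lemma coeff_sum:
  assumes "\<And>k. k \<in> K \<Longrightarrow> g k \<in> root_span" "j \<in> idx"
  shows "coeff (\<Sum>k\<in>K. g k) j = (\<Sum>k\<in>K. coeff (g k) j) \<and> (\<Sum>k\<in>K. g k) \<in> root_span"
  using assms
proof (induction K rule: infinite_finite_induct)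
  case (insert k K)
  have "x + y \<in> root_span" if "x \<in> root_span" "y \<in> root_span" for x y
    using that unfolding root_span_def by (auto simp: simple_combination_add[symmetric])
  then show ?case using insert by (simp add: coeff_add)
next
  case empty
  have "simple_combination R (\<lambda>_. 0) = 0" by (simp add: simple_combination_def)
  then show ?case using coeff_unique[of 0 "\<lambda>_. 0" j] assms(2) by (auto simp: root_span_def)
next
  case (infinite K)
  have "simple_combination R (\<lambda>_. 0) = 0" by (simp add: simple_combination_def)
  then show ?case using infinite coeff_unique[of 0 "\<lambda>_. 0" j] assms(2) by (auto simp: root_span_def)
qed

text \<open>Such an \<open>x\<close> is a nonnegative combination of simple roots from
  \<open>J\<close>, each sent to a negative vector.\<close>

lemma act_neg:
  assumes "set ws \<subseteq> idx" "\<forall>j\<in>J. pos (- act ws (simple R j))" "J \<subseteq> idx"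
    "x \<in> root_span" "pos x" "\<forall>j\<in>idx - J. coeff x j = 0"
  shows "pos (- act ws x)"
  unfolding pos_def
proof
  fix i assume i: "i \<in> idx"
  have sp: "act ws (simple R j) \<in> root_span" if "j \<in> idx" for j
    using that assms(1) by (simp add: act_span root_in_span simple_root)
  have "act ws x = (\<Sum>j\<in>idx. coeff x j *s act ws (simple R j))"
    using arg_cong[OF span_coeff[OF assms(4)], of "act ws"]
    by (simp add: simple_combination_def word_act_sum word_act_smult)
  then have "coeff (act ws x) i = (\<Sum>j\<in>idx. coeff x j * coeff (act ws (simple R j)) i)"
    using coeff_sum[of idx "\<lambda>j. coeff x j *s act ws (simple R j)" i] sp i
    by (simp add: span_smult coeff_smult)
  also have "\<dots> \<le> 0"
  proof (rule sum_nonpos)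
    fix j assume j: "j \<in> idx"
    show "coeff x j * coeff (act ws (simple R j)) i \<le> 0"
    proof (cases "j \<in> J")
      case True
      then have "coeff (- act ws (simple R j)) i \<ge> 0"
        using assms(2) i unfolding pos_def by blast
      then have "coeff (act ws (simple R j)) i \<le> 0"
        using coeff_minus[OF sp[OF j] i] by simp
      then show ?thesis using assms(5) j by (simp add: pos_def mult_nonneg_nonpos)
    next
      case False
      then show ?thesis using assms(6) j by simp
    qed
  qed
  finally show "coeff (- act ws x) i \<ge> 0"
    using coeff_minus[OF act_span[OF assms(1,4)] i] by simp
qed

subsection \<open>Irreducible components\<close>

definition linked :: "((int ^ 'm) \<times> (int ^ 'm)) set" where
  "linked = {(\<beta>, \<gamma>). \<beta> \<in> roots R \<and> \<gamma> \<in> roots R \<and> pairing \<beta> (coroot R \<gamma>) \<noteq> 0}"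

lemma linked_sym: "(\<beta>, \<gamma>) \<in> linked \<Longrightarrow> (\<gamma>, \<beta>) \<in> linked"
  using pairing_coroot_symmetric by (auto simp: linked_def)

lemma linked_rtrancl_sym: "(\<beta>, \<gamma>) \<in> linked\<^sup>* \<Longrightarrow> (\<gamma>, \<beta>) \<in> linked\<^sup>*"
  using linked_sym by (metis symI sym_rtrancl symD)

lemma linked_refl:
  assumes "\<alpha> \<in> roots R" "\<beta> \<in> roots R" "pairing \<beta> (coroot R \<alpha>) \<noteq> 0"
  shows "(\<alpha>, refl \<alpha> \<beta>) \<in> linked"
proof -
  have "pairing (refl \<alpha> \<beta>) (coroot R \<alpha>) = - pairing \<beta> (coroot R \<alpha>)"
    using pairing_coroot[OF assms(1)]
    by (simp add: root_reflection_def pairing_diff_left pairing_smult_left)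
  then have "(refl \<alpha> \<beta>, \<alpha>) \<in> linked"
    using assms by (auto simp: linked_def refl_root)
  then show ?thesis by (rule linked_sym)
qed

text \<open>A letter k either fixes the current root or links \<alpha>_k to both the old and the new
  root. Since only the coefficient at k changes, every simple root in the support stays in the same
  component.\<close>

lemma support_linked:
  assumes "set ws \<subseteq> idx" "i \<in> idx" "j \<in> idx" "coeff (act ws (simple R i)) j \<noteq> 0"
  shows "(act ws (simple R i), simple R j) \<in> linked\<^sup>*"
  using assms(1,4)
proof (induction ws)
  case Nil
  then have "i = j" using assms(2,3) by (auto simp: coeff_simple split: if_splits)
  then show ?case by simp
next
  case (Cons k ws)
  let ?\<beta> = "act ws (simple R i)"
  have ws: "set ws \<subseteq> idx" and k: "k \<in> idx" using Cons.prems by auto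
  have r: "?\<beta> \<in> roots R" using ws assms(2) by (simp add: act_root simple_root)
  show ?case
  proof (cases "pairing ?\<beta> (coroot R (simple R k)) = 0")
    case True
    then have "act (k # ws) (simple R i) = ?\<beta>" by (simp add: root_reflection_def)
    then show ?thesis using Cons ws by simp
  next
    case False
    have 1: "(act (k # ws) (simple R i), simple R k) \<in> linked"
      using linked_refl[OF simple_root[OF k] r False] linked_sym by simp
    have 2: "(simple R k, ?\<beta>) \<in> linked"
      using False r simple_root[OF k] linked_sym by (auto simp: linked_def)
    show ?thesis
    proof (cases "j = k")
      case True
      then show ?thesis using 1 by blast
    next
      case False
      then have "coeff ?\<beta> j \<noteq> 0"
        using Cons.prems(2) coeff_refl_simple[OF root_in_span[OF r] k assms(3)] by simp
      then have "(?\<beta>, simple R j) \<in> linked\<^sup>*" using Cons.IH ws by blast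
      then show ?thesis using 1 2 by (meson converse_rtrancl_into_rtrancl)
    qed
  qed
qed

lemma linked_root: "(\<beta>, \<gamma>) \<in> linked\<^sup>* \<Longrightarrow> \<beta> \<in> roots R \<Longrightarrow> \<gamma> \<in> roots R"
  by (induction rule: rtrancl_induct) (auto simp: linked_def)

text \<open>The highest root dominates only its own component, so each use of this bound first needs
  a proof that the root is linked to the omitted simple root.\<close>

lemma cominuscule_coeff_le:
  assumes "cominuscule R i" "(simple R i, \<beta>) \<in> linked\<^sup>*"
  shows "coeff \<beta> i \<le> 1"
proof -
  have i: "i \<in> idx" using assms(1) by (simp add: cominuscule_def)
  have comp: "root_component R (simple R i) = {\<gamma>. (simple R i, \<gamma>) \<in> linked\<^sup>*}"
    by (simp add: root_component_def linked_def)
  obtain \<theta> where \<theta>: "highest_root R i \<theta>" "coeff \<theta> i = 1"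
    using assms(1) by (auto simp: cominuscule_def)
  then have "(simple R i, \<theta>) \<in> linked\<^sup>*" by (simp add: highest_root_def comp)
  then have \<theta>r: "\<theta> \<in> roots R" using linked_root simple_root i by blast
  have \<beta>r: "\<beta> \<in> roots R" using linked_root simple_root i assms(2) by blast
  obtain c where "\<theta> - \<beta> = simple_combination R c" "\<forall>j. c j \<ge> 0"
    using \<theta>(1) assms(2) unfolding highest_root_def comp by blast
  then have "coeff (\<theta> - \<beta>) i \<ge> 0" using coeff_unique i by metis
  then show ?thesis
    using coeff_diff[OF root_in_span[OF \<theta>r] root_in_span[OF \<beta>r] i] \<theta>(2) by simp
qed

subsection \<open>The roots of the unipotent radical\<close>

context
  fixes P :: parabolic_data
  assumes comin: "cominuscule_parabolic R P"
begin

lemma omitted_idx: "omitted P \<in> idx"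
  using comin by (simp add: cominuscule_parabolic_def cominuscule_def)

lemma words_idx: "set (levi_word P) \<subseteq> idx" "set (unip_word P) \<subseteq> idx"
  using comin by (auto simp: cominuscule_parabolic_def reduced_word_def)

text \<open>The element of the Levi word also has a word that avoids the omitted index, and none of
  those letters touches this coefficient.\<close>

lemma coeff_act_levi:
  assumes "x \<in> root_span"
  shows "coeff (act (levi_word P) x) (omitted P) = coeff x (omitted P)"
proof -
  obtain ws where "set ws \<subseteq> idx - {omitted P}" "act (levi_word P) = act ws"
    using comin by (auto simp: cominuscule_parabolic_def long_element_def weyl_group_def)
  then show ?thesis using coeff_act[OF _ omitted_idx assms] by simp
qed

text \<open>With an empty unipotent word, w_M would be the long element of the whole group and make
  the omitted simple root negative, although W_M preserves its coefficient 1. The last index, used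
  for the omitted coordinate, thus exists.\<close>

lemma unip_dim_pos: "unip_dim P > 0"
proof (rule ccontr)
  assume "\<not> ?thesis"
  then have "long_element R idx (act (levi_word P))"
    using comin by (simp add: cominuscule_parabolic_def unip_dim_def)
  then have "pos (- act (levi_word P) (simple R (omitted P)))"
    using long_element_simple_neg omitted_idx words_idx by blast
  moreover have "coeff (act (levi_word P) (simple R (omitted P))) (omitted P) = 1"
    using coeff_act_levi[OF root_in_span[OF simple_root]] omitted_idx by (simp add: coeff_simple)
  ultimately show False
    using omitted_idx coeff_minus[OF act_span[OF words_idx(1) root_in_span[OF simple_root]]]
    by (force simp: pos_def)
qed

lemma unip_root_eq_act:
  assumes "k \<in> {1..unip_dim P}"
  obtains ws i where "set ws \<subseteq> idx" "i \<in> idx" "unip_root R P k = act ws (simple R i)"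
proof
  show "set (levi_word P @ take (k - 1) (unip_word P)) \<subseteq> idx"
    using words_idx set_take_subset by fastforce
  show "unip_word P ! (k - 1) \<in> idx"
    using words_idx(2) assms nth_mem[of "k - 1" "unip_word P"] by (force simp: unip_dim_def)
qed (simp add: unip_root_def word_act_append)

lemma unip_root_root:
  assumes "k \<in> {1..unip_dim P}"
  shows "unip_root R P k \<in> roots R"
  using unip_root_eq_act[OF assms] act_root simple_root by metis

text \<open>Write the root as w_M \<beta>. Reducedness makes both \<beta> and w_M \<beta> positive.
  If the coefficient vanished, \<beta> would be a combination of simple roots of the Levi factor,
  all of which w_M makes negative.\<close>

lemma unip_root_coeff_pos:
  assumes k: "k \<in> {1..unip_dim P}"
  shows "coeff (unip_root R P k) (omitted P) > 0"
proof (rule ccontr)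
  assume neg: "\<not> ?thesis"
  define us where "us = take (k - 1) (unip_word P)"
  define i where "i = unip_word P ! (k - 1)"
  define \<beta> where "\<beta> = act us (simple R i)"
  have split: "unip_word P = us @ [i] @ drop k (unip_word P)"
    using k id_take_nth_drop[of "k - 1" "unip_word P"] by (auto simp: us_def i_def unip_dim_def)
  have red: "reduced_word R (levi_word P @ us @ [i] @ drop k (unip_word P))"
    using comin split by (simp add: cominuscule_parabolic_def)
  have idx: "set us \<subseteq> idx" "i \<in> idx" using red by (auto simp: reduced_word_def)
  have \<gamma>: "unip_root R P k = act (levi_word P) \<beta>"
    by (simp add: unip_root_def \<beta>_def us_def i_def)
  have \<beta>r: "\<beta> \<in> roots R" unfolding \<beta>_def using idx by (simp add: act_root simple_root)
  have \<beta>pos: "pos \<beta>" unfolding \<beta>_def using reduced_factor_pos[OF red] .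
  have \<gamma>pos: "pos (unip_root R P k)"
    using reduced_factor_pos[of "[]" "levi_word P @ us" i "drop k (unip_word P)"] red
    by (simp add: \<gamma> \<beta>_def word_act_append)
  have "coeff \<beta> (omitted P) = 0"
    using neg \<beta>pos omitted_idx coeff_act_levi[OF root_in_span[OF \<beta>r]] \<gamma> by (force simp: pos_def)
  then have z: "\<forall>j\<in>idx - (idx - {omitted P}). coeff \<beta> j = 0" by auto
  have "\<forall>j\<in>idx - {omitted P}. pos (- act (levi_word P) (simple R j))"
    using long_element_simple_neg[of "idx - {omitted P}" "levi_word P"] comin words_idx(1)
    by (auto simp: cominuscule_parabolic_def)
  then have "pos (- unip_root R P k)"
    unfolding \<gamma> using act_neg[OF words_idx(1) _ _ root_in_span[OF \<beta>r] \<beta>pos z] by blast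
  then show False
    using not_pos_and_neg[OF unip_root_root[OF k] \<gamma>pos] by blast
qed

lemma unip_root_linked:
  assumes k: "k \<in> {1..unip_dim P}"
  shows "(simple R (omitted P), unip_root R P k) \<in> linked\<^sup>*"
proof -
  obtain ws i where ws: "set ws \<subseteq> idx" "i \<in> idx" "unip_root R P k = act ws (simple R i)"
    using unip_root_eq_act[OF k] .
  have "coeff (act ws (simple R i)) (omitted P) \<noteq> 0"
    using unip_root_coeff_pos[OF k] ws(3) by simp
  then show ?thesis
    using linked_rtrancl_sym[OF support_linked[OF ws(1,2) omitted_idx]] ws(3) by simp
qed

lemma cominuscule_omitted: "cominuscule R (omitted P)"
  using comin by (simp add: cominuscule_parabolic_def)

lemma unip_root_coeff:
  assumes k: "k \<in> {1..unip_dim P}"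
  shows "coeff (unip_root R P k) (omitted P) = 1"
  using unip_root_coeff_pos[OF k] cominuscule_coeff_le[OF cominuscule_omitted unip_root_linked[OF k]]
  by simp

lemma unip_pairing_nonneg:
  assumes k: "k \<in> {1..unip_dim P}" and l: "l \<in> {1..unip_dim P}"
  shows "pairing (unip_root R P k) (unip_coroot R P l) \<ge> 0"
proof (rule ccontr)
  let ?k = "unip_root R P k" and ?l = "unip_root R P l"
  let ?p = "pairing ?k (coroot R ?l)"
  assume "\<not> ?thesis"
  then have p: "?p < 0" by (simp add: unip_coroot_def)
  \<comment> \<open>A nonzero pairing keeps the reflected root in the component of the omitted
    simple root, where coefficients are at most 1; but its coefficient is 1 - p, at least 2.\<close>
  then have "(?l, refl ?l ?k) \<in> linked"
    using linked_refl[OF unip_root_root[OF l] unip_root_root[OF k]] by simp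
  then have "(simple R (omitted P), refl ?l ?k) \<in> linked\<^sup>*"
    using unip_root_linked[OF l] by simp
  then have "coeff (refl ?l ?k) (omitted P) \<le> 1"
    by (rule cominuscule_coeff_le[OF cominuscule_omitted])
  moreover have "coeff (refl ?l ?k) (omitted P) = 1 - ?p"
    using unip_root_coeff k l omitted_idx
    by (simp add: root_reflection_def coeff_diff coeff_smult span_smult root_in_span unip_root_root)
  ultimately show False using p by simp
qed

text \<open>The coefficient at the omitted root, where \<alpha>_j contributes nothing, gives i = i'.
  The coefficient at j then exhibits 1 as a multiple of i.\<close>

lemma root_pairs_cases:
  assumes "(k, k', i, i') \<in> root_pairs R P j" "j \<in> idx" "j \<noteq> omitted P"
  shows "k \<in> {1..unip_dim P}" "k' \<in> {1..unip_dim P}" "k' < k" "i = 1" "i' = 1"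
    "unip_root R P k' - simple R j = unip_root R P k"
proof -
  let ?k = "unip_root R P k" and ?k' = "unip_root R P k'"
  show k: "k \<in> {1..unip_dim P}" and k': "k' \<in> {1..unip_dim P}" and "k' < k"
    using assms(1) by (auto simp: root_pairs_def)
  have eq: "int i *s ?k - int i' *s ?k' = - simple R j" and "i > 0"
    using assms(1) by (auto simp: root_pairs_def)
  have sp: "?k \<in> root_span" "?k' \<in> root_span" "simple R j \<in> root_span"
    using k k' assms(2) by (auto simp: root_in_span unip_root_root simple_root)
  have c: "int i * coeff ?k a - int i' * coeff ?k' a = - coeff (simple R j) a" if "a \<in> idx" for a
    using arg_cong[OF eq, of "\<lambda>x. coeff x a"] that sp
    by (simp add: coeff_diff coeff_smult coeff_minus span_smult)
  have ii: "i' = i"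
    using c[OF omitted_idx] k k' assms(2,3) omitted_idx by (simp add: unip_root_coeff coeff_simple)
  have "int i * (coeff ?k' j - coeff ?k j) = 1"
    using c[OF assms(2)] assms(2) ii by (simp add: coeff_simple algebra_simps)
  then have "int i dvd 1" by (metis dvd_triv_left)
  then show "i = 1" using \<open>i > 0\<close> by simp
  then show "i' = 1" using ii by simp
  show "?k' - simple R j = ?k"
    using eq \<open>i = 1\<close> \<open>i' = 1\<close> by (simp add: vec_eq_iff algebra_simps)
qed

end

end

section \<open>Arithmetic of S-integers\<close>

subsection \<open>Absolute values\<close>

context
  fixes v :: "'f::field_char_0 \<Rightarrow> real"
  assumes av: "absolute_value v"
begin

lemma av_nonneg: "v x \<ge> 0" and av_zero: "v x = 0 \<longleftrightarrow> x = 0"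
  and av_mult: "v (x * y) = v x * v y" and av_triangle: "v (x + y) \<le> v x + v y"
  using av unfolding absolute_value_def by blast+

lemma av_0: "v 0 = 0"
  by (simp add: av_zero)

lemma av_one: "v 1 = 1"
  using av_mult[of 1 1] av_zero[of 1] by simp

lemma av_power: "v (x ^ n) = v x ^ n"
  by (induction n) (simp_all add: av_one av_mult)

lemma av_root_of_unity:
  assumes "x ^ n = 1" "n > 0"
  shows "v x = 1"
  using av_power[of x n] assms av_one av_nonneg[of x] power_eq_imp_eq_base[of "v x" n 1] by simp

lemma av_minus: "v (- x) = v x"
  using av_mult[of "-1" x] av_root_of_unity[of "-1" 2] by simp

lemma av_inverse: "v (inverse x) = inverse (v x)"
proof (cases "x = 0")
  case False
  then have "v (inverse x) * v x = 1" by (simp flip: av_mult add: av_one)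
  then show ?thesis by (metis inverse_unique mult.commute)
qed (simp_all add: av_0)

lemma av_divide: "v (x / y) = v x / v y"
  by (simp add: divide_inverse av_mult av_inverse)

context
  assumes ultra: "\<And>x y. v (x + y) \<le> max (v x) (v y)"
begin

lemma ultra_diff: "v (x - y) \<le> max (v x) (v y)"
  using ultra[of x "- y"] av_minus by simp

lemma ultra_dominant:
  assumes "v y < v x"
  shows "v (x + y) = v x"
  using ultra[of x y] ultra_diff[of "x + y" y] assms by simp

lemma ultra_of_nat: "v (of_nat k) \<le> 1"
proof (induction k)
  case (Suc k)
  then show ?case using ultra[of 1 "of_nat k"] av_one by simp
qed (simp_all add: av_0)

lemma ultra_of_int: "v (of_int k) \<le> 1"
  using ultra_of_nat[of "nat k"] ultra_of_nat[of "nat (- k)"] av_minus[of "of_int k"]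
  by (cases "k \<ge> 0") auto

lemma ultra_sum:
  assumes "\<And>i. i \<in> I \<Longrightarrow> v (g i) \<le> B" "B \<ge> 0"
  shows "v (\<Sum>i\<in>I. g i) \<le> B"
  using assms
proof (induction I rule: infinite_finite_induct)
  case (insert i I)
  then have "v (g i) \<le> B" "v (\<Sum>i\<in>I. g i) \<le> B" by auto
  then have "max (v (g i)) (v (\<Sum>i\<in>I. g i)) \<le> B" by simp
  then show ?case using insert.hyps ultra[of "g i" "\<Sum>i\<in>I. g i"] by (simp del: max.bounded_iff)
qed (simp_all add: av_0)

text \<open>An integer prime to l has absolute value 1, by a Bezout identity and the ultrametric
  inequality. Hence only the l-part of a rational contributes.\<close>

lemma rational_value_group:
  fixes l :: nat
  assumes l: "Factorial_Ring.prime l" "v (of_nat l) < 1" and "q \<noteq> 0"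
  shows "\<exists>k::int. v (of_rat q) = v (of_nat l) powi k"
proof -
  have l0: "v (of_nat l) > 0"
    using l(1) av_nonneg[of "of_nat l"] av_zero[of "of_nat l"]
    by (metis less_eq_real_def not_prime_0 of_nat_eq_0_iff)
  have int_val: "\<exists>m::nat. v (of_int a) = v (of_nat l) ^ m" if a0: "a \<noteq> 0" for a :: int
  proof -
    obtain a' where a': "a = int l ^ multiplicity (int l) a * a'" "\<not> int l dvd a'"
    proof (rule multiplicity_decompose')
      show "\<not> is_unit (int l)" using l(1) by auto
    qed (use a0 that in auto)
    have "coprime (int l) a'"
      using l(1) a'(2) by (simp add: prime_imp_coprime prime_nat_int_transfer)
    then obtain x y where "x * int l + y * a' = 1"
      by (metis bezout_int coprime_imp_gcd_eq_1)
    then have e: "of_int x * of_nat l + of_int y * (of_int a' :: 'f) = 1"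
      by (metis of_int_1 of_int_add of_int_mult of_int_of_nat_eq)
    have "1 \<le> max (v (of_int x) * v (of_nat l)) (v (of_int y) * v (of_int a'))"
      using ultra[of "of_int x * of_nat l" "of_int y * of_int a'"] e av_one av_mult by simp
    moreover have "v (of_int x) * v (of_nat l) < 1"
      using ultra_of_int[of x] l(2) l0 av_nonneg[of "of_int x"]
      by (meson le_less_trans mult_left_le_one_le less_imp_le)
    ultimately have "1 \<le> v (of_int y) * v (of_int a')" by simp
    moreover have "v (of_int y) * v (of_int a') \<le> 1 * v (of_int a')"
      using ultra_of_int[of y] av_nonneg by (intro mult_right_mono) auto
    ultimately have "v (of_int a') = 1" using ultra_of_int[of a'] by simp
    moreover have "(of_int a :: 'f) = of_nat l ^ multiplicity (int l) a * of_int a'"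
      by (subst a'(1)) simp
    ultimately show ?thesis using av_mult av_power by auto
  qed
  obtain a b where ab: "quotient_of q = (a, b)" by fastforce
  have b: "b > 0" and q: "q = of_int a / of_int b"
    using ab quotient_of_denom_pos quotient_of_div by blast+
  have a: "a \<noteq> 0" using q \<open>q \<noteq> 0\<close> by auto
  obtain m where m: "v (of_int a) = v (of_nat l) ^ m" using int_val[OF a] by blast
  obtain m' where m': "v (of_int b) = v (of_nat l) ^ m'" using int_val[of b] b by auto
  have "v (of_rat q) = v (of_int a) / v (of_int b)"
    by (simp add: q of_rat_divide av_divide)
  also have "\<dots> = v (of_nat l) powi (int m - int m')"
    using l0 m m' by (simp add: power_int_diff)
  finally show ?thesis by blast
qed

text \<open>Expanding \<open>(1 + u)^l = 1\<close>, all middle terms are divisible by \<open>l u\<^sup>2\<close>, so the extreme terms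
  \<open>l u\<close> and \<open>u^l\<close> must have the same absolute value.\<close>

lemma prime_root_of_unity_value:
  fixes l :: nat
  assumes l: "Factorial_Ring.prime l" and x: "x ^ l = 1" "x \<noteq> 1" "v (x - 1) < 1"
  shows "v (x - 1) ^ (l - 1) = v (of_nat l)"
proof -
  define u where "u = x - 1"
  have u: "v u > 0" "v u < 1"
    using x av_nonneg[of u] av_zero[of u] unfolding u_def by (auto simp: less_eq_real_def)
  have l2: "l \<ge> 2" using l prime_ge_2_nat by blast
  have lpos: "v (of_nat l) > 0"
    using l2 av_nonneg[of "of_nat l"] av_zero[of "of_nat l"] by (auto simp: less_eq_real_def)
  define M where "M = (\<Sum>i\<in>{2..<l}. of_nat (l choose i) * u ^ i)"
  have "{..l} = {0, 1, l} \<union> {2..<l}" using l2 by auto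
  moreover have "(\<Sum>i\<in>{0, 1, l} \<union> {2..<l}. of_nat (l choose i) * u ^ i) = 1 + of_nat l * u + u ^ l + M"
    using l2 unfolding M_def by (subst sum.union_disjoint) auto
  ultimately have "(u + 1) ^ l = 1 + of_nat l * u + u ^ l + M"
    by (simp add: binomial_ring)
  then have ul: "u ^ l = - (of_nat l * u + M)"
    using x(1) by (simp add: u_def algebra_simps)
  have "v M \<le> v (of_nat l) * v u ^ 2"
    unfolding M_def
  proof (rule ultra_sum)
    fix i assume i: "i \<in> {2..<l}"
    then have "l dvd (l choose i)" using l by (intro dvd_choose_prime) auto
    then obtain c where c: "l choose i = l * c" by blast
    have "v u ^ i \<le> v u ^ 2" using u i by (intro power_decreasing) auto
    then have "v (of_nat c) * v u ^ i \<le> 1 * v u ^ 2"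
      using ultra_of_nat[of c] av_nonneg by (intro mult_mono) auto
    then show "v (of_nat (l choose i) * u ^ i) \<le> v (of_nat l) * v u ^ 2"
      using c lpos by (simp add: av_mult av_power mult.assoc)
  qed (use lpos in auto)
  also have "\<dots> < v (of_nat l) * v u"
    using u lpos by (simp add: power2_eq_square)
  finally have "v (of_nat l * u + M) = v (of_nat l) * v u"
    using ultra_dominant[of M "of_nat l * u"] by (simp add: av_mult)
  then have "v u ^ l = v (of_nat l) * v u"
    using ul av_minus av_power by metis
  moreover have "v u ^ l = v u ^ (l - 1) * v u"
    using l2 by (metis Suc_diff_1 gr0I not_numeral_le_zero power_Suc2)
  ultimately show ?thesis using u unfolding u_def by simp
qed

text \<open>If the value group is that of the rationals, a nontrivial root of unity congruent to 1 has
  order 2, and this is excluded by the presence of a square root of -1.\<close>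

lemma root_of_unity_near_one:
  assumes unram: "\<And>x. x \<noteq> 0 \<Longrightarrow> \<exists>q. v x = v (of_rat q)"
    and x: "x ^ n = 1" "n > 0" "v (x - 1) < 1"
    and i: "(- 1 :: 'f) ^ n = 1 \<Longrightarrow> \<exists>i::'f. i\<^sup>2 = - 1"
  shows "x = 1"
proof (rule ccontr)
  assume x1: "x \<noteq> 1"
  \<comment> \<open>Needed because the argument passes to a power of \<open>x\<close>, which must
    again be close to 1.\<close>
  have pow: "v (x ^ k - 1) < 1" for k
  proof (induction k)
    case (Suc k)
    have "x ^ Suc k - 1 = x * (x ^ k - 1) + (x - 1)" by (simp add: algebra_simps)
    then have "v (x ^ Suc k - 1) \<le> max (v x * v (x ^ k - 1)) (v (x - 1))"
      using ultra av_mult by metis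
    then show ?case using Suc x(3) av_root_of_unity[OF x(1,2)] by simp
  qed (simp_all add: av_0)
  \<comment> \<open>Primes are stripped from an exponent annihilating \<open>x\<close> until the
    power is nontrivial; that power has prime order.\<close>
  have "\<exists>l m. Factorial_Ring.prime l \<and> x ^ m \<noteq> 1 \<and> (x ^ m) ^ l = 1" if "x ^ k = 1" "k > 0" for k :: nat
    using that
  proof (induction k rule: less_induct)
    case (less k)
    then have "k \<noteq> 1" using x1 by auto
    then obtain l where l: "Factorial_Ring.prime l" "l dvd k" using prime_factor_nat by blast
    then obtain m where m: "k = m * l" by (metis dvdE mult.commute)
    show ?case
    proof (cases "x ^ m = 1")
      case True
      moreover have "m < k" "m > 0" using m l(1) less(3) prime_gt_1_nat[OF l(1)] by auto
      ultimately show ?thesis using less.IH by blast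
    next
      case False
      then show ?thesis using l(1) less(2) m by (metis power_mult)
    qed
  qed
  then obtain l m where l: "Factorial_Ring.prime l" and m: "x ^ m \<noteq> 1" "(x ^ m) ^ l = 1"
    using x by blast
  have val: "v (x ^ m - 1) ^ (l - 1) = v (of_nat l)"
    by (rule prime_root_of_unity_value[OF l m(2,1) pow])
  have l2: "l \<ge> 2" using l prime_ge_2_nat by blast
  have lt: "v (of_nat l) < 1"
    using val power_strict_mono[OF pow[of m] av_nonneg, of "l - 1"] l2 by simp
  have pos: "v (of_nat l) > 0"
    using l2 av_nonneg[of "of_nat l"] av_zero[of "of_nat l"] by (auto simp: less_eq_real_def)
  \<comment> \<open>As v y is an integral power of v l, no proper root of v l is a value. With k = l
    - 1 this forces l = 2; with k = 2 it produces the final contradiction.\<close>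
  have exponent: "int k dvd 1" if y: "y \<noteq> 0" "v y ^ k = v (of_nat l)" for y k
  proof -
    obtain q where q: "v y = v (of_rat q)" using unram[OF y(1)] by blast
    then have "q \<noteq> 0" using y(1) av_zero by (metis of_rat_0)
    then obtain e :: int where e: "v y = v (of_nat l) powi e"
      using rational_value_group[OF l lt] q by metis
    then have "v (of_nat l) powi (e * int k) = v (of_nat l) powi 1"
      using y(2) by (simp add: power_int_mult)
    then have "e * int k = 1"
      using power_int_strict_decreasing[OF _ pos lt, of 1 "e * int k"]
        power_int_strict_decreasing[OF _ pos lt, of "e * int k" 1] by (cases "e * int k" "1::int" rule: linorder_cases) auto
    then show ?thesis by (metis dvd_triv_right)
  qed
  have "int (l - 1) dvd 1" using exponent[OF _ val] m(1) by simp
  then have "l = 2" using l2 by simp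
  then have "(x ^ m) ^ 2 = 1" using m(2) by simp
  then have xm: "x ^ m = - 1" using m(1) power2_eq_1_iff by blast
  have "(- 1 :: 'f) ^ n = 1" using x(1) xm by (metis power_mult mult.commute power_one)
  then obtain j :: 'f where j: "j\<^sup>2 = - 1" using i by blast
  have "j ^ 4 = (j\<^sup>2)\<^sup>2" by (simp flip: power_mult)
  then have "j ^ 4 = 1" using j by simp
  then have "v j = 1" using av_root_of_unity by force
  \<comment> \<open>For a square root j of -1, the value of j - 1 is a square root of the value of
    2, which \<open>exponent\<close> forbids.\<close>
  have "(j - 1)\<^sup>2 = - (of_nat 2 * j)" using j by (simp add: power2_diff)
  then have "v (j - 1) ^ 2 = v (of_nat l)"
    using \<open>v j = 1\<close> \<open>l = 2\<close> av_mult av_minus av_power by (metis mult.right_neutral)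
  moreover have "j - 1 \<noteq> 0" using j by auto
  ultimately show False using exponent[of "j - 1" 2] by simp
qed

end

end

section \<open>Places and the ring of S-integers\<close>

lemma place_absolute_value:
  assumes "P \<in> places"
  shows "absolute_value (place_abs P)"
proof -
  obtain v where v: "P = {w. absolute_value w \<and> equivalent_absolute_values v w}"
    "nontrivial_absolute_value v"
    using assms unfolding places_def by blast
  have "v x = v x powr 1" for x
    using v(2) by (simp add: nontrivial_absolute_value_def absolute_value_def)
  then have "v \<in> P"
    using v unfolding nontrivial_absolute_value_def equivalent_absolute_values_def
    by (auto intro!: exI[of _ "1::real"])
  then have "place_abs P \<in> P" unfolding place_abs_def by (rule someI[of "\<lambda>v. v \<in> P"])
  then show ?thesis using v(1) by simp
qed

locale arithmetic =
  fixes A :: "('f::number_field) arithmetic_data"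
  assumes setting: "arithmetic_setting A"
begin

abbreviation ints :: "'f set" where "ints \<equiv> carrier (oS A)"
abbreviation deg :: nat where "deg \<equiv> sym_deg A"
abbreviation mu :: "'f set" where "mu \<equiv> roots_of_unity deg"
abbreviation pideal :: "'f \<Rightarrow> 'f set" where "pideal p \<equiv> PIdl\<^bsub>oS A\<^esub> p"

lemma oS_simps [simp]:
  "x \<otimes>\<^bsub>oS A\<^esub> y = x * y" "x \<oplus>\<^bsub>oS A\<^esub> y = x + y" "\<one>\<^bsub>oS A\<^esub> = 1" "\<zero>\<^bsub>oS A\<^esub> = 0"
  by (simp_all add: S_integers_def)

lemma principal: "principal_domain (oS A)"
  using setting by (simp add: arithmetic_setting_def)

sublocale D: principal_domain "oS A"
  by (rule principal)

lemma deg_pos: "deg > 0"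
  using setting by (simp add: arithmetic_setting_def)

lemma ints_add: "x \<in> ints \<Longrightarrow> y \<in> ints \<Longrightarrow> x + y \<in> ints"
  and ints_mult: "x \<in> ints \<Longrightarrow> y \<in> ints \<Longrightarrow> x * y \<in> ints"
  and ints_1: "1 \<in> ints" and ints_0: "0 \<in> ints"
  using D.a_closed D.m_closed D.one_closed D.zero_closed by simp_all

lemma ints_minus:
  assumes "x \<in> ints"
  shows "- x \<in> ints"
proof -
  have "x + (\<ominus>\<^bsub>oS A\<^esub> x) = 0"
    using D.r_neg[OF assms] by simp
  then have "- x = \<ominus>\<^bsub>oS A\<^esub> x"
    by (rule minus_unique)
  then show ?thesis using D.a_inv_closed[OF assms] by simp
qed

lemma ints_diff: "x \<in> ints \<Longrightarrow> y \<in> ints \<Longrightarrow> x - y \<in> ints"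
  using ints_add[OF _ ints_minus, of x y] by simp

lemma ints_power: "x \<in> ints \<Longrightarrow> x ^ k \<in> ints"
  by (induction k) (simp_all add: ints_1 ints_mult)

lemma ints_prod: "(\<And>i. i \<in> I \<Longrightarrow> g i \<in> ints) \<Longrightarrow> (\<Prod>i\<in>I. g i) \<in> ints"
  by (induction I rule: infinite_finite_induct) (simp_all add: ints_1 ints_mult)

lemma ints_sum: "(\<And>i. i \<in> I \<Longrightarrow> g i \<in> ints) \<Longrightarrow> (\<Sum>i\<in>I. g i) \<in> ints"
  by (induction I rule: infinite_finite_induct) (simp_all add: ints_0 ints_add)

lemma ints_of_int: "of_int k \<in> ints"
proof -
  have "of_nat m \<in> ints" for m
    by (induction m) (simp_all add: ints_0 ints_1 ints_add)
  from this[of "nat k"] ints_minus[OF this[of "nat (- k)"]] show ?thesis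
    by (cases "k \<ge> 0") auto
qed

lemmas ints_closed = ints_add ints_mult ints_1 ints_0 ints_minus ints_diff ints_power ints_of_int

section \<open>Divisibility and congruences; \<open>x \<in> pideal p\<close> says that
  \<open>p\<close> divides \<open>x\<close>\<close>

lemma pideal_iff: "x \<in> pideal p \<longleftrightarrow> (\<exists>a\<in>ints. x = a * p)"
  by (auto simp: cgenideal_def)

lemma pidealI: "a \<in> ints \<Longrightarrow> x = a * p \<Longrightarrow> x \<in> pideal p"
  by (auto simp: pideal_iff)

lemma pideal_0: "0 \<in> pideal p"
  by (rule pidealI[OF ints_0]) simp

lemma pideal_add: "x \<in> pideal p \<Longrightarrow> y \<in> pideal p \<Longrightarrow> x + y \<in> pideal p"
  unfolding pideal_iff by (metis ints_add distrib_right)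

lemma pideal_minus: "x \<in> pideal p \<Longrightarrow> - x \<in> pideal p"
  unfolding pideal_iff by (metis ints_minus mult_minus_left)

lemma pideal_diff: "x \<in> pideal p \<Longrightarrow> y \<in> pideal p \<Longrightarrow> x - y \<in> pideal p"
  using pideal_add[OF _ pideal_minus, of x p y] by simp

lemma pideal_mult:
  assumes "a \<in> ints" "x \<in> pideal p"
  shows "a * x \<in> pideal p"
proof -
  obtain b where "b \<in> ints" "x = b * p" using assms(2) by (auto simp: pideal_iff)
  then show ?thesis using assms(1) by (intro pidealI[of "a * b"]) (simp_all add: ints_mult mult.assoc)
qed

lemma pideal_mono:
  assumes "x \<in> pideal q" "q \<in> pideal p"
  shows "x \<in> pideal p"
  using assms(1) pideal_mult[OF _ assms(2)] unfolding pideal_iff[of x q] by blast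

lemma pideal_cong_mult:
  assumes "x - y \<in> pideal p" "z - w \<in> pideal p" "y \<in> ints" "z \<in> ints"
  shows "x * z - y * w \<in> pideal p"
proof -
  have "x * z - y * w = z * (x - y) + y * (z - w)" by (simp add: algebra_simps)
  then show ?thesis using assms by (simp add: pideal_add pideal_mult)
qed

lemma pideal_cong_power:
  assumes "x - y \<in> pideal p" "x \<in> ints" "y \<in> ints"
  shows "x ^ m - y ^ m \<in> pideal p"
  using assms
  by (induction m) (auto intro!: pideal_cong_mult ints_power simp: pideal_0)

lemma pideal_coset_eq: "pideal p +>\<^bsub>oS A\<^esub> x = pideal p +>\<^bsub>oS A\<^esub> y \<longleftrightarrow> x - y \<in> pideal p"
proof
  assume "pideal p +>\<^bsub>oS A\<^esub> x = pideal p +>\<^bsub>oS A\<^esub> y"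
  moreover have "x \<in> pideal p +>\<^bsub>oS A\<^esub> x"
    using pideal_0 by (force simp: a_r_coset_def')
  ultimately show "x - y \<in> pideal p"
    by (auto simp: a_r_coset_def')
next
  assume xy: "x - y \<in> pideal p"
  have "h + x \<in> (\<lambda>h. h + y) ` pideal p" "h + y \<in> (\<lambda>h. h + x) ` pideal p" if "h \<in> pideal p" for h
    using pideal_add[OF that xy] pideal_diff[OF that xy]
    by (auto intro: image_eqI[of _ _ "h + (x - y)"] image_eqI[of _ _ "h - (x - y)"])
  then show "pideal p +>\<^bsub>oS A\<^esub> x = pideal p +>\<^bsub>oS A\<^esub> y"
    unfolding a_r_coset_def' oS_simps by blast
qed

subsection \<open>Coprimality\<close>

text \<open>Coprimality in Bezout form, equivalent to gcd 1 because the ring is principal. The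
  multipliers u and v supply every explicit solution of a congruence below.\<close>

definition cop :: "'f \<Rightarrow> 'f \<Rightarrow> bool" where
  "cop a b \<longleftrightarrow> (\<exists>u\<in>ints. \<exists>v\<in>ints. u * a + v * b = 1)"

lemma coprime_S_iff_cop:
  assumes "a \<in> ints" "b \<in> ints"
  shows "coprime_S A a b \<longleftrightarrow> cop a b"
proof
  assume "coprime_S A a b"
  then have "pideal 1 = pideal a <+>\<^bsub>oS A\<^esub> pideal b"
    using D.ideal_sum_iff_gcd[OF assms ints_1] by (simp add: coprime_S_def)
  moreover have "1 \<in> pideal 1" using ints_1 by (auto simp: pideal_iff)
  ultimately show "cop a b"
    by (auto simp: set_add_def' cop_def pideal_iff) metis
next
  assume "cop a b"
  then obtain u v where uv: "u \<in> ints" "v \<in> ints" "u * a + v * b = 1" by (auto simp: cop_def)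
  have "\<exists>c\<in>ints. 1 = y * c" if "c \<in> ints" "c' \<in> ints" "a = y * c" "b = y * c'" for y c c'
    using uv that by (intro bexI[of _ "u * c + v * c'"]) (auto simp: algebra_simps ints_closed)
  then show "coprime_S A a b"
    using assms unfolding coprime_S_def isgcd_def factor_def by auto
qed

lemma cop_commute: "cop a b \<Longrightarrow> cop b a"
  unfolding cop_def by (metis add.commute)

lemma cop_1: "cop 1 a"
  unfolding cop_def using ints_0 ints_1 by (intro bexI[of _ 1] bexI[of _ 0]) auto

lemma cop_mult:
  assumes "cop a c" "cop b c" "a \<in> ints" "b \<in> ints" "c \<in> ints"
  shows "cop (a * b) c"
proof -
  obtain u v where uv: "u \<in> ints" "v \<in> ints" "u * a + v * c = 1" using assms(1) by (auto simp: cop_def)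
  obtain u' v' where uv': "u' \<in> ints" "v' \<in> ints" "u' * b + v' * c = 1"
    using assms(2) by (auto simp: cop_def)
  have "1 = (u * a + v * c) * (u' * b + v' * c)" using uv uv' by simp
  also have "\<dots> = (u * u') * (a * b) + (u * a * v' + v * (u' * b + v' * c)) * c"
    by (simp add: algebra_simps)
  finally show ?thesis
    unfolding cop_def using uv uv' assms by (metis (no_types, lifting) ints_add ints_mult)
qed

lemma cop_power: "cop a c \<Longrightarrow> a \<in> ints \<Longrightarrow> c \<in> ints \<Longrightarrow> cop (a ^ k) c"
  by (induction k) (simp_all add: cop_1 cop_mult ints_power)

lemma cop_prod:
  assumes "\<And>i. i \<in> I \<Longrightarrow> cop (g i) c" "\<And>i. i \<in> I \<Longrightarrow> g i \<in> ints" "c \<in> ints"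
  shows "cop (\<Prod>i\<in>I. g i) c"
  using assms
  by (induction I rule: infinite_finite_induct) (simp_all add: cop_1 cop_mult ints_prod)

lemma cop_divisor:
  assumes "cop a c" "a \<in> pideal b"
  shows "cop b c"
proof -
  obtain d where d: "d \<in> ints" "a = d * b" using assms(2) by (auto simp: pideal_iff)
  obtain u v where uv: "u \<in> ints" "v \<in> ints" "u * a + v * c = 1" using assms(1) by (auto simp: cop_def)
  then have "u * d * b + v * c = 1" using d by (simp add: mult.assoc)
  then show ?thesis
    using d uv unfolding cop_def by (metis ints_mult)
qed

lemma cop_cong:
  assumes "cop a c" "a - b \<in> pideal c" 
  shows "cop b c"
proof -
  obtain d where d: "d \<in> ints" "a - b = d * c" using assms(2) by (auto simp: pideal_iff)
  obtain u v where uv: "u \<in> ints" "v \<in> ints" "u * a + v * c = 1" using assms(1) by (auto simp: cop_def)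
  have "a = b + d * c" using d by (simp add: algebra_simps)
  then have "u * b + (u * d + v) * c = 1" using uv by (simp add: algebra_simps)
  then show ?thesis using d uv unfolding cop_def by (metis ints_add ints_mult)
qed

lemma cop_cancel:
  assumes "cop a c" "a * x \<in> pideal c" "x \<in> ints"
  shows "x \<in> pideal c"
proof -
  obtain u v where uv: "u \<in> ints" "v \<in> ints" "u * a + v * c = 1" using assms(1) by (auto simp: cop_def)
  have "x = (u * a + v * c) * x" using uv by simp
  also have "\<dots> = u * (a * x) + (v * x) * c" by (simp add: algebra_simps)
  finally show ?thesis
    using assms uv by (metis pideal_add pideal_mult pidealI ints_mult)
qed

lemma pideal_coprime_mult:
  assumes "x \<in> pideal a" "x \<in> pideal b" "cop a b"
  shows "x \<in> pideal (a * b)"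
proof -
  obtain u v where uv: "u \<in> ints" "v \<in> ints" "u * a + v * b = 1" using assms(3) by (auto simp: cop_def)
  obtain r where r: "r \<in> ints" "x = r * a" using assms(1) by (auto simp: pideal_iff)
  obtain s where s: "s \<in> ints" "x = s * b" using assms(2) by (auto simp: pideal_iff)
  have "x = u * a * x + v * b * x"
    using uv(3) by (metis distrib_right mult_1)
  also have "\<dots> = u * a * (s * b) + v * b * (r * a)"
    using r(2) s(2) by metis
  also have "\<dots> = (u * s + v * r) * (a * b)" by (simp add: algebra_simps)
  finally show ?thesis using uv r s by (intro pidealI[of "u * s + v * r"]) (auto simp: ints_closed)
qed

lemma chinese_remainder:
  assumes "cop a b" "x \<in> ints" "y \<in> ints" "a \<in> ints" "b \<in> ints"
  obtains z where "z \<in> ints" "z - x \<in> pideal a" "z - y \<in> pideal b"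
proof -
  obtain u v where uv: "u \<in> ints" "v \<in> ints" "u * a + v * b = 1" using assms(1) by (auto simp: cop_def)
  show ?thesis
  proof
    show "v * b * x + u * a * y \<in> ints" using assms uv by (simp add: ints_closed)
    have "v * b * x + u * a * y - x = u * (y - x) * a + (u * a + v * b - 1) * x"
      by (simp add: algebra_simps)
    then show "v * b * x + u * a * y - x \<in> pideal a"
      using uv assms by (intro pidealI[of "u * (y - x)"]) (auto simp: ints_closed)
    have "v * b * x + u * a * y - y = v * (x - y) * b + (u * a + v * b - 1) * y"
      by (simp add: algebra_simps)
    then show "v * b * x + u * a * y - y \<in> pideal b"
      using uv assms by (intro pidealI[of "v * (x - y)"]) (auto simp: ints_closed)
  qed
qed

lemma solve_congruence:
  assumes "cop a b" "x \<in> ints"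
  obtains z where "z \<in> ints" "z * a - x \<in> pideal b"
proof -
  obtain u v where uv: "u \<in> ints" "v \<in> ints" "u * a + v * b = 1" using assms(1) by (auto simp: cop_def)
  show ?thesis
  proof
    show "x * u \<in> ints" using assms uv by (simp add: ints_mult)
    have "x * u * a - x = (- x * v) * b + x * (u * a + v * b - 1)" by (simp add: algebra_simps)
    then show "x * u * a - x \<in> pideal b"
      using uv assms by (intro pidealI[of "- x * v"]) (auto simp: ints_closed)
  qed
qed

subsection \<open>The additive character\<close>

lemma null_sequences_add:
  fixes P :: "'f place"
  assumes "P \<in> places" "s \<in> null_sequences P" "s' \<in> null_sequences P"
  shows "(\<lambda>n. s n + s' n) \<in> null_sequences P"
proof -
  note av = place_absolute_value[OF assms(1)]
  have lim: "(\<lambda>n. place_abs P (s n) + place_abs P (s' n)) \<longlonglongrightarrow> 0"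
    using assms(2,3) tendsto_add[of "\<lambda>n. place_abs P (s n)" 0 _ "\<lambda>n. place_abs P (s' n)" 0]
    unfolding null_sequences_def by simp
  have "(\<lambda>n. place_abs P (s n + s' n)) \<longlonglongrightarrow> 0"
  proof (rule tendsto_sandwich[OF _ _ tendsto_const])
    show "\<forall>\<^sub>F n in sequentially. 0 \<le> place_abs P (s n + s' n)"
      using av_nonneg[OF av] by (intro always_eventually allI)
    show "\<forall>\<^sub>F n in sequentially. place_abs P (s n + s' n) \<le> place_abs P (s n) + place_abs P (s' n)"
      using av_triangle[OF av] by (intro always_eventually allI)
  qed (rule lim)
  then show ?thesis by (simp add: null_sequences_def)
qed

text \<open>Addition in the quotient is the sum set of two cosets, so the equality comes down to
  null sequences being closed under addition and containing 0.\<close>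

lemma completion_embed_add:
  fixes x y :: 'f
  assumes "P \<in> places"
  shows "completion_embed P (x + y) = completion_embed P x \<oplus>\<^bsub>completion P\<^esub> completion_embed P y"
proof -
  have 0: "(\<lambda>_. 0) \<in> null_sequences P"
    using av_0[OF place_absolute_value[OF assms]] by (simp add: null_sequences_def)
  have coset: "completion_embed P z = {\<lambda>n. h n + z | h. h \<in> null_sequences P}" for z :: 'f
    by (auto simp: completion_embed_def a_r_coset_def' cauchy_ring_def)
  have add: "X \<oplus>\<^bsub>completion P\<^esub> Y = {\<lambda>n. s n + s' n | s s'. s \<in> X \<and> s' \<in> Y}" for X Y
    by (auto simp: completion_def FactRing_def set_add_def' cauchy_ring_def)
  show ?thesis
  proof (intro equalityI subsetI)
    fix s assume "s \<in> completion_embed P (x + y)"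
    then obtain h where h: "h \<in> null_sequences P" "s = (\<lambda>n. h n + (x + y))"
      unfolding coset by blast
    have "s = (\<lambda>n. (h n + x) + (0 + y))" using h(2) by (simp add: algebra_simps)
    moreover have "(\<lambda>n. h n + x) \<in> completion_embed P x" "(\<lambda>n. 0 + y) \<in> completion_embed P y"
      unfolding coset using h(1) 0 by (blast, intro CollectI exI[of _ "\<lambda>_. 0"]) simp
    ultimately show "s \<in> completion_embed P x \<oplus>\<^bsub>completion P\<^esub> completion_embed P y"
      unfolding add by (intro CollectI exI[of _ "\<lambda>n. h n + x"] exI[of _ "\<lambda>n. 0 + y"]) simp
  next
    fix s assume "s \<in> completion_embed P x \<oplus>\<^bsub>completion P\<^esub> completion_embed P y"
    then obtain h h' where h: "h \<in> null_sequences P" "h' \<in> null_sequences P"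
      "s = (\<lambda>n. (h n + x) + (h' n + y))"
      unfolding add coset by blast
    then have "s = (\<lambda>n. (h n + h' n) + (x + y))" by (simp add: algebra_simps)
    then show "s \<in> completion_embed P (x + y)"
      unfolding coset using null_sequences_add[OF assms h(1,2)]
      by (intro CollectI exI[of _ "\<lambda>n. h n + h' n"]) simp
  qed
qed

lemma bad_places: "bad_places A \<subseteq> places"
  using setting by (simp add: arithmetic_setting_def)

lemma diagonal_carrier: "diagonal (bad_places A) x \<in> carrier (S_completion (bad_places A))"
proof -
  have "completion_embed P x \<in> carrier (completion P)" if "P \<in> bad_places A" for P
  proof -
    have "(\<lambda>_. x) \<in> carrier (cauchy_ring P)"
      using av_0[OF place_absolute_value[of P]] bad_places that by (auto simp: cauchy_ring_def)
    then show ?thesis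
      by (auto simp: completion_embed_def completion_def FactRing_def A_RCOSETS_def')
  qed
  then show ?thesis by (simp add: diagonal_def S_completion_def)
qed

lemma diagonal_add:
  "diagonal (bad_places A) (x + y) =
     diagonal (bad_places A) x \<oplus>\<^bsub>S_completion (bad_places A)\<^esub> diagonal (bad_places A) y"
  using completion_embed_add bad_places
  by (auto simp: diagonal_def S_completion_def fun_eq_iff restrict_def)

lemma psi_add: "psi A (x + y) = psi A x * psi A y"
proof -
  have "additive_character (bad_places A) (add_char A)"
    using setting by (simp add: arithmetic_setting_def)
  then show ?thesis
    unfolding psi_def diagonal_add additive_character_def using diagonal_carrier by blast
qed

lemma psi_ints: "x \<in> ints \<Longrightarrow> psi A x = 1"
  using setting by (simp add: arithmetic_setting_def psi_def)

lemma psi_cong: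
  assumes "x - y \<in> ints"
  shows "psi A x = psi A y"
  using psi_add[of "x - y" y] psi_ints[OF assms] by simp

subsection \<open>The power residue symbol\<close>

lemma finite_double_roots: "finite (roots_of_unity (2 * deg) :: 'f set)"
  and card_double_roots: "card (roots_of_unity (2 * deg) :: 'f set) = 2 * deg"
proof -
  show "card (roots_of_unity (2 * deg) :: 'f set) = 2 * deg"
    using setting by (simp add: arithmetic_setting_def)
  then show "finite (roots_of_unity (2 * deg) :: 'f set)"
    using deg_pos by (intro card_ge_0_finite) simp
qed

lemma finite_mu: "finite mu"
  by (rule finite_subset[OF _ finite_double_roots]) (auto simp: roots_of_unity_def power_mult mult.commute)

text \<open>Squaring maps the roots of order \<open>2 n\<close> to those of order \<open>n\<close> with fibres of size at most 2.\<close>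

lemma deg_le_card_squares:
  "deg \<le> card ((\<lambda>x. x\<^sup>2) ` (roots_of_unity (2 * deg) :: 'f set))"
proof -
  let ?r = "roots_of_unity (2 * deg) :: 'f set"
  let ?sq = "(\<lambda>x. x\<^sup>2) ` ?r"
  have fibre: "card {x. x\<^sup>2 = y} \<le> 2 \<and> finite {x. x\<^sup>2 = y}" if y: "y \<in> ?sq" for y :: 'f
  proof -
    obtain a where "y = a\<^sup>2" using y by blast
    then have sub: "{x. x\<^sup>2 = y} \<subseteq> {a, - a}" by (auto simp: power2_eq_iff)
    have "card {a, - a} \<le> 2" by (simp add: card_insert_if)
    then show ?thesis using card_mono[OF _ sub] finite_subset[OF sub] by simp
  qed
  have fin: "finite ?sq" using finite_double_roots by simp
  have "2 * deg = card ?r" by (simp add: card_double_roots)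
  also have "\<dots> \<le> card (\<Union>y\<in>?sq. {x. x\<^sup>2 = y})"
    using fin fibre by (intro card_mono finite_UN_I) auto
  also have "\<dots> \<le> (\<Sum>y\<in>?sq. card {x. x\<^sup>2 = y})"
    by (rule card_UN_le[OF fin])
  also have "\<dots> \<le> (\<Sum>y\<in>?sq. 2)"
    using fibre by (intro sum_mono) blast
  finally show ?thesis by simp
qed

lemma squares_subset_mu: "(\<lambda>x. x\<^sup>2) ` (roots_of_unity (2 * deg) :: 'f set) \<subseteq> mu"
  by (auto simp: roots_of_unity_def power_mult)

lemma deg_le_card_mu: "deg \<le> card mu"
  using deg_le_card_squares card_mono[OF finite_mu squares_subset_mu] by linarith

lemma card_mu_le: "card mu \<le> deg"
proof -
  let ?p = "Polynomial.monom 1 deg - 1 :: 'f poly"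
  have "Polynomial.coeff ?p deg = 1" using deg_pos by simp
  then have "?p \<noteq> 0" by (metis coeff_0 zero_neq_one)
  moreover have "degree ?p \<le> deg" by (intro degree_diff_le) (auto simp: degree_monom_le)
  moreover have "mu = {x. poly ?p x = 0}" by (auto simp: roots_of_unity_def poly_monom)
  ultimately show ?thesis using card_poly_roots_bound[of ?p] by simp
qed

text \<open>The squares of the 2n-th roots of unity number at least n and lie in a set of at most n
  elements, so they fill it. When -1 is an n-th root of unity this provides its square root.\<close>

lemma mu_square:
  assumes "x \<in> mu"
  shows "\<exists>y. y\<^sup>2 = x"
proof -
  have "(\<lambda>x. x\<^sup>2) ` (roots_of_unity (2 * deg) :: 'f set) = mu"
    using deg_le_card_squares card_mu_le by (intro card_seteq[OF finite_mu squares_subset_mu]) simp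
  then show ?thesis using assms by force
qed

lemma mu_near_one:
  assumes P: "P \<in> places - bad_places A" and x: "x \<in> mu" "place_abs P (x - 1) < 1"
  shows "x = 1"
proof -
  have "\<not> archimedean_place P" "\<not> ramified_place P"
    using setting P unfolding arithmetic_setting_def by blast+
  then have "place_abs P (x + y) \<le> max (place_abs P x) (place_abs P y)"
    and "x \<noteq> 0 \<Longrightarrow> \<exists>q. place_abs P x = place_abs P (of_rat q)" for x y
    using P unfolding archimedean_place_def ramified_place_def by auto
  moreover have "\<exists>i::'f. i\<^sup>2 = - 1" if "(- 1 :: 'f) ^ deg = 1"
    using mu_square that by (simp add: roots_of_unity_def)
  ultimately show ?thesis
    using root_of_unity_near_one[OF place_absolute_value, of P x deg] P x deg_pos
    unfolding roots_of_unity_def by blast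
qed

lemma mu_ints: "mu \<subseteq> ints"
proof
  fix x assume "x \<in> mu"
  then have "place_abs P x = 1" if "P \<in> places" for P
    using av_root_of_unity[OF place_absolute_value[OF that]] deg_pos by (simp add: roots_of_unity_def)
  then show "x \<in> ints" by (simp add: S_integers_def)
qed

lemma mu_mult: "x \<in> mu \<Longrightarrow> y \<in> mu \<Longrightarrow> x * y \<in> mu"
  by (simp add: roots_of_unity_def power_mult_distrib)

lemma mu_1: "1 \<in> mu"
  by (simp add: roots_of_unity_def)

text \<open>As \<open>p\<close> is not a unit, its inverse fails to be integral at some place
  outside S, and there |p| < 1. Congruent roots of unity have a quotient close to 1 at that place,
  hence equal to 1.\<close>

lemma mu_cong_unique:
  assumes p: "p \<in> ints" "p \<noteq> 0" "1 \<notin> pideal p" and z: "z \<in> mu" "w \<in> mu" "z - w \<in> pideal p"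
  shows "z = w"
proof -
  have "inverse p \<notin> ints" using p by (auto simp: pideal_iff)
  then obtain P where P: "P \<in> places - bad_places A" "place_abs P (inverse p) > 1"
    by (auto simp: S_integers_def not_le)
  have av: "absolute_value (place_abs P)" using P by (simp add: place_absolute_value)
  have "inverse (place_abs P p) > 1" using P(2) by (simp add: av_inverse[OF av])
  then have p1: "place_abs P p < 1" using one_less_inverse_iff by blast
  obtain a where a: "a \<in> ints" "z - w = a * p" using z(3) by (auto simp: pideal_iff)
  have a1: "place_abs P a \<le> 1" using a(1) P(1) by (simp add: S_integers_def)
  have w: "w ^ deg = 1" "w \<noteq> 0" using z(2) deg_pos by (auto simp: roots_of_unity_def power_0_left)
  have "place_abs P (z / w - 1) = place_abs P (z - w) / place_abs P w"
    using w(2) by (simp add: diff_divide_distrib flip: av_divide[OF av])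
  also have "\<dots> = place_abs P a * place_abs P p"
    using av_root_of_unity[OF av w(1) deg_pos] a(2) by (simp add: av_mult[OF av])
  also have "\<dots> < 1"
    using a1 p1 av_nonneg[OF av] by (meson le_less_trans mult_left_le_one_le)
  finally have "z / w = 1"
    using mu_near_one[OF P(1), of "z / w"] z w by (simp add: roots_of_unity_def power_divide)
  then show ?thesis using w(2) by simp
qed

section \<open>The symbol at a single prime\<close>

abbreviation prs :: "'f \<Rightarrow> 'f \<Rightarrow> 'f" where
  "prs \<equiv> prime_residue_symbol (bad_places A) deg"

definition prime_elt :: "'f \<Rightarrow> bool" where
  "prime_elt p \<longleftrightarrow> p \<in> ints \<and> p \<noteq> 0 \<and> irreducible (Ring_Divisibility.mult_of (oS A)) p"

definition norm_exp :: "'f \<Rightarrow> nat" where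
  "norm_exp p = (card (carrier (oS A Quot pideal p)) - 1) div deg"

lemma oS_mult_fun: "(\<otimes>\<^bsub>oS A\<^esub>) = (*)"
  by (simp add: S_integers_def)

lemma prime_elt_ring_prime:
  assumes "prime_elt p"
  shows "ring_prime\<^bsub>oS A\<^esub> p"
proof -
  have p: "p \<in> ints - {\<zero>\<^bsub>oS A\<^esub>}" "irreducible (Ring_Divisibility.mult_of (oS A)) p"
    using assms by (auto simp: prime_elt_def)
  then have "prime (Ring_Divisibility.mult_of (oS A)) p"
    using D.mult_of.irreducible_prime by simp
  then show ?thesis
    using p D.prime_eq_prime_mult[of p] unfolding ring_prime_def by auto
qed

lemma prime_elt_proper:
  assumes "prime_elt p"
  shows "1 \<notin> pideal p"
proof
  assume "1 \<in> pideal p"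
  then obtain a where "a \<in> ints" "1 = a * p" by (auto simp: pideal_iff)
  then have "p \<in> Units (oS A)"
    using assms by (auto simp: Units_def prime_elt_def mult.commute)
  then have "p \<in> Units (Ring_Divisibility.mult_of (oS A))" by simp
  then show False using assms by (auto simp: prime_elt_def irreducible_def)
qed

text \<open>For an infinite residue ring the exponent degenerates to 0 and the symbol is 1; otherwise the
  residue field contains exactly \<open>n\<close> roots of unity of order \<open>n\<close>, all of them coming from the field.\<close>

lemma residue_root_exists:
  assumes p: "prime_elt p" and c: "c \<in> ints" "c \<notin> pideal p"
  shows "\<exists>z\<in>mu. c ^ norm_exp p - z \<in> pideal p"
proof (cases "finite (carrier (oS A Quot pideal p))")
  case False
  then have "norm_exp p = 0" by (simp add: norm_exp_def)
  then show ?thesis using mu_1 pideal_0 by (intro bexI[of _ 1]) auto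
next
  case True
  define K where "K = oS A Quot pideal p"
  define h where "h = (\<lambda>x. pideal p +>\<^bsub>oS A\<^esub> x)"
  have pin: "p \<in> ints" "p \<noteq> 0" using p by (auto simp: prime_elt_def)
  interpret K: field K
    unfolding K_def using D.field_iff_prime[of p] prime_elt_ring_prime[OF p] pin by simp
  have ideal: "ideal (pideal p) (oS A)" using D.cgenideal_ideal pin by simp
  have hom: "h \<in> ring_hom (oS A) K"
    unfolding h_def K_def by (rule ideal.rcos_ring_hom[OF ideal])
  have h_closed: "h x \<in> carrier K" if "x \<in> ints" for x
    using ring_hom_memE(1)[OF hom that] .
  have h_mult: "h (x * y) = h x \<otimes>\<^bsub>K\<^esub> h y" if "x \<in> ints" "y \<in> ints" for x y
    using ring_hom_memE(2)[OF hom that] by simp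
  have h_1: "h 1 = \<one>\<^bsub>K\<^esub>" using ring_hom_memE(4)[OF hom] by simp
  have h_pow: "h (x ^ m) = h x [^]\<^bsub>K\<^esub> m" if "x \<in> ints" for x and m :: nat
  proof (induction m)
    case (Suc m)
    then show ?case using h_mult[OF ints_power[OF that] that, of m] by (simp add: mult.commute)
  qed (simp add: h_1)
  have h_eq: "h x = h y \<longleftrightarrow> x - y \<in> pideal p" for x y
    unfolding h_def by (rule pideal_coset_eq)
  have "\<zero>\<^bsub>K\<^esub> = h 0"
    using ring_hom_zero[OF hom D.ring_axioms K.ring_axioms] by simp
  then have h_zero: "h x = \<zero>\<^bsub>K\<^esub> \<longleftrightarrow> x \<in> pideal p" for x using h_eq[of x 0] by simp
  have fin: "finite (carrier K)" using True by (simp add: K_def)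
  \<comment> \<open>A field has at most n such elements, and reduction embeds the n roots of unity
    of the number field among them. So every one lifts.\<close>
  let ?T = "{x \<in> carrier K. x [^]\<^bsub>K\<^esub> deg = \<one>\<^bsub>K\<^esub>}"
  have T_le: "card ?T \<le> deg" using K.num_roots_le_deg[OF fin] deg_pos by simp
  have sub: "h ` mu \<subseteq> ?T"
  proof
    fix y assume "y \<in> h ` mu"
    then obtain x where x: "x \<in> mu" "y = h x" by blast
    then have "x \<in> ints" "x ^ deg = 1" using mu_ints by (auto simp: roots_of_unity_def)
    then show "y \<in> ?T" using x(2) h_closed h_pow[of x deg] h_1 by simp
  qed
  have "inj_on h mu"
    using mu_cong_unique[OF pin prime_elt_proper[OF p]] h_eq by (auto intro!: inj_onI)
  then have "card (h ` mu) = card mu" by (rule card_image)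
  then have "card ?T \<le> card (h ` mu)" using T_le deg_le_card_mu by simp
  then have T: "h ` mu = ?T" using fin by (intro card_seteq[OF _ sub]) auto
  have cardT: "card ?T = deg"
    using T \<open>card (h ` mu) = card mu\<close> deg_le_card_mu T_le by simp
  define G where "G = Multiplicative_Group.mult_of K"
  interpret G: group G unfolding G_def by (rule K.field_mult_group)
  have G_simps [simp]: "carrier G = carrier K - {\<zero>\<^bsub>K\<^esub>}" "x \<otimes>\<^bsub>G\<^esub> y = x \<otimes>\<^bsub>K\<^esub> y" "\<one>\<^bsub>G\<^esub> = \<one>\<^bsub>K\<^esub>"
      "x [^]\<^bsub>G\<^esub> (m::nat) = x [^]\<^bsub>K\<^esub> m" for x y m
    by (simp_all add: G_def Multiplicative_Group.nat_pow_mult_of)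
  have T0: "\<zero>\<^bsub>K\<^esub> \<notin> ?T" using deg_pos K.nat_pow_zero by auto
  interpret Gc: comm_group G
    by (rule G.group_comm_groupI) (auto simp: K.m_comm)
  have subgroup: "subgroup ?T G"
  proof (rule G.subgroupI)
    show "?T \<subseteq> carrier G" using T0 by auto
    show "?T \<noteq> {}" using K.one_closed by (auto intro!: exI[of _ "\<one>\<^bsub>K\<^esub>"])
    show "inv\<^bsub>G\<^esub> a \<in> ?T" if "a \<in> ?T" for a
    proof -
      have a: "a \<in> carrier G" using that T0 by auto
      have "(inv\<^bsub>G\<^esub> a) [^]\<^bsub>G\<^esub> deg = inv\<^bsub>G\<^esub> (a [^]\<^bsub>G\<^esub> deg)"
        using G.nat_pow_inv[OF a] by simp
      also have "\<dots> = \<one>\<^bsub>G\<^esub>" using that G.inv_one by simp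
      finally show ?thesis using G.inv_closed[OF a] by simp
    qed
    show "a \<otimes>\<^bsub>G\<^esub> b \<in> ?T" if "a \<in> ?T" "b \<in> ?T" for a b
      using that K.nat_pow_distrib[of a b deg] by simp
  qed
  \<comment> \<open>By Lagrange the division by n in \<open>norm_exp\<close> is exact, so the power
    of \<open>c\<close> is an n-th root of unity in the residue field and lifts.\<close>
  have "deg dvd order G"
    unfolding G.lagrange[OF subgroup, symmetric] cardT by simp
  moreover have ord: "order G = card (carrier K) - 1"
    using fin K.zero_closed by (simp add: order_def)
  ultimately have m: "norm_exp p * deg = order G" by (simp add: norm_exp_def K_def)
  have hc: "h c \<in> carrier G" using c h_closed h_zero by simp
  have "(h c [^]\<^bsub>K\<^esub> norm_exp p) [^]\<^bsub>K\<^esub> deg = h c [^]\<^bsub>K\<^esub> (norm_exp p * deg)"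
    using hc by (simp add: K.nat_pow_pow)
  also have "\<dots> = \<one>\<^bsub>K\<^esub>" unfolding m using G.pow_order_eq_1[OF hc] by simp
  finally have "h (c ^ norm_exp p) \<in> ?T"
    using c h_pow h_closed by simp
  then obtain z where "z \<in> mu" "h (c ^ norm_exp p) = h z" unfolding T[symmetric] by blast
  then show ?thesis using h_eq by blast
qed

lemma prs_unfold: "prs c p = (THE z. z \<in> mu \<and> c ^ norm_exp p - z \<in> pideal p)"
  by (simp add: prime_residue_symbol_def norm_exp_def Let_def)

lemma residue_root_unique:
  assumes "prime_elt p" "z \<in> mu" "w \<in> mu" "x - z \<in> pideal p" "x - w \<in> pideal p"
  shows "z = w"
proof -
  have "z - w = (x - w) - (x - z)" by simp
  then have "z - w \<in> pideal p" using assms(4,5) pideal_diff by metis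
  then show ?thesis
    using mu_cong_unique[of p] assms(1-3) prime_elt_proper by (auto simp: prime_elt_def)
qed

lemma prs_eqI:
  assumes "prime_elt p" "z \<in> mu" "c ^ norm_exp p - z \<in> pideal p"
  shows "prs c p = z"
  unfolding prs_unfold using assms residue_root_unique by (intro the_equality) blast+

lemma prs_spec:
  assumes "prime_elt p" "c \<in> ints" "c \<notin> pideal p"
  shows "prs c p \<in> mu" "c ^ norm_exp p - prs c p \<in> pideal p"
  using residue_root_exists[OF assms] prs_eqI[OF assms(1)] by auto

lemma prs_mult:
  assumes "prime_elt p" "c \<in> ints" "c \<notin> pideal p" "c' \<in> ints" "c' \<notin> pideal p"
  shows "prs (c * c') p = prs c p * prs c' p"
proof (rule prs_eqI[OF assms(1)])
  note s = prs_spec[OF assms(1-3)] and s' = prs_spec[OF assms(1,4,5)]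
  show "prs c p * prs c' p \<in> mu" using s s' mu_mult by blast
  show "(c * c') ^ norm_exp p - prs c p * prs c' p \<in> pideal p"
    unfolding power_mult_distrib using s s' mu_ints assms(4)
    by (intro pideal_cong_mult) (auto simp: ints_power)
qed

text \<open>Congruent arguments admit the same candidates for the root of unity, so the two
  descriptions coincide whether or not a candidate exists.\<close>

lemma prs_cong:
  assumes "c \<in> ints" "c' \<in> ints" "c - c' \<in> pideal p"
  shows "prs c p = prs c' p"
proof -
  have d: "c ^ norm_exp p - c' ^ norm_exp p \<in> pideal p"
    by (rule pideal_cong_power) (use assms in auto)
  have "c ^ norm_exp p - z \<in> pideal p \<longleftrightarrow> c' ^ norm_exp p - z \<in> pideal p" for z
    using pideal_diff[OF _ d, of "c ^ norm_exp p - z"] pideal_add[OF _ d, of "c' ^ norm_exp p - z"] by auto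
  then show ?thesis by (simp add: prs_unfold)
qed

section \<open>The symbol for composite moduli\<close>

abbreviation Mx :: "'f monoid" where "Mx \<equiv> Ring_Divisibility.mult_of (oS A)"

text \<open>The predicate under the choice operator in \<open>residue_symbol\<close>.\<close>

definition factorization :: "'f list \<Rightarrow> 'f \<Rightarrow> bool" where
  "factorization fs d \<longleftrightarrow> set fs \<subseteq> carrier Mx \<and> wfactors Mx fs d"

lemma factorization_exists:
  assumes "d \<in> ints" "d \<noteq> 0"
  shows "\<exists>fs. factorization fs d"
  using D.mult_of.wfactors_exist[of d] assms unfolding factorization_def by simp

lemma prs_associated:
  assumes "p \<in> carrier Mx" "q \<in> carrier Mx" "p \<sim>\<^bsub>Mx\<^esub> q"
  shows "prs c p = prs c q"
proof -
  have "p \<sim>\<^bsub>oS A\<^esub> q" using assms(3) by (simp add: associated_def)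
  then have "pideal p = pideal q"
    using D.associated_iff_same_ideal assms(1,2) by simp
  then show ?thesis by (simp add: prime_residue_symbol_def)
qed

text \<open>Frees the symbol from the chosen factorization: two factorizations agree up to order and
  associates, and the prime symbol sees only the ideal.\<close>

lemma residue_symbol_factorization:
  assumes "factorization fs d" "d \<in> ints" "d \<noteq> 0"
  shows "residue_symbol (bad_places A) deg c d = prod_list (map (prs c) fs)"
proof -
  define gs where "gs = (SOME fs. factorization fs d)"
  have gs: "factorization gs d" unfolding gs_def using assms(1) by (rule someI)
  have "essentially_equal Mx gs fs"
    using D.mult_of.wfactors_unique[of gs d fs] gs assms unfolding factorization_def by simp
  then obtain hs where hs: "mset gs = mset hs" "list_all2 (associated Mx) hs fs"
    by (auto simp: essentially_equal_def)
  have "prod_list (map (prs c) gs) = prod_list (map (prs c) hs)"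
    using hs(1) by (metis mset_map prod_mset_prod_list)
  also have "map (prs c) hs = map (prs c) fs"
  proof (rule nth_equalityI)
    show "length (map (prs c) hs) = length (map (prs c) fs)"
      using list_all2_lengthD[OF hs(2)] by simp
    fix i assume "i < length (map (prs c) hs)"
    then have i: "i < length hs" "i < length fs" using list_all2_lengthD[OF hs(2)] by auto
    have "hs ! i \<in> carrier Mx" "fs ! i \<in> carrier Mx"
      using nth_mem[OF i(1)] nth_mem[OF i(2)] gs assms(1) mset_eq_setD[OF hs(1)]
      unfolding factorization_def by blast+
    from prs_associated[OF this list_all2_nthD[OF hs(2) i(1)], of c]
    show "map (prs c) hs ! i = map (prs c) fs ! i"
      using i by simp
  qed
  finally show ?thesis
    by (simp add: residue_symbol_def gs_def factorization_def)
qed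

lemma factorization_mult:
  assumes "factorization fs d" "factorization gs e" "d \<in> ints" "d \<noteq> 0" "e \<in> ints" "e \<noteq> 0"
  shows "factorization (fs @ gs) (d * e)"
  using D.mult_of.wfactors_mult[of fs d gs e] assms unfolding factorization_def by simp

lemma factorization_member:
  assumes "factorization fs d" "p \<in> set fs"
  shows "prime_elt p" "d \<in> pideal p"
proof -
  show "prime_elt p" using assms by (auto simp: factorization_def wfactors_def prime_elt_def)
  have "foldr (*) fs 1 \<sim>\<^bsub>Mx\<^esub> d"
    using assms(1) oS_mult_fun by (simp add: factorization_def wfactors_def)
  then obtain u where u: "u \<in> ints" "d = foldr (*) fs 1 * u"
    by (auto simp: associated_def factor_def)
  have ints: "set fs \<subseteq> ints" using assms(1) by (auto simp: factorization_def)
  then have "foldr (*) gs 1 \<in> ints" if "set gs \<subseteq> set fs" for gs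
    using that by (induction gs) (auto simp: ints_1 ints_mult)
  moreover obtain gs hs where fs: "fs = gs @ p # hs" using assms(2) split_list by metis
  ultimately have i: "foldr (*) gs 1 \<in> ints" "foldr (*) hs 1 \<in> ints" by auto
  have "foldr (*) (gs @ xs) (1::'f) = foldr (*) gs 1 * foldr (*) xs 1" for xs
    by (induction gs) (auto simp: mult.assoc)
  from this[of "p # hs"] have "foldr (*) fs 1 = foldr (*) gs 1 * (p * foldr (*) hs 1)"
    by (simp add: fs)
  then have "d = (foldr (*) gs 1 * foldr (*) hs 1 * u) * p"
    using u(2) by (simp only: mult_ac)
  from pidealI[OF _ this] show "d \<in> pideal p" using i u(1) by (simp add: ints_mult)
qed

lemma factorization_coprime:
  assumes "factorization fs d" "p \<in> set fs" "cop c d"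
  shows "c \<notin> pideal p"
proof
  assume c: "c \<in> pideal p"
  obtain u v where "u \<in> ints" "v \<in> ints" "u * c + v * d = 1" using assms(3) by (auto simp: cop_def)
  then have "1 \<in> pideal p"
    using c factorization_member(2)[OF assms(1,2)] by (metis pideal_add pideal_mult)
  then show False using prime_elt_proper[OF factorization_member(1)[OF assms(1,2)]] by blast
qed

text \<open>\<open>mu_embed\<close> is assumed multiplicative only on the n-th roots of unity, so
  values must be placed there before products are embedded.\<close>

lemma residue_symbol_mu:
  assumes "c \<in> ints" "d \<in> ints" "d \<noteq> 0" "cop c d"
  shows "residue_symbol (bad_places A) deg c d \<in> mu"
proof -
  obtain fs where fs: "factorization fs d" using factorization_exists assms by blast
  have "prod_list (map (prs c) gs) \<in> mu" if "set gs \<subseteq> set fs" for gs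
    using that
  proof (induction gs)
    case (Cons p gs)
    then have p: "p \<in> set fs" by simp
    then show ?case
      using Cons prs_spec(1)[OF factorization_member(1)[OF fs p] assms(1) factorization_coprime[OF fs p assms(4)]]
      by (simp add: mu_mult)
  qed (simp add: mu_1)
  then show ?thesis using residue_symbol_factorization[OF fs assms(2,3)] by simp
qed

lemma mu_embed_mult: "x \<in> mu \<Longrightarrow> y \<in> mu \<Longrightarrow> mu_embed A (x * y) = mu_embed A x * mu_embed A y"
  using setting by (simp add: arithmetic_setting_def)

lemma symb_mult_right:
  assumes "c \<in> ints" "d \<in> ints" "d \<noteq> 0" "e \<in> ints" "e \<noteq> 0" "cop c d" "cop c e"
  shows "symb A c (d * e) = symb A c d * symb A c e"
proof -
  obtain fs where fs: "factorization fs d" using factorization_exists assms by blast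
  obtain gs where gs: "factorization gs e" using factorization_exists assms by blast
  have "residue_symbol (bad_places A) deg c (d * e) =
      residue_symbol (bad_places A) deg c d * residue_symbol (bad_places A) deg c e"
    using residue_symbol_factorization[OF factorization_mult[OF fs gs assms(2-5)]]
      residue_symbol_factorization[OF fs assms(2,3)] residue_symbol_factorization[OF gs assms(4,5)]
      assms by (simp add: ints_mult)
  then show ?thesis
    using residue_symbol_mu assms by (simp add: symb_def mu_embed_mult)
qed

lemma symb_mult_left:
  assumes "c \<in> ints" "c' \<in> ints" "d \<in> ints" "d \<noteq> 0" "cop c d" "cop c' d"
  shows "symb A (c * c') d = symb A c d * symb A c' d"
proof -
  obtain fs where fs: "factorization fs d" using factorization_exists assms by blast
  have "prod_list (map (prs (c * c')) gs) = prod_list (map (prs c) gs) * prod_list (map (prs c') gs)"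
    if "set gs \<subseteq> set fs" for gs
    using that
  proof (induction gs)
    case (Cons p gs)
    then have p: "p \<in> set fs" by simp
    then show ?case
      using Cons prs_mult[OF factorization_member(1)[OF fs p] assms(1) _ assms(2)]
        factorization_coprime[OF fs p] assms(5,6) by simp
  qed simp
  then have "residue_symbol (bad_places A) deg (c * c') d =
      residue_symbol (bad_places A) deg c d * residue_symbol (bad_places A) deg c' d"
    using residue_symbol_factorization[OF fs assms(3,4)] by simp
  then show ?thesis
    using residue_symbol_mu assms by (simp add: symb_def mu_embed_mult)
qed

lemma symb_cong:
  assumes "c \<in> ints" "c' \<in> ints" "d \<in> ints" "d \<noteq> 0" "c - c' \<in> pideal d"
  shows "symb A c d = symb A c' d"
proof -
  obtain fs where fs: "factorization fs d" using factorization_exists assms by blast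
  have "map (prs c) fs = map (prs c') fs"
    using prs_cong[OF assms(1,2)] pideal_mono[OF assms(5) factorization_member(2)[OF fs]]
    by (intro map_cong) auto
  then show ?thesis
    using residue_symbol_factorization[OF fs assms(3,4)] unfolding symb_def by metis
qed

lemma prod_pideal:
  assumes "finite I" "k \<in> I" "\<And>i. i \<in> I \<Longrightarrow> g i \<in> ints"
  shows "(\<Prod>i\<in>I. g i) \<in> pideal (g k)"
proof (rule pidealI)
  show "(\<Prod>i\<in>I - {k}. g i) \<in> ints" using assms(3) by (intro ints_prod) auto
  show "(\<Prod>i\<in>I. g i) = (\<Prod>i\<in>I - {k}. g i) * g k"
    using prod.remove[OF assms(1,2)] by (simp add: mult.commute)
qed

subsection \<open>Residue systems\<close>

definition residue_system :: "'f \<Rightarrow> 'f \<Rightarrow> 'f set \<Rightarrow> bool" where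
  "residue_system D d C \<longleftrightarrow> C \<subseteq> {c \<in> ints. cop c d} \<and>
     (\<forall>x\<in>ints. cop x d \<longrightarrow> (\<exists>!c. c \<in> C \<and> x - c \<in> pideal D))"

lemma pideal_diff_commute: "x - y \<in> pideal D \<Longrightarrow> y - x \<in> pideal D"
  using pideal_minus[of "x - y" D] by simp

lemma pideal_diff_trans: "x - y \<in> pideal D \<Longrightarrow> y - z \<in> pideal D \<Longrightarrow> x - z \<in> pideal D"
  using pideal_add[of "x - y" D "y - z"] by simp

text \<open>Congruent elements have the same set of candidates, so a choice made from that set is
  constant on each class.\<close>

lemma residue_system_exists: "\<exists>C. residue_system D d C"
proof -
  define r where "r z = (SOME w. w \<in> ints \<and> cop w d \<and> z - w \<in> pideal D)" for z
  have r: "r z \<in> ints \<and> cop (r z) d \<and> z - r z \<in> pideal D" if "z \<in> ints" "cop z d" for z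
    unfolding r_def by (rule someI[of _ z]) (use that pideal_0 in auto)
  have r_cong: "r z = r w" if "z - w \<in> pideal D" for z w
  proof -
    have "z - x \<in> pideal D \<longleftrightarrow> w - x \<in> pideal D" for x
      using pideal_diff_trans that pideal_diff_commute by blast
    then show ?thesis by (simp add: r_def)
  qed
  have "\<exists>!c. c \<in> r ` {c \<in> ints. cop c d} \<and> x - c \<in> pideal D" if x: "x \<in> ints" "cop x d" for x
  proof (rule ex1I[of _ "r x"])
    show "r x \<in> r ` {c \<in> ints. cop c d} \<and> x - r x \<in> pideal D" using r[OF x] x by blast
    fix c assume c: "c \<in> r ` {c \<in> ints. cop c d} \<and> x - c \<in> pideal D"
    then obtain z where z: "z \<in> ints" "cop z d" "c = r z" by blast
    have "z - c \<in> pideal D" using r[OF z(1,2)] z(3) by simp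
    moreover have "c - x \<in> pideal D" using c by (simp add: pideal_diff_commute)
    ultimately have "z - x \<in> pideal D" by (rule pideal_diff_trans)
    then show "c = r x" using r_cong z(3) by blast
  qed
  then show ?thesis
    using r unfolding residue_system_def by (intro exI[of _ "r ` {c \<in> ints. cop c d}"]) blast
qed

lemma residue_system_unique:
  assumes "residue_system D d C" "c \<in> C" "c' \<in> C" "c - c' \<in> pideal D"
  shows "c = c'"
proof -
  have "c \<in> ints" "cop c d" using assms by (auto simp: residue_system_def)
  then have "\<exists>!x. x \<in> C \<and> c - x \<in> pideal D" using assms(1) by (auto simp: residue_system_def)
  moreover have "c - c \<in> pideal D" using pideal_0 by simp
  ultimately show ?thesis using assms by blast
qed

text \<open>The combination F x + E y is used because division by E F turns it into x / E + y / F,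
  the form in which the entries occur in the coordinates.\<close>

lemma residue_system_crt:
  assumes C: "residue_system (E * F) (e * f) C" "residue_system E e Ce" "residue_system F f Cf"
    and int: "E \<in> ints" "F \<in> ints" "e \<in> ints" "f \<in> ints"
    and EF: "cop E F" "E \<in> pideal e" "F \<in> pideal f"
  shows "\<exists>\<phi>. bij_betw \<phi> (Ce \<times> Cf) C \<and>
           (\<forall>x\<in>Ce. \<forall>y\<in>Cf. \<phi> (x, y) - (F * x + E * y) \<in> pideal (E * F))"
proof -
  have Ef: "cop E f" using cop_commute[OF cop_divisor[OF cop_commute[OF EF(1)] EF(3)]] .
  have Fe: "cop F e" using cop_commute[OF cop_divisor[OF EF(1,2)]] .
  have EFi: "E * F \<in> pideal E" "E * F \<in> pideal F"
    using int by (auto intro: pidealI[of F] pidealI[of E] simp: mult.commute)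
  have cop_ef: "cop (F * x + E * y) (e * f)"
    if "x \<in> ints" "y \<in> ints" "cop x e" "cop y f" for x y
  proof -
    have i: "F * x + E * y \<in> ints" using that int by (simp add: ints_closed)
    have "cop (F * x) e" "cop (E * y) f" using that int Fe Ef by (simp_all add: cop_mult)
    moreover have "F * x - (F * x + E * y) \<in> pideal e" "E * y - (F * x + E * y) \<in> pideal f"
      using pideal_minus[OF pideal_mult[OF that(2) EF(2)]] pideal_minus[OF pideal_mult[OF that(1) EF(3)]]
      by (simp_all add: mult.commute)
    ultimately have "cop (F * x + E * y) e" "cop (F * x + E * y) f" using cop_cong by blast+
    then show ?thesis using cop_mult i int cop_commute by blast
  qed
  define \<phi> where "\<phi> = (\<lambda>(x, y). THE c. c \<in> C \<and> F * x + E * y - c \<in> pideal (E * F))"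
  have Ce: "x \<in> ints" "cop x e" if "x \<in> Ce" for x using C(2) that by (auto simp: residue_system_def)
  have Cf: "y \<in> ints" "cop y f" if "y \<in> Cf" for y using C(3) that by (auto simp: residue_system_def)
  have \<phi>: "\<phi> (x, y) \<in> C \<and> F * x + E * y - \<phi> (x, y) \<in> pideal (E * F)" if "x \<in> Ce" "y \<in> Cf" for x y
  proof -
    have "\<exists>!c. c \<in> C \<and> F * x + E * y - c \<in> pideal (E * F)"
      using C(1) cop_ef Ce[OF that(1)] Cf[OF that(2)] int
      unfolding residue_system_def by (simp add: ints_closed)
    from theI'[OF this] show ?thesis by (simp add: \<phi>_def)
  qed
  have "inj_on \<phi> (Ce \<times> Cf)"
  proof (rule inj_onI, clarify)
    fix x y x' y' assume x: "x \<in> Ce" "x' \<in> Ce" and y: "y \<in> Cf" "y' \<in> Cf" and eq: "\<phi> (x, y) = \<phi> (x', y')"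
    have "(F * x + E * y) - (F * x' + E * y') \<in> pideal (E * F)"
      using pideal_diff_trans[OF conjunct2[OF \<phi>[OF x(1) y(1)]]]
        pideal_diff_commute[OF conjunct2[OF \<phi>[OF x(2) y(2)]]] unfolding eq .
    then have d: "F * (x - x') + E * (y - y') \<in> pideal (E * F)" by (simp add: algebra_simps)
    have i: "x - x' \<in> ints" "y - y' \<in> ints" using x y Ce Cf by (simp_all add: ints_diff)
    \<comment> \<open>Modulo \<open>E\<close> the second summand drops out, and \<open>F\<close>,
      being prime to \<open>E\<close>, can be cancelled; likewise with the roles exchanged.\<close>
    have "E * (y - y') \<in> pideal E" "F * (x - x') \<in> pideal F"
      using i by (auto intro: pidealI simp: mult.commute)
    then have "F * (x - x') \<in> pideal E" "E * (y - y') \<in> pideal F"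
      using pideal_diff[OF pideal_mono[OF d EFi(1)]] pideal_diff[OF pideal_mono[OF d EFi(2)]]
      by fastforce+
    then have "x - x' \<in> pideal E" "y - y' \<in> pideal F"
      using cop_cancel i EF(1) cop_commute by blast+
    then show "x = x' \<and> y = y'"
      using residue_system_unique C(2,3) x y by blast
  qed
  moreover have "\<phi> ` (Ce \<times> Cf) = C"
  proof (intro equalityI subsetI)
    fix c assume c: "c \<in> C"
    then have ci: "c \<in> ints" "cop c (e * f)" using C(1) by (auto simp: residue_system_def)
    have ce: "cop c e" "cop c f"
      using cop_divisor[OF cop_commute[OF ci(2)]] int cop_commute by (metis pidealI mult.commute)+
    \<comment> \<open>Since c = F (v c) + E (u c), the preimage of \<open>c\<close> is the pair of
      representatives of v c and u c. Here v is coprime to e because v F is 1 modulo e, and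
      similarly u to f.\<close>
    obtain u v where uv: "u \<in> ints" "v \<in> ints" "u * E + v * F = 1" using EF(1) by (auto simp: cop_def)
    have "cop 1 e" "cop 1 f" by (rule cop_1)+
    moreover have "1 - v * F \<in> pideal e" "1 - u * E \<in> pideal f"
    proof -
      have "1 - v * F = u * E" "1 - u * E = v * F" using uv(3) by (simp_all add: algebra_simps)
      then show "1 - v * F \<in> pideal e" "1 - u * E \<in> pideal f"
        using pideal_mult uv EF by simp_all
    qed
    ultimately have "cop (v * F) e" "cop (u * E) f" using cop_cong by blast+
    then have "cop v e" "cop u f"
      using cop_divisor uv int by (metis pidealI mult.commute)+
    then have cop: "cop (v * c) e" "cop (u * c) f" using cop_mult uv ci ce int by blast+
    obtain x where x: "x \<in> Ce" "v * c - x \<in> pideal E"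
      using C(2) ints_mult[OF uv(2) ci(1)] cop(1) unfolding residue_system_def by blast
    obtain y where y: "y \<in> Cf" "u * c - y \<in> pideal F"
      using C(3) ints_mult[OF uv(1) ci(1)] cop(2) unfolding residue_system_def by blast
    obtain r where r: "r \<in> ints" "v * c - x = r * E" using x(2) by (auto simp: pideal_iff)
    obtain s where s: "s \<in> ints" "u * c - y = s * F" using y(2) by (auto simp: pideal_iff)
    have "c - (F * x + E * y) = F * (v * c - x) + E * (u * c - y) - (u * E + v * F - 1) * c"
      by (simp add: algebra_simps)
    also have "\<dots> = (r + s) * (E * F)" using r s uv(3) by (simp add: algebra_simps)
    finally have "c - (F * x + E * y) = (r + s) * (E * F)" .
    from pidealI[OF ints_add[OF r(1) s(1)] this] have "c - (F * x + E * y) \<in> pideal (E * F)" .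
    from pideal_diff_trans[OF this conjunct2[OF \<phi>[OF x(1) y(1)]]]
    have "c - \<phi> (x, y) \<in> pideal (E * F)" .
    then have "c = \<phi> (x, y)" using residue_system_unique[OF C(1) c] \<phi>[OF x(1) y(1)] by blast
    then show "c \<in> \<phi> ` (Ce \<times> Cf)" using x y by blast
  qed (use \<phi> in auto)
  ultimately show ?thesis
    using \<phi> pideal_diff_commute unfolding bij_betw_def by (intro exI[of _ \<phi>]) blast
qed

end

section \<open>Reindexing sums over product sets\<close>

lemma bij_betw_PiE_times:
  assumes "\<And>k. k \<in> I \<Longrightarrow> bij_betw (\<phi> k) (X k \<times> Y k) (Z k)"
  shows "bij_betw (\<lambda>(x, y). \<lambda>k\<in>I. \<phi> k (x k, y k)) ((\<Pi>\<^sub>E k\<in>I. X k) \<times> (\<Pi>\<^sub>E k\<in>I. Y k)) (\<Pi>\<^sub>E k\<in>I. Z k)"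
    (is "bij_betw ?\<Phi> _ _")
proof (rule bij_betw_imageI)
  show "inj_on ?\<Phi> ((\<Pi>\<^sub>E k\<in>I. X k) \<times> (\<Pi>\<^sub>E k\<in>I. Y k))"
  proof (rule inj_onI, clarify)
    fix x y x' y'
    assume m: "x \<in> (\<Pi>\<^sub>E k\<in>I. X k)" "y \<in> (\<Pi>\<^sub>E k\<in>I. Y k)" "x' \<in> (\<Pi>\<^sub>E k\<in>I. X k)" "y' \<in> (\<Pi>\<^sub>E k\<in>I. Y k)"
      and eq: "(\<lambda>k\<in>I. \<phi> k (x k, y k)) = (\<lambda>k\<in>I. \<phi> k (x' k, y' k))"
    have "x k = x' k \<and> y k = y' k" if k: "k \<in> I" for k
    proof -
      have "\<phi> k (x k, y k) = \<phi> k (x' k, y' k)" using fun_cong[OF eq, of k] k by simp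
      then have "(x k, y k) = (x' k, y' k)"
        using bij_betw_imp_inj_on[OF assms[OF k]] m k by (auto dest!: inj_onD simp: PiE_mem)
      then show ?thesis by simp
    qed
    then show "x = x' \<and> y = y'" using m by (auto intro: PiE_ext)
  qed
  show "?\<Phi> ` ((\<Pi>\<^sub>E k\<in>I. X k) \<times> (\<Pi>\<^sub>E k\<in>I. Y k)) = (\<Pi>\<^sub>E k\<in>I. Z k)"
  proof (intro equalityI subsetI)
    fix z assume z: "z \<in> (\<Pi>\<^sub>E k\<in>I. Z k)"
    have "\<exists>w. w \<in> X k \<times> Y k \<and> \<phi> k w = z k" if k: "k \<in> I" for k
      using bij_betw_imp_surj_on[OF assms[OF k]] PiE_mem[OF z k] by (metis imageE)
    then obtain w where w: "\<And>k. k \<in> I \<Longrightarrow> w k \<in> X k \<times> Y k \<and> \<phi> k (w k) = z k" by metis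
    let ?x = "\<lambda>k\<in>I. fst (w k)" and ?y = "\<lambda>k\<in>I. snd (w k)"
    have "?x \<in> (\<Pi>\<^sub>E k\<in>I. X k)" "?y \<in> (\<Pi>\<^sub>E k\<in>I. Y k)" using w by (auto simp: mem_Times_iff)
    moreover have "z = ?\<Phi> (?x, ?y)" using w z by (auto simp: fun_eq_iff PiE_def extensional_def)
    ultimately show "z \<in> ?\<Phi> ` ((\<Pi>\<^sub>E k\<in>I. X k) \<times> (\<Pi>\<^sub>E k\<in>I. Y k))" by blast
  next
    fix z assume "z \<in> ?\<Phi> ` ((\<Pi>\<^sub>E k\<in>I. X k) \<times> (\<Pi>\<^sub>E k\<in>I. Y k))"
    then show "z \<in> (\<Pi>\<^sub>E k\<in>I. Z k)" using bij_betwE[OF assms] by (auto simp: PiE_mem)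
  qed
qed

lemma sum_times_product:
  fixes a :: "'c::comm_semiring_0"
  shows "(\<Sum>(x, y)\<in>X \<times> Y. a * (g x * h y)) = a * (sum g X * sum h Y)"
proof -
  have "sum g X * sum h Y = (\<Sum>(x, y)\<in>X \<times> Y. g x * h y)"
    by (simp add: sum_product sum.cartesian_product)
  then show ?thesis by (simp add: sum_distrib_left case_prod_unfold)
qed

section \<open>The exponential sum\<close>

locale parabolic_sum = arithmetic A + based_datum R
  for A :: "('f::number_field) arithmetic_data" and R :: "('m::finite) root_data" +
  fixes G :: "('f, 'g, 'm) pinned_group"
    and P :: parabolic_data
    and Q :: "int ^ 'm \<Rightarrow> int"
    and t :: "nat \<Rightarrow> 'f"
  assumes comin: "cominuscule_parabolic R P"
    and t_ints: "j \<in> {1..ss_rank R} \<Longrightarrow> t j \<in> ints"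
begin

abbreviation dim where "dim \<equiv> unip_dim P"
abbreviation md :: "(nat \<Rightarrow> 'f) \<Rightarrow> nat \<Rightarrow> 'f" where "md \<equiv> modulus R P"
abbreviation root where "root \<equiv> unip_root R P"
abbreviation pair where "pair k l \<equiv> pairing (unip_root R P k) (unip_coroot R P l)"

section \<open>Integrality and multiplicativity of the moduli\<close>

definition entries :: "(nat \<Rightarrow> 'f) \<Rightarrow> bool" where
  "entries x \<longleftrightarrow> (\<forall>k\<in>{1..dim}. x k \<in> ints \<and> x k \<noteq> 0)"

lemma entriesD: "entries x \<Longrightarrow> k \<in> {1..dim} \<Longrightarrow> x k \<in> ints" "entries x \<Longrightarrow> k \<in> {1..dim} \<Longrightarrow> x k \<noteq> 0"
  by (auto simp: entries_def)

text \<open>Nonnegativity of the pairings enters here: the integer powers become natural ones, which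
  makes the modulus an S-integral multiple of \<open>x k\<close>.\<close>

lemma modulus_eq_power:
  assumes "k \<in> {1..dim}"
  shows "md x k = x k * (\<Prod>l=k+1..dim. x l ^ nat (pair k l))"
proof -
  have "x l powi pair k l = x l ^ nat (pair k l)" if "l \<in> {k+1..dim}" for l
    using unip_pairing_nonneg[OF comin assms, of l] that by (simp add: power_int_def)
  then show ?thesis unfolding modulus_def by (simp cong: prod.cong_simp)
qed

lemma modulus_cofactor:
  assumes "entries x" "k \<in> {1..dim}"
  shows "(\<Prod>l=k+1..dim. x l ^ nat (pair k l)) \<in> ints"
  using entriesD(1)[OF assms(1)] assms(2) by (intro ints_prod ints_power) auto

lemma modulus_ints:
  assumes "entries x" "k \<in> {1..dim}"
  shows "md x k \<in> ints"
  using modulus_cofactor[OF assms] entriesD(1)[OF assms] by (simp add: modulus_eq_power[OF assms(2)] ints_mult)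

lemma modulus_nonzero:
  assumes "entries x" "k \<in> {1..dim}"
  shows "md x k \<noteq> 0"
  using entriesD(2)[OF assms(1)] assms(2) by (auto simp: modulus_eq_power[OF assms(2)])

lemma modulus_pideal:
  assumes "entries x" "k \<in> {1..dim}"
  shows "md x k \<in> pideal (x k)"
  using pidealI[OF modulus_cofactor[OF assms]] by (simp add: modulus_eq_power[OF assms(2)] mult.commute)

lemma modulus_cop:
  assumes "entries x" "k \<in> {1..dim}" "c \<in> ints" "\<And>l. l \<in> {1..dim} \<Longrightarrow> cop (x l) c"
  shows "cop (md x k) c"
  unfolding modulus_eq_power[OF assms(2)]
proof (rule cop_mult)
  show "cop (\<Prod>l=k+1..dim. x l ^ nat (pair k l)) c"
    using assms entriesD(1)[OF assms(1)] by (intro cop_prod cop_power ints_power) auto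
qed (use assms entriesD(1)[OF assms(1)] modulus_cofactor[OF assms(1,2)] in auto)

lemma modulus_mult:
  assumes "\<And>k. k \<in> {1..dim} \<Longrightarrow> d k = e k * f k" "k \<in> {1..dim}"
  shows "md d k = md e k * md f k"
proof -
  have "(\<Prod>l=k+1..dim. d l powi pair k l) = (\<Prod>l=k+1..dim. e l powi pair k l * f l powi pair k l)"
    using assms(1) by (intro prod.cong) (auto simp: power_int_mult_distrib)
  then show ?thesis using assms by (simp add: modulus_def prod.distrib)
qed

text \<open>In the cominuscule case the exponents \<open>i\<close> and \<open>i'\<close> are 1 and \<open>\<gamma>\<^sub>k' = \<gamma>\<^sub>k + \<alpha>\<^sub>j\<close>, so that all powers of
  the \<open>d\<^sub>l\<close> combine to \<open>D\<^sub>k / D\<^sub>k'\<close>.\<close>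

lemma v_term:
  assumes x: "entries x" and j: "j \<in> idx" "j \<noteq> omitted P" and m: "(k, k', i, i') \<in> root_pairs R P j"
  shows "(- 1) ^ (i + i') * s * (b k * inverse (x k)) ^ i * (c k' * inverse (x k')) ^ i' *
        (\<Prod>l=k..dim. inverse (x l) powi pairing (simple R j) (unip_coroot R P l)) *
        (\<Prod>l=k'+1..<k. inverse (x l) powi (int i' * pair k' l)) =
      s * (b k * md x k * (c k' / md x k'))"
proof -
  note r = root_pairs_cases[OF comin m j]
  have nz: "x l \<noteq> 0" if "l \<in> {1..dim}" for l using entriesD(2)[OF x that] .
  define a where "a = (\<Prod>l=k'+1..<k. x l powi pair k' l)"
  define B where "B = (\<Prod>l=k..dim. x l powi pair k' l)"
  define B' where "B' = (\<Prod>l=k..dim. x l powi pair k l)"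
  have nz': "a \<noteq> 0" "B \<noteq> 0" using r(1,2) nz by (auto simp: a_def B_def)
  have "{k'+1..dim} = {k'+1..<k} \<union> {k..dim}" using r by auto
  then have md': "md x k' = x k' * (a * B)"
    unfolding modulus_def a_def B_def by (simp add: prod.union_disjoint[symmetric] ivl_disj_int)
  \<comment> \<open>The index l = k contributes the square of \<open>x k\<close>: one factor belongs
    to the modulus, the other cancels the denominator under \<open>b k\<close>.\<close>
  have "pair k k = 2"
    using pairing_coroot[OF unip_root_root[OF comin r(1)]] by (simp add: unip_coroot_def)
  moreover have "{k..dim} = insert k {k+1..dim}" using r(1) by auto
  ultimately have B': "B' = x k * md x k"
    unfolding B'_def modulus_def by (simp add: power2_eq_square)
  \<comment> \<open>Because \<alpha>_j is the difference of the roots at k' and k, its powers split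
    into a numerator from k and a denominator from k'.\<close>
  have "pairing (simple R j) (unip_coroot R P l) = pair k' l - pair k l" for l
    unfolding r(6)[symmetric] by (simp add: pairing_diff_left)
  then have "(\<Prod>l=k..dim. inverse (x l) powi pairing (simple R j) (unip_coroot R P l)) =
      (\<Prod>l=k..dim. x l powi pair k l / x l powi pair k' l)"
    using nz r(1) by (intro prod.cong) (auto simp: power_int_inverse power_int_diff)
  also have "\<dots> = B' / B" by (simp add: B_def B'_def prod_dividef)
  finally have 1: "(\<Prod>l=k..dim. inverse (x l) powi pairing (simple R j) (unip_coroot R P l)) = B' / B" .
  have 2: "(\<Prod>l=k'+1..<k. inverse (x l) powi (int i' * pair k' l)) = inverse a"
    unfolding a_def r(5) by (simp add: power_int_inverse prod_inversef[symmetric])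
  have "x k \<noteq> 0" "x k' \<noteq> 0" using nz r by auto
  then show ?thesis
    unfolding 1 2 unfolding r(4,5) md' B' using nz' by (simp add: field_simps)
qed

lemma v_coord_eq:
  assumes "entries x" "j \<in> idx" "j \<noteq> omitted P"
  shows "v_coord R G P x c b j =
    (\<Sum>(k, k', i, i')\<in>root_pairs R P j. of_int (struct_const G (root k) (- root k') i i') *
       (b k * md x k * (c k' / md x k')))"
  unfolding v_coord_def using assms(3) v_term[OF assms]
  by (auto intro!: sum.cong)

lemma modulus_last: "md x dim = x dim"
  by (simp add: modulus_def)

text \<open>In the part with x_k' / E_k', the factor b_k F_k may be replaced by the choice for
  \<open>e\<close> once E_k' divides the difference. As k' ranges over all smaller indices, the
  congruence is required modulo the product of all the moduli.\<close>

lemma v_coord_split: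
  assumes e: "entries e" and f: "entries f" and d: "\<And>k. k \<in> {1..dim} \<Longrightarrow> d k = e k * f k"
    and ints: "\<And>k. k \<in> {1..dim} \<Longrightarrow> x k \<in> ints \<and> y k \<in> ints \<and> b k \<in> ints"
    and c: "\<And>k. k \<in> {1..dim} \<Longrightarrow> c k - (md f k * x k + md e k * y k) \<in> pideal (md e k * md f k)"
    and be: "\<And>k. k \<in> {1..dim} \<Longrightarrow> b k * md f k - be k \<in> pideal (\<Prod>l=1..dim. md e l)"
    and bf: "\<And>k. k \<in> {1..dim} \<Longrightarrow> b k * md e k - bf k \<in> pideal (\<Prod>l=1..dim. md f l)"
    and j: "j \<in> idx"
  shows "v_coord R G P d c b j - (v_coord R G P e x be j + v_coord R G P f y bf j) \<in> ints"
proof -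
  have md_d: "md d k = md e k * md f k" if "k \<in> {1..dim}" for k
    using modulus_mult[OF d that] .
  have entd: "entries d" using e f d by (auto simp: entries_def ints_mult)
  have frac: "c k / md d k - (x k / md e k + y k / md f k) \<in> ints" if k: "k \<in> {1..dim}" for k
  proof -
    obtain z where z: "z \<in> ints" "c k - (md f k * x k + md e k * y k) = z * (md e k * md f k)"
      using c[OF k] by (auto simp: pideal_iff)
    then have "c k = md f k * x k + md e k * y k + z * (md e k * md f k)" by (simp add: algebra_simps)
    then have "c k / md d k - (x k / md e k + y k / md f k) = z"
      using modulus_nonzero[OF e k] modulus_nonzero[OF f k] by (simp add: md_d[OF k] field_simps)
    then show ?thesis using z by simp
  qed
  have dim: "dim \<in> {1..dim}" using unip_dim_pos[OF comin] by simp
  show ?thesis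
  proof (cases "j = omitted P")
    case True
    then show ?thesis using frac[OF dim] by (simp add: v_coord_def modulus_last)
  next
    case False
    have summand: "b k * md d k * (c k' / md d k') -
        (be k * md e k * (x k' / md e k') + bf k * md f k * (y k' / md f k')) \<in> ints"
      if k: "k \<in> {1..dim}" and k': "k' \<in> {1..dim}" for k k'
    proof -
      have div: "(u - w) / md g k' \<in> ints"
        if g: "u - w \<in> pideal (\<Prod>l=1..dim. md g l)" "entries g" for u w g
      proof -
        have "(\<Prod>l=1..dim. md g l) \<in> pideal (md g k')"
          using modulus_ints[OF g(2)] k' by (intro prod_pideal) auto
        then obtain a where "a \<in> ints" "u - w = a * md g k'"
          using pideal_mono[OF g(1)] by (auto simp: pideal_iff)
        then show ?thesis using modulus_nonzero[OF g(2) k'] by simp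
      qed
      have nz: "md e k' \<noteq> 0" "md f k' \<noteq> 0"
        using modulus_nonzero[OF e k'] modulus_nonzero[OF f k'] by auto
      define z where "z = c k' / md d k' - (x k' / md e k' + y k' / md f k')"
      have "c k' / md d k' = z + x k' / md e k' + y k' / md f k'" by (simp add: z_def)
      \<comment> \<open>Three errors are separated: that of the fraction c_k' / D_k', that of b_k
        F_k over E_k', and that of b_k E_k over F_k'. Each is an S-integer times S-integers.\<close>
      then have "b k * md d k * (c k' / md d k') -
          (be k * md e k * (x k' / md e k') + bf k * md f k * (y k' / md f k')) =
          b k * md d k * z + (b k * md f k - be k) / md e k' * (md e k * x k') +
          (b k * md e k - bf k) / md f k' * (md f k * y k')"
        using nz by (simp add: md_d[OF k] add_divide_distrib diff_divide_distrib algebra_simps)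
      also have "\<dots> \<in> ints"
        using frac[OF k'] div[OF be[OF k] e] div[OF bf[OF k] f] ints[OF k] ints[OF k']
          modulus_ints[OF e k] modulus_ints[OF f k] modulus_ints[OF entd k]
        by (intro ints_add ints_mult) (auto simp: z_def)
      finally show ?thesis .
    qed
    show ?thesis
      unfolding v_coord_eq[OF e j False] v_coord_eq[OF f j False] v_coord_eq[OF entd j False]
        sum.distrib[symmetric] sum_subtractf[symmetric]
    proof (rule ints_sum, clarify)
      fix k k' i i' assume m: "(k, k', i, i') \<in> root_pairs R P j"
      note r = root_pairs_cases[OF comin m j False]
      let ?s = "of_int (struct_const G (root k) (- root k') i i')"
      have "?s * (b k * md d k * (c k' / md d k')) -
          (?s * (be k * md e k * (x k' / md e k')) + ?s * (bf k * md f k * (y k' / md f k'))) =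
          ?s * (b k * md d k * (c k' / md d k') -
            (be k * md e k * (x k' / md e k') + bf k * md f k * (y k' / md f k')))"
        by (simp add: right_diff_distrib distrib_left)
      then show "?s * (b k * md d k * (c k' / md d k')) -
          (?s * (be k * md e k * (x k' / md e k')) + ?s * (bf k * md f k * (y k' / md f k'))) \<in> ints"
        using ints_mult[OF ints_of_int summand[OF r(1,2)]] by simp
    qed
  qed
qed

lemma psi_split:
  assumes "\<And>j. j \<in> idx \<Longrightarrow> v j - (w j + w' j) \<in> ints"
  shows "psi A (\<Sum>j=1..ss_rank R. t j * v j) =
    psi A (\<Sum>j=1..ss_rank R. t j * w j) * psi A (\<Sum>j=1..ss_rank R. t j * w' j)"
proof -
  have "(\<Sum>j=1..ss_rank R. t j * v j) - ((\<Sum>j=1..ss_rank R. t j * w j) + (\<Sum>j=1..ss_rank R. t j * w' j)) =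
      (\<Sum>j=1..ss_rank R. t j * (v j - (w j + w' j)))"
    by (simp add: sum.distrib[symmetric] sum_subtractf[symmetric] algebra_simps)
  also have "\<dots> \<in> ints" using assms t_ints by (intro ints_sum ints_mult) auto
  finally show ?thesis using psi_cong psi_add by metis
qed

text \<open>Eliminating \<open>a\<close> from a d - b c = 1 leaves the congruence b c = -1 modulo
  the entry, which is easier to transport.\<close>

lemma admissible_choice_iff:
  assumes "entries x"
  shows "admissible_choice A R P x C b \<longleftrightarrow> (\<forall>k\<in>{1..dim}. residue_system (md x k) (x k) (C k) \<and>
     (\<forall>c\<in>C k. b k c \<in> ints \<and> b k c * c + 1 \<in> pideal (x k)))"
proof -
  have 1: "(\<exists>a\<in>ints. a * x k - b k c * c = 1) \<longleftrightarrow> b k c * c + 1 \<in> pideal (x k)" for k c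
    unfolding pideal_iff diff_eq_eq by (auto simp: add.commute) metis+
  have 2: "C k \<subseteq> {c \<in> ints. coprime_S A c (x k)} \<and>
        (\<forall>y\<in>ints. coprime_S A y (x k) \<longrightarrow> (\<exists>!c. c \<in> C k \<and> y - c \<in> pideal (md x k))) \<longleftrightarrow>
      residue_system (md x k) (x k) (C k)" if "k \<in> {1..dim}" for k
    using coprime_S_iff_cop[OF _ entriesD(1)[OF assms that]] unfolding residue_system_def by auto
  show ?thesis
    unfolding admissible_choice_def 1 using 2 by blast
qed

lemma admissible_choice_exists:
  assumes "entries x"
  shows "\<exists>C b. admissible_choice A R P x C b"
proof -
  define C where "C k = (SOME C. residue_system (md x k) (x k) C)" for k
  have C: "residue_system (md x k) (x k) (C k)" for k
    unfolding C_def by (rule someI_ex[OF residue_system_exists])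
  define b where "b k c = (SOME b. b \<in> ints \<and> b * c + 1 \<in> pideal (x k))" for k c
  have "b k c \<in> ints \<and> b k c * c + 1 \<in> pideal (x k)" if "c \<in> C k" for k c
  proof -
    have "cop c (x k)" using C[of k] that by (auto simp: residue_system_def)
    then obtain u v where uv: "u \<in> ints" "v \<in> ints" "u * c + v * x k = 1" by (auto simp: cop_def)
    then have "(- u) * c + 1 = v * x k" by (simp add: algebra_simps)
    then have "\<exists>b. b \<in> ints \<and> b * c + 1 \<in> pideal (x k)" using uv pidealI ints_minus by blast
    then show ?thesis unfolding b_def by (rule someI_ex)
  qed
  then show ?thesis using C unfolding admissible_choice_iff[OF assms] by blast
qed

text \<open>As e_k divides E_k, the terms E_k y and the multiple of E_k F_k vanish modulo e_k,
  leaving F_k x; symmetrically modulo f_k.\<close>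

lemma symb_split:
  assumes e: "entries e" and f: "entries f" and cop: "\<And>k l. k \<in> {1..dim} \<Longrightarrow> l \<in> {1..dim} \<Longrightarrow> cop (e k) (f l)"
    and k: "k \<in> {1..dim}" and xy: "x \<in> ints" "y \<in> ints" "cop x (e k)" "cop y (f k)"
    and c: "c \<in> ints" "c - (md f k * x + md e k * y) \<in> pideal (md e k * md f k)"
  shows "symb A c (e k * f k) =
    symb A (md e k) (f k) * symb A (md f k) (e k) * (symb A x (e k) * symb A y (f k))"
proof -
  note ei = entriesD[OF e k] and fi = entriesD[OF f k] and Ei = modulus_ints[OF e k] and Fi = modulus_ints[OF f k]
  have copE: "cop (md e k) (f k)" using modulus_cop[OF e k fi(1)] cop k by blast
  have copF: "cop (md f k) (e k)" using modulus_cop[OF f k ei(1)] cop k cop_commute by blast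
  obtain z where z: "z \<in> ints" "c - (md f k * x + md e k * y) = z * (md e k * md f k)"
    using c(2) by (auto simp: pideal_iff)
  have "c - md f k * x = (y + z * md f k) * md e k" "c - md e k * y = (x + z * md e k) * md f k"
    using z(2) by (simp_all add: algebra_simps)
  then have "c - md f k * x \<in> pideal (md e k)" "c - md e k * y \<in> pideal (md f k)"
    using z(1) xy Ei Fi by (metis pidealI ints_add ints_mult)+
  then have ce: "c - md f k * x \<in> pideal (e k)" and cf: "c - md e k * y \<in> pideal (f k)"
    using pideal_mono modulus_pideal[OF e k] modulus_pideal[OF f k] by blast+
  have Fx: "cop (md f k * x) (e k)" and Ey: "cop (md e k * y) (f k)"
    using copE copF xy Ei Fi ei fi by (simp_all add: cop_mult)
  have cope: "cop c (e k)" "cop c (f k)"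
    using cop_cong[OF Fx] cop_cong[OF Ey] ce cf pideal_diff_commute by blast+
  have "symb A c (e k * f k) = symb A c (e k) * symb A c (f k)"
    using symb_mult_right c(1) ei fi cope by blast
  also have "symb A c (e k) = symb A (md f k) (e k) * symb A x (e k)"
    using symb_cong[OF c(1) _ ei ce] symb_mult_left[OF Fi xy(1) ei copF xy(3)] Fi xy by (simp add: ints_mult)
  also have "symb A c (f k) = symb A (md e k) (f k) * symb A y (f k)"
    using symb_cong[OF c(1) _ fi cf] symb_mult_left[OF Ei xy(2) fi copE xy(4)] Ei xy by (simp add: ints_mult)
  finally show ?thesis by (simp add: mult_ac)
qed

section \<open>Twisted multiplicativity\<close>

definition twist :: "(nat \<Rightarrow> 'f) \<Rightarrow> (nat \<Rightarrow> 'f) \<Rightarrow> complex" where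
  "twist e f = (\<Prod>k=1..dim. symb A (md e k) (f k) powi Q (unip_coroot R P k) *
                 symb A (md f k) (e k) powi Q (unip_coroot R P k))"

text \<open>Every choice is arbitrary except the solutions for \<open>d\<close>, which are
  constructed. The given \<open>b0\<close> serves only to certify that \<open>C\<close> consists of
  residue systems.\<close>

lemma exp_sum_twisted_multiplicative:
  assumes e: "entries e" and f: "entries f" and d: "\<And>k. k \<in> {1..dim} \<Longrightarrow> d k = e k * f k"
    and cop: "\<And>k l. k \<in> {1..dim} \<Longrightarrow> l \<in> {1..dim} \<Longrightarrow> cop (e k) (f l)"
    and Cd: "admissible_choice A R P d C b0"
    and Ce: "admissible_choice A R P e Ce be" and Cf: "admissible_choice A R P f Cf bf"
  shows "\<exists>b. admissible_choice A R P d C b \<and>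
    exp_sum A R G Q P C b d t =
      twist e f * exp_sum A R G Q P Ce be e t * exp_sum A R G Q P Cf bf f t"
proof -
  have entd: "entries d" using e f d by (auto simp: entries_def ints_mult)
  have md_d: "md d k = md e k * md f k" if "k \<in> {1..dim}" for k
    using modulus_mult[OF d that] .
  note Cd' = Cd[unfolded admissible_choice_iff[OF entd]]
  note Ce' = Ce[unfolded admissible_choice_iff[OF e]]
  note Cf' = Cf[unfolded admissible_choice_iff[OF f]]
  have copEf: "cop (md e k) (f l)" if "k \<in> {1..dim}" "l \<in> {1..dim}" for k l
    using modulus_cop[OF e that(1) entriesD(1)[OF f that(2)]] cop that by blast
  have copEF: "cop (md e k) (md f l)" if "k \<in> {1..dim}" "l \<in> {1..dim}" for k l
    using modulus_cop[OF f that(2) modulus_ints[OF e that(1)]] copEf that cop_commute by blast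
  have "\<exists>\<phi>. bij_betw \<phi> (Ce k \<times> Cf k) (C k) \<and> (\<forall>x\<in>Ce k. \<forall>y\<in>Cf k.
      \<phi> (x, y) - (md f k * x + md e k * y) \<in> pideal (md e k * md f k))" if k: "k \<in> {1..dim}" for k
    using bspec[OF Cd' k, unfolded md_d[OF k] d[OF k]] bspec[OF Ce' k] bspec[OF Cf' k] modulus_ints[OF e k] modulus_ints[OF f k]
      entriesD(1)[OF e k] entriesD(1)[OF f k] copEF[OF k k] modulus_pideal[OF e k] modulus_pideal[OF f k]
    by (intro residue_system_crt) auto
  then obtain \<phi> where bij: "\<And>k. k \<in> {1..dim} \<Longrightarrow> bij_betw (\<phi> k) (Ce k \<times> Cf k) (C k)"
    and \<phi>: "\<And>k x y. k \<in> {1..dim} \<Longrightarrow> x \<in> Ce k \<Longrightarrow> y \<in> Cf k \<Longrightarrow>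
      \<phi> k (x, y) - (md f k * x + md e k * y) \<in> pideal (md e k * md f k)"
    by metis
  let ?E = "\<Prod>l=1..dim. md e l" and ?F = "\<Prod>l=1..dim. md f l"
  have Ei: "?E \<in> ints" and Fi: "?F \<in> ints" using modulus_ints e f by (auto intro: ints_prod)
  have copF: "cop (md f k) ?E" and copE: "cop (md e k) ?F" if "k \<in> {1..dim}" for k
    using copEF that modulus_ints e f cop_commute by (auto intro!: cop_commute[OF cop_prod])
  have copEFp: "cop ?E ?F" using copE Fi modulus_ints[OF e] by (intro cop_prod) auto
  have dvdE: "?E \<in> pideal (e k)" if k: "k \<in> {1..dim}" for k
  proof -
    have "?E \<in> pideal (md e k)"
      using modulus_ints[OF e] k by (intro prod_pideal) auto
    then show ?thesis using pideal_mono modulus_pideal[OF e k] by blast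
  qed
  have dvdF: "?F \<in> pideal (f k)" if k: "k \<in> {1..dim}" for k
  proof -
    have "?F \<in> pideal (md f k)"
      using modulus_ints[OF f] k by (intro prod_pideal) auto
    then show ?thesis using pideal_mono modulus_pideal[OF f k] by blast
  qed
  \<comment> \<open>Invert F_k modulo the product of the E_l and E_k modulo the product of the F_l,
    then glue the two solutions.\<close>
  have ex_b: "\<exists>b. b \<in> ints \<and> b * md f k - s \<in> pideal ?E \<and> b * md e k - s' \<in> pideal ?F"
    if k: "k \<in> {1..dim}" and s: "s \<in> ints" "s' \<in> ints" for k s s'
  proof -
    obtain z where z: "z \<in> ints" "z * md f k - s \<in> pideal ?E" using solve_congruence[OF copF[OF k] s(1)] .
    obtain w where w: "w \<in> ints" "w * md e k - s' \<in> pideal ?F" using solve_congruence[OF copE[OF k] s(2)] .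
    obtain b where b: "b \<in> ints" "b - z \<in> pideal ?E" "b - w \<in> pideal ?F"
      using chinese_remainder[OF copEFp z(1) w(1) Ei Fi] .
    have "b * md f k - z * md f k \<in> pideal ?E" "b * md e k - w * md e k \<in> pideal ?F"
      using pideal_mult[OF modulus_ints[OF f k] b(2)] pideal_mult[OF modulus_ints[OF e k] b(3)]
      by (simp_all add: algebra_simps)
    then show ?thesis using z w b(1) pideal_diff_trans by blast
  qed
  \<comment> \<open>An admissible choice makes b_k a function of c_k alone, so the pair (x, y)
    behind a residue is recovered by inverting the bijection.\<close>
  define \<iota> where "\<iota> k = inv_into (Ce k \<times> Cf k) (\<phi> k)" for k
  define b where "b k c = (SOME b. b \<in> ints \<and> b * md f k - be k (fst (\<iota> k c)) \<in> pideal ?E \<and>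
      b * md e k - bf k (snd (\<iota> k c)) \<in> pideal ?F)" for k c
  have b: "b k (\<phi> k (x, y)) \<in> ints" "b k (\<phi> k (x, y)) * md f k - be k x \<in> pideal ?E"
      "b k (\<phi> k (x, y)) * md e k - bf k y \<in> pideal ?F"
    if "k \<in> {1..dim}" "x \<in> Ce k" "y \<in> Cf k" for k x y
  proof -
    have \<iota>: "\<iota> k (\<phi> k (x, y)) = (x, y)"
      unfolding \<iota>_def using bij_betw_imp_inj_on[OF bij[OF that(1)]] that by (intro inv_into_f_f) auto
    have "be k x \<in> ints" "bf k y \<in> ints" using Ce' Cf' that by auto
    from someI_ex[OF ex_b[OF that(1) this]]
    show "b k (\<phi> k (x, y)) \<in> ints" "b k (\<phi> k (x, y)) * md f k - be k x \<in> pideal ?E"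
      "b k (\<phi> k (x, y)) * md e k - bf k y \<in> pideal ?F"
      by (simp_all add: b_def \<iota>)
  qed
  have in_C: "\<phi> k (x, y) \<in> C k" if "k \<in> {1..dim}" "x \<in> Ce k" "y \<in> Cf k" for k x y
    using bij_betwE[OF bij[OF that(1)]] that by blast
  have C_ints: "c \<in> ints" if "k \<in> {1..dim}" "c \<in> C k" for k c
    using Cd' that by (auto simp: residue_system_def)
  have Ce_ints: "x \<in> ints" "cop x (e k)" if "k \<in> {1..dim}" "x \<in> Ce k" for k x
    using Ce' that by (auto simp: residue_system_def)
  have Cf_ints: "y \<in> ints" "cop y (f k)" if "k \<in> {1..dim}" "y \<in> Cf k" for k y
    using Cf' that by (auto simp: residue_system_def)
  have adm: "admissible_choice A R P d C b"
    unfolding admissible_choice_iff[OF entd]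
  proof (intro ballI conjI)
    fix k assume k: "k \<in> {1..dim}"
    show "residue_system (md d k) (d k) (C k)" using Cd' k by blast
    fix c assume c: "c \<in> C k"
    then obtain x y where xy: "x \<in> Ce k" "y \<in> Cf k" "c = \<phi> k (x, y)"
      using bij_betw_imp_surj_on[OF bij[OF k]] by blast
    note bk = b[OF k xy(1,2), folded xy(3)]
    show "b k c \<in> ints" by (rule bk(1))
    have ci: "c \<in> ints" using C_ints[OF k c] .
    have ei: "e k \<in> ints" and fi: "f k \<in> ints" using entriesD(1) e f k by auto
    have E: "md e k \<in> ints" and F: "md f k \<in> ints" using modulus_ints e f k by auto
    obtain z where z: "z \<in> ints" "c - (md f k * x + md e k * y) = z * (md e k * md f k)"
      using \<phi>[OF k xy(1,2)] xy(3) by (auto simp: pideal_iff)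
    have bxe: "be k x \<in> ints" "be k x * x + 1 \<in> pideal (e k)" using Ce' k xy by auto
    have byf: "bf k y \<in> ints" "bf k y * y + 1 \<in> pideal (f k)" using Cf' k xy by auto
    \<comment> \<open>Modulo e_k the first two summands vanish, by the congruences for b_k and c_k,
      and the third by admissibility of \<open>be\<close>. The factor F_k is coprime to e_k and is
      cancelled afterwards.\<close>
    have "md f k * (b k c * c + 1) =
        (b k c * md f k - be k x) * c + be k x * (c - md f k * x) + md f k * (be k x * x + 1)"
      by (simp add: algebra_simps)
    moreover have "c - md f k * x = (y + z * md f k) * md e k" using z(2) by (simp add: algebra_simps)
    then have "c - md f k * x \<in> pideal (e k)"
      using pideal_mono[OF pidealI modulus_pideal[OF e k]] z(1) Cf_ints[OF k xy(2)] F ints_add ints_mult by metis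
    moreover have "(b k c * md f k - be k x) * c \<in> pideal (e k)"
      using pideal_mult[OF ci pideal_mono[OF bk(2) dvdE[OF k]]] by (simp add: mult.commute)
    ultimately have "md f k * (b k c * c + 1) \<in> pideal (e k)"
      using bxe F by (simp add: pideal_add pideal_mult)
    then have 1: "b k c * c + 1 \<in> pideal (e k)"
      using cop_cancel[OF cop_commute[OF cop_divisor[OF copEF[OF k k] modulus_pideal[OF e k]]]] ci bk(1)
      by (simp add: ints_add ints_mult ints_1)
    have "md e k * (b k c * c + 1) =
        (b k c * md e k - bf k y) * c + bf k y * (c - md e k * y) + md e k * (bf k y * y + 1)"
      by (simp add: algebra_simps)
    moreover have "c - md e k * y = (x + z * md e k) * md f k" using z(2) by (simp add: algebra_simps)
    then have "c - md e k * y \<in> pideal (f k)"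
      using pideal_mono[OF pidealI modulus_pideal[OF f k]] z(1) Ce_ints[OF k xy(1)] E ints_add ints_mult by metis
    moreover have "(b k c * md e k - bf k y) * c \<in> pideal (f k)"
      using pideal_mult[OF ci pideal_mono[OF bk(3) dvdF[OF k]]] by (simp add: mult.commute)
    ultimately have "md e k * (b k c * c + 1) \<in> pideal (f k)"
      using byf E by (simp add: pideal_add pideal_mult)
    then have 2: "b k c * c + 1 \<in> pideal (f k)"
      using cop_cancel[OF copEf[OF k k]] ci bk(1) by (simp add: ints_add ints_mult ints_1)
    show "b k c * c + 1 \<in> pideal (d k)"
      unfolding d[OF k] using pideal_coprime_mult[OF 1 2 cop[OF k k]] .
  qed
  let ?X = "\<Pi>\<^sub>E k\<in>{1..dim}. Ce k" and ?Y = "\<Pi>\<^sub>E k\<in>{1..dim}. Cf k" and ?Z = "\<Pi>\<^sub>E k\<in>{1..dim}. C k"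
  let ?\<Phi> = "\<lambda>(x, y). \<lambda>k\<in>{1..dim}. \<phi> k (x k, y k)"
  let ?g = "\<lambda>d b c. psi A (\<Sum>j=1..ss_rank R. t j * v_coord R G P d c (\<lambda>k. b k (c k)) j) *
        (\<Prod>k=1..dim. symb A (c k) (d k) powi Q (unip_coroot R P k))"
  have split: "?g d b (?\<Phi> (x, y)) = twist e f * (?g e be x * ?g f bf y)" if x: "x \<in> ?X" and y: "y \<in> ?Y" for x y
  proof -
    define c where "c = ?\<Phi> (x, y)"
    have ck: "c k = \<phi> k (x k, y k)" if "k \<in> {1..dim}" for k using that by (simp add: c_def)
    have xk: "x k \<in> Ce k" and yk: "y k \<in> Cf k" if "k \<in> {1..dim}" for k using x y that by auto
    have "v_coord R G P d c (\<lambda>k. b k (c k)) j -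
        (v_coord R G P e x (\<lambda>k. be k (x k)) j + v_coord R G P f y (\<lambda>k. bf k (y k)) j) \<in> ints"
      if "j \<in> idx" for j
      using ck xk yk b \<phi> Ce_ints(1) Cf_ints(1) by (intro v_coord_split[OF e f d _ _ _ _ that]) auto
    then have psi: "psi A (\<Sum>j=1..ss_rank R. t j * v_coord R G P d c (\<lambda>k. b k (c k)) j) =
        psi A (\<Sum>j=1..ss_rank R. t j * v_coord R G P e x (\<lambda>k. be k (x k)) j) *
        psi A (\<Sum>j=1..ss_rank R. t j * v_coord R G P f y (\<lambda>k. bf k (y k)) j)"
      by (rule psi_split)
    have "symb A (c k) (d k) = symb A (md e k) (f k) * symb A (md f k) (e k) *
        (symb A (x k) (e k) * symb A (y k) (f k))" if k: "k \<in> {1..dim}" for k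
      unfolding d[OF k] ck[OF k]
      using symb_split[OF e f cop k] Ce_ints[OF k xk[OF k]] Cf_ints[OF k yk[OF k]]
        C_ints[OF k in_C[OF k xk[OF k] yk[OF k]]] \<phi>[OF k xk[OF k] yk[OF k]] by blast
    then have "(\<Prod>k=1..dim. symb A (c k) (d k) powi Q (unip_coroot R P k)) =
        twist e f * ((\<Prod>k=1..dim. symb A (x k) (e k) powi Q (unip_coroot R P k)) *
        (\<Prod>k=1..dim. symb A (y k) (f k) powi Q (unip_coroot R P k)))"
      unfolding twist_def prod.distrib[symmetric]
      by (intro prod.cong) (auto simp: power_int_mult_distrib)
    then show ?thesis unfolding c_def[symmetric] psi by (simp add: mult_ac)
  qed
  have "exp_sum A R G Q P C b d t = (\<Sum>c\<in>?Z. ?g d b c)"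
    by (simp add: exp_sum_def)
  also have "\<dots> = (\<Sum>w\<in>?X \<times> ?Y. ?g d b (?\<Phi> w))"
    using bij_betw_PiE_times[of "{1..dim}" \<phi> Ce Cf C, OF bij] by (rule sum.reindex_bij_betw[symmetric])
  also have "\<dots> = (\<Sum>(x, y)\<in>?X \<times> ?Y. twist e f * (?g e be x * ?g f bf y))"
    using split by (intro sum.cong) (auto simp del: restrict_apply)
  also have "\<dots> = twist e f * ((\<Sum>x\<in>?X. ?g e be x) * (\<Sum>y\<in>?Y. ?g f bf y))"
    by (rule sum_times_product)
  finally have "exp_sum A R G Q P C b d t = twist e f * exp_sum A R G Q P Ce be e t * exp_sum A R G Q P Cf bf f t"
    by (simp add: exp_sum_def mult.assoc)
  then show ?thesis using adm by blast
qed

end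

text \<open>The sum for \<open>d\<close> may vary with the \<open>b\<close>'s, so the general
  identity asserts a suitable \<open>b\<close> for given data on the other side. The identity
  between values of \<open>H_sum\<close> is the case where the sum for \<open>d\<close> is
  independent of the choices.\<close>

theorem theorem6p5:
  fixes A :: "('f::number_field) arithmetic_data"
    and R :: "('m::finite) root_data"
    and G :: "('f, 'g, 'm) pinned_group"
    and P :: parabolic_data
    and Q :: "int ^ 'm \<Rightarrow> int"
    and d e f t :: "nat \<Rightarrow> 'f"
  assumes "arithmetic_setting A"
    and "split_reductive_group R G"
    and "cominuscule_parabolic R P"
    and "invariant_quadratic_form R Q"
    and "\<forall>k\<in>{1..unip_dim P}. e k \<in> carrier (oS A) \<and> e k \<noteq> 0"
    and "\<forall>k\<in>{1..unip_dim P}. f k \<in> carrier (oS A) \<and> f k \<noteq> 0"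
    and "\<forall>k\<in>{1..unip_dim P}. d k = e k * f k"
    and "coprime_S A (\<Prod>k=1..unip_dim P. e k) (\<Prod>k=1..unip_dim P. f k)"
    and "\<forall>j\<in>{1..ss_rank R}. t j \<in> carrier (oS A) \<and> t j \<noteq> 0"
  shows "(H_well_defined A R G Q P d t \<longrightarrow>
            H_sum A R G Q P d t =
              (\<Prod>k=1..unip_dim P.
                 symb A (modulus R P e k) (f k) powi Q (unip_coroot R P k) *
                 symb A (modulus R P f k) (e k) powi Q (unip_coroot R P k)) *
              H_sum A R G Q P e t * H_sum A R G Q P f t) \<and>
         (\<forall>C Ce be Cf bf.
            (\<exists>b. admissible_choice A R P d C b) \<and>
            admissible_choice A R P e Ce be \<and> admissible_choice A R P f Cf bf \<longrightarrow>
            (\<exists>b. admissible_choice A R P d C b \<and>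
               exp_sum A R G Q P C b d t =
                 (\<Prod>k=1..unip_dim P.
                    symb A (modulus R P e k) (f k) powi Q (unip_coroot R P k) *
                    symb A (modulus R P f k) (e k) powi Q (unip_coroot R P k)) *
                 exp_sum A R G Q P Ce be e t * exp_sum A R G Q P Cf bf f t))"
proof -
  interpret parabolic_sum A R G P Q t
    using assms(1-3,9) by unfold_locales (auto simp: split_reductive_group_def)
  have e: "entries e" and f: "entries f" using assms(5,6) by (auto simp: entries_def)
  have d: "d k = e k * f k" if "k \<in> {1..dim}" for k using assms(7) that by blast
  have entd: "entries d" using e f d by (auto simp: entries_def ints_mult)
  have ints: "(\<Prod>k=1..dim. e k) \<in> ints" "(\<Prod>k=1..dim. f k) \<in> ints"
    using entriesD(1) e f by (auto intro: ints_prod)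
  have divisor: "(\<Prod>k=1..dim. g k) \<in> pideal (g k)" if "k \<in> {1..dim}" "entries g" for g k
    using entriesD(1)[OF that(2)] that(1) by (intro prod_pideal) auto
  have copef: "cop (\<Prod>k=1..dim. e k) (\<Prod>k=1..dim. f k)"
    using assms(8) coprime_S_iff_cop[OF ints] by simp
  have cop: "cop (e k) (f l)" if "k \<in> {1..dim}" "l \<in> {1..dim}" for k l
    using cop_divisor[OF cop_commute[OF cop_divisor[OF copef divisor[OF that(1) e]]] divisor[OF that(2) f]]
    by (rule cop_commute)
  note main = exp_sum_twisted_multiplicative[OF e f d cop]
  have H: "\<exists>C b. admissible_choice A R P x C b \<and> H_sum A R G Q P x t = exp_sum A R G Q P C b x t"
    if "entries x" for x
    unfolding H_sum_def by (rule someI_ex) (use admissible_choice_exists[OF that] in blast)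
  have "H_sum A R G Q P d t = twist e f * H_sum A R G Q P e t * H_sum A R G Q P f t"
    if wd: "H_well_defined A R G Q P d t"
  proof -
    obtain C b where C: "admissible_choice A R P d C b" "H_sum A R G Q P d t = exp_sum A R G Q P C b d t"
      using H[OF entd] by blast
    obtain Ce be where Ce: "admissible_choice A R P e Ce be" "H_sum A R G Q P e t = exp_sum A R G Q P Ce be e t"
      using H[OF e] by blast
    obtain Cf bf where Cf: "admissible_choice A R P f Cf bf" "H_sum A R G Q P f t = exp_sum A R G Q P Cf bf f t"
      using H[OF f] by blast
    obtain b' where "admissible_choice A R P d C b'" "exp_sum A R G Q P C b' d t =
        twist e f * exp_sum A R G Q P Ce be e t * exp_sum A R G Q P Cf bf f t"
      using main[OF _ _ _ C(1) Ce(1) Cf(1)] by blast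
    \<comment> \<open>Well-definedness for \<open>d\<close> replaces the solutions chosen inside
      \<open>H_sum\<close> by the constructed ones; for \<open>e\<close> and \<open>f\<close> the
      chosen data are used directly.\<close>
    moreover have "exp_sum A R G Q P C b d t = exp_sum A R G Q P C b' d t"
      using wd C(1) calculation(1) unfolding H_well_defined_def by blast
    ultimately show ?thesis using C(2) Ce(2) Cf(2) by simp
  qed
  then show ?thesis
    using main unfolding twist_def by blast
qed

end
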